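(* There exist $\delta_0>0$ and a constant $C_0>0$ (the constant entering the definition of the tube $U^\delta$) such that for all $0<\delta\le\delta_0$ and for each $B^\delta\in\partial U^\delta$ satisfying $$W_\delta(A^\delta,B^\delta)=\inf_{E\in\partial U^\delta}W_\delta(A^\delta,E),$$ writing $\varphi_{B^\delta}:=p_\delta(B^\delta)$, one has either $\varphi_{B^\delta}=\varphi_{A^\delta}-\Delta_1$ or $\varphi_{B^\delta}=\varphi_{A^\delta}+\Delta_2$, and $$W_\delta(A^\delta,B^\delta)=W^{red}_\delta(\varphi_{A^\delta},\varphi_{B^\delta})+O(\delta^3|\log\delta|^3),$$ where the constant in $O(\cdot)$ is independent of $\delta$.
   Context: Setting. $\langle\cdot,\cdot\rangle$, $\|\cdot\|$ are the Euclidean scalar product and norm on $\mathbb R^n$, and $\mathrm{dist}$ is the associated distance. $V\in C^4(\mathbb R^n,\mathbb R)$, $G\in C^2(\mathbb R^n,\mathbb R^n)$, and $H[X]$ is the Hessian matrix of $V$ at $X$. $M\subset\mathbb R^n$ is a compact simple closed curve of class $C^3$ with $\nabla V=0$ and $V=0$ on $M$, and there is $\lambda>0$ such that for all $X\in M$, all $v$ tangent to $M$ at $X$ and all $w$ orthogonal to the tangent line at $X$: $H[X]v=0$ and $\langle H[X]w,w\rangle\ge\lambda\|w\|^2$. $L$ is the length of $M$ and $q:\mathbb R/L\mathbb R\to M$ is a parametrization with $\|q'(\theta)\|=1$. Perturbed curve. For $\delta>0$ consider the flow $\dot X=-\nabla V[X]+\delta G[X]$. By the persistence theorem for normally hyperbolic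 manifolds, for all small $\delta$ there is a $C^2$ map $\phi_\delta:\mathbb R/L\mathbb R\to\mathbb R^n$ with $\langle\phi_\delta(\theta),q'(\theta)\rangle=0$ and $\sup_\theta\{\|\phi_\delta(\theta)\|,\|\phi_\delta'(\theta)\|,\|\phi_\delta''(\theta)\|\}=O(\delta)$ such that, with $\tilde q_\delta(\theta):=q(\theta)+\phi_\delta(\theta)$, the curve $M^\delta=\{\tilde q_\delta(\theta):\theta\in\mathbb R/L\mathbb R\}$ is an invariant, stable normally hyperbolic manifold of this flow. $L_\delta$ is the length of $M^\delta$ and $q_\delta:\mathbb R/L_\delta\mathbb R\to M^\delta$ is a parametrization with $\|q_\delta'(\varphi)\|=1$ (with the same orientation as $\tilde q_\delta$). For $Z$ close to $M^\delta$, $p_\delta(Z)$ is the unique $\varphi\in\mathbb R/L_\delta\mathbb R$ with $\|Z-q_\delta(\varphi)\|=\mathrm{dist}(Z,M^\delta)$. Reduced dynamics. Let $b(\theta)=\delta\langle G[q(\theta)],q'(\theta)\rangle$ and $b_\delta(\varphi)=\langle-\nabla V[q_\delta(\varphi)]+\delta G[q_\delta(\varphi)],q_\delta'(\varphi)\rangle$. It is assumed that $b$ has a stable fixed point $\theta^0$ ($b(\theta^0)=0$, $b'(\theta^0)<0$), and $\Delta_1,\Delta_2>0$ are such that $[\theta^0-\Delta_1,\theta^0+\Delta_2]$ is contained in the basin of attraction of $\theta^0$ for $\dot\theta=b(\theta)$. For $\delta$ small, the flow on $M^\delta$ has a stable hyperbolic fixed point $A^\delta=\tilde q_\delta(\theta^\delta_0)=q_\delta(\varphi_{A^\delta})$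 with $|\theta_0^\delta-\theta^0|=O(\delta)$, and $[\varphi_{A^\delta}-\Delta_1,\varphi_{A^\delta}+\Delta_2]$ is contained in the basin of attraction of $\varphi_{A^\delta}$ for $\dot\varphi=b_\delta(\varphi)$; $A^\delta$ is a stable fixed point of the perturbed flow in $\mathbb R^n$. Quasipotentials. For $P_1,P_2\in\mathbb R^n$, $$W_\delta(P_1,P_2)=\inf\Big\{\tfrac12\int_T^0\|\dot Y_t+\nabla V[Y_t]-\delta G[Y_t]\|^2dt\Big\},$$ over $T<0$ and absolutely continuous $Y:[T,0]\to\mathbb R^n$ with $Y_T=P_1$, $Y_0=P_2$. For $\varphi_1,\varphi_2\in\mathbb R/L_\delta\mathbb R$, $$W^{red}_\delta(\varphi_1,\varphi_2)=\inf\Big\{\tfrac12\int_T^0|\dot\varphi_t-b_\delta(\varphi_t)|^2dt\Big\},$$ over $T<0$ and absolutely continuous $\varphi:[T,0]\to\mathbb R/L_\delta\mathbb R$ with $\varphi_T=\varphi_1$, $\varphi_0=\varphi_2$. Tube. For a constant $C_0>0$, $$U^\delta=\{Z\in\mathbb R^n:\ \mathrm{dist}(Z,M^\delta)\le C_0\delta^{1/2},\ p_\delta(Z)\in[\varphi_{A^\delta}-\Delta_1,\varphi_{A^\delta}+\Delta_2]\}.$$ *)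

theory Defs
  imports "HOL-Analysis.Analysis" "HOL-Library.Landau_Symbols" "HOL-Library.Real_Mod"
begin

text \<open>
  The circle \<open>\<real>/L\<int>\<close> is handled through lifts: a map on it is an \<open>L\<close>-periodic map on
  \<^typ>\<open>real\<close>, a path in it is given by a real-valued lift, and equality of two of its points is
  \<open>[x = y] (rmod L)\<close>.
\<close>

subsection \<open>Regularity, gradient, Hessian\<close>

text \<open>
  Class \<open>C\<^sup>k\<close> on a whole finite-dimensional space: all iterated directional derivatives up to
  order \<open>k\<close> exist and are continuous.
\<close>
primrec C_k :: "nat \<Rightarrow> ('a::euclidean_space \<Rightarrow> 'b::real_normed_vector) \<Rightarrow> bool" where
  "C_k 0 f \<longleftrightarrow> continuous_on UNIV f"
| "C_k (Suc k) f \<longleftrightarrow> (\<forall>x. f differentiable (at x)) \<and>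
     (\<forall>v. C_k k (\<lambda>x. frechet_derivative f (at x) v))"

definition grad :: "('a::real_inner \<Rightarrow> real) \<Rightarrow> 'a \<Rightarrow> 'a" where
  "grad V x = (THE D. GDERIV V x :> D)"

definition hessian :: "(real^'n \<Rightarrow> real) \<Rightarrow> real^'n \<Rightarrow> real^'n^'n" where
  "hessian V x = jacobian (grad V) (at x)"

definition perturbed_field :: "(real^'n \<Rightarrow> real) \<Rightarrow> (real^'n \<Rightarrow> real^'n) \<Rightarrow> real \<Rightarrow> real^'n \<Rightarrow> real^'n" where
  "perturbed_field V G \<delta> x = - grad V x + \<delta> *\<^sub>R G x"

subsection \<open>Closed curves\<close>

abbreviation velocity :: "(real \<Rightarrow> 'a::real_normed_vector) \<Rightarrow> real \<Rightarrow> 'a" where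
  "velocity c s \<equiv> vector_derivative c (at s)"

definition unit_speed_closed_curve :: "nat \<Rightarrow> real \<Rightarrow> (real \<Rightarrow> 'a::real_normed_vector) \<Rightarrow> bool" where
  "unit_speed_closed_curve k L c \<longleftrightarrow> L > 0 \<and> C_k k c \<and> (\<forall>s. c (s + L) = c s) \<and>
     inj_on c {0..<L} \<and> (\<forall>s. norm (velocity c s) = 1)"

definition curve_length :: "real \<Rightarrow> (real \<Rightarrow> 'a::real_normed_vector) \<Rightarrow> real" where
  "curve_length L c = integral {0..L} (\<lambda>s. norm (velocity c s))"

text \<open>
  \<open>c'\<close> is a unit-speed parametrization, with the same orientation, of the closed curve
  parametrized by the \<open>L\<close>-periodic map \<open>c\<close>; \<open>L'\<close> is the length of that curve.
\<close>
definition unit_speed_reparametrization ::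
    "real \<Rightarrow> (real \<Rightarrow> 'a::real_inner) \<Rightarrow> real \<Rightarrow> (real \<Rightarrow> 'a) \<Rightarrow> bool" where
  "unit_speed_reparametrization L c L' c' \<longleftrightarrow>
     L' = curve_length L c \<and> unit_speed_closed_curve 2 L' c' \<and> range c' = range c \<and>
     (\<forall>s s'. c s = c' s' \<longrightarrow> velocity c s \<bullet> velocity c' s' > 0)"

text \<open>
  The representative in \<open>[0, L)\<close> of the parameter of the point of the curve nearest to \<open>Z\<close>;
  meaningful only where that point is unique.
\<close>
definition proj_param :: "real \<Rightarrow> (real \<Rightarrow> 'a::real_normed_vector) \<Rightarrow> 'a \<Rightarrow> real" where
  "proj_param L c Z = (THE s. 0 \<le> s \<and> s < L \<and> norm (Z - c s) = infdist Z (range c))"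

definition tube :: "real \<Rightarrow> (real \<Rightarrow> 'a::real_normed_vector) \<Rightarrow> real \<Rightarrow> real \<Rightarrow> real \<Rightarrow> 'a set" where
  "tube L c r lo hi = {Z. infdist Z (range c) \<le> r \<and> (\<exists>s\<in>{lo..hi}. [proj_param L c Z = s] (rmod L))}"

subsection \<open>Dynamics\<close>

definition solves :: "(real \<Rightarrow> 'a::real_normed_vector) \<Rightarrow> ('a \<Rightarrow> 'a) \<Rightarrow> real set \<Rightarrow> bool" where
  "solves u F I \<longleftrightarrow> (\<forall>t\<in>I. (u has_vector_derivative F (u t)) (at t within I))"

text \<open>
  All uses concern locally Lipschitz fields, for which the orbit through a point is unique.
\<close>
definition flow_invariant :: "('a::real_normed_vector \<Rightarrow> 'a) \<Rightarrow> 'a set \<Rightarrow> bool" where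
  "flow_invariant F M \<longleftrightarrow> (\<forall>x\<in>M. \<exists>u. solves u F UNIV \<and> u 0 = x \<and> range u \<subseteq> M)"

text \<open>
  \<open>P\<close> is the family of projections onto the tangent lines belonging to the splitting into
  tangent and stable directions.  It commutes with the linearized flow \<open>v' = DF(u) v\<close> along every
  orbit \<open>u\<close> in the curve; under that flow the tangent part grows backwards at rate at most
  \<open>\<mu>1\<close>, and the complementary part decays forwards at the larger rate \<open>\<mu>2\<close>.
\<close>
definition stable_normally_hyperbolic ::
    "('a::euclidean_space \<Rightarrow> 'a) \<Rightarrow> (real \<Rightarrow> 'a) \<Rightarrow> bool" where
  "stable_normally_hyperbolic F c \<longleftrightarrow>
     flow_invariant F (range c) \<and>
     (\<exists>P K \<mu>1 \<mu>2. 0 \<le> \<mu>1 \<and> \<mu>1 < \<mu>2 \<and>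
        (\<forall>v. continuous_on (range c) (\<lambda>x. P x v)) \<and>
        (\<forall>s. linear (P (c s)) \<and> P (c s) \<circ> P (c s) = P (c s) \<and>
             range (P (c s)) = span {velocity c s}) \<and>
        (\<forall>u v. solves u F UNIV \<and> range u \<subseteq> range c \<and>
           (\<forall>t. (v has_vector_derivative frechet_derivative F (at (u t)) (v t)) (at t)) \<longrightarrow>
             (\<forall>t. ((\<lambda>s. P (u s) (v s)) has_vector_derivative
                     frechet_derivative F (at (u t)) (P (u t) (v t))) (at t)) \<and>
             (\<forall>t\<le>0. norm (P (u t) (v t)) \<le> K * exp (- \<mu>1 * t) * norm (P (u 0) (v 0))) \<and>
             (\<forall>t\<ge>0. norm (v t - P (u t) (v t)) \<le>
                     K * exp (- \<mu>2 * t) * norm (v 0 - P (u 0) (v 0)))))"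

definition stable_hyperbolic_zero :: "(real \<Rightarrow> real) \<Rightarrow> real \<Rightarrow> bool" where
  "stable_hyperbolic_zero b a \<longleftrightarrow> b a = 0 \<and> (\<exists>D<0. (b has_real_derivative D) (at a))"

definition circle_basin :: "real \<Rightarrow> (real \<Rightarrow> real) \<Rightarrow> real \<Rightarrow> real set" where
  "circle_basin L b a =
     {x. \<exists>u. solves u b {0..} \<and> u 0 = x \<and> (\<exists>a'. [a' = a] (rmod L) \<and> (u \<longlongrightarrow> a') at_top)}"

definition stable_fixed_point :: "('a::real_normed_vector \<Rightarrow> 'a) \<Rightarrow> 'a \<Rightarrow> bool" where
  "stable_fixed_point F A \<longleftrightarrow> F A = 0 \<and>
     (\<forall>\<epsilon>>0. \<exists>\<eta>>0. \<forall>u T. T \<ge> 0 \<and> solves u F {0..T} \<and> dist (u 0) A < \<eta> \<longrightarrow>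
        (\<forall>t\<in>{0..T}. dist (u t) A < \<epsilon>)) \<and>
     (\<exists>\<eta>>0. \<forall>u. solves u F {0..} \<and> dist (u 0) A < \<eta> \<longrightarrow> (u \<longlongrightarrow> A) at_top)"

text \<open>The component of \<open>F\<close> along a unit-speed curve.\<close>
definition reduced_drift :: "('a::real_inner \<Rightarrow> 'a) \<Rightarrow> (real \<Rightarrow> 'a) \<Rightarrow> real \<Rightarrow> real" where
  "reduced_drift F c s = F (c s) \<bullet> velocity c s"

subsection \<open>Quasipotentials\<close>

definition abs_continuous_on :: "real \<Rightarrow> real \<Rightarrow> (real \<Rightarrow> 'a::real_normed_vector) \<Rightarrow> bool" where
  "abs_continuous_on a b f \<longleftrightarrow>
     (\<forall>\<epsilon>>0. \<exists>\<eta>>0. \<forall>(N::nat) s t.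
        (\<forall>i<N. a \<le> s i \<and> s i \<le> t i \<and> t i \<le> b) \<and>
        (\<forall>i<N. \<forall>j<N. i \<noteq> j \<longrightarrow> {s i<..<t i} \<inter> {s j<..<t j} = {}) \<and>
        (\<Sum>i<N. t i - s i) < \<eta> \<longrightarrow>
        (\<Sum>i<N. norm (f (t i) - f (s i))) < \<epsilon>)"

text \<open>
  The value is \<open>\<infinity>\<close> if the integrand is not integrable.  An absolutely continuous path is
  differentiable almost everywhere, so the junk values of the derivative do not matter.
\<close>
definition action :: "('a::euclidean_space \<Rightarrow> 'a) \<Rightarrow> real \<Rightarrow> (real \<Rightarrow> 'a) \<Rightarrow> ennreal" where
  "action F T Y =
     (\<integral>\<^sup>+ t\<in>{T..0}. ennreal ((norm (vector_derivative Y (at t) - F (Y t)))\<^sup>2) \<partial>lborel) / 2"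

definition quasipotential :: "('a::euclidean_space \<Rightarrow> 'a) \<Rightarrow> 'a \<Rightarrow> 'a \<Rightarrow> ennreal" where
  "quasipotential F P1 P2 =
     (INF (T, Y) \<in> {(T, Y). T < 0 \<and> abs_continuous_on T 0 Y \<and> Y T = P1 \<and> Y 0 = P2}. action F T Y)"

definition circle_quasipotential :: "real \<Rightarrow> (real \<Rightarrow> real) \<Rightarrow> real \<Rightarrow> real \<Rightarrow> ennreal" where
  "circle_quasipotential L b s1 s2 =
     (INF (T, Y) \<in> {(T, Y). T < 0 \<and> abs_continuous_on T 0 Y \<and>
         [Y T = s1] (rmod L) \<and> [Y 0 = s2] (rmod L)}. action b T Y)"

end

theory Submission
  imports Defs
begin

text \<open>
  Near the invariant curve use tubular coordinates \<open>Z = c(s) + n\<close> with \<open>n \<bullet> c'(s) = 0\<close>. Let \<open>\<Phi>\<close> be the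
  reduced potential, \<open>\<Phi>' = -2b\<close>, where \<open>b = O(\<delta>)\<close> is the drift along the curve. Since the Hessian of
  \<open>V\<close> is symmetric and kills the tangent of \<open>M\<close>, the tangential drift at \<open>Z\<close> is
  \<open>b + O(\<delta>|n| + |n|\<^sup>2)\<close>, while the normal drift contracts at a rate \<open>\<mu>\<close>. Therefore
  \<open>U = (1 - \<eta>) \<Phi>(s) + \<mu>|n|\<^sup>2/2\<close> is a subsolution of the Hamilton-Jacobi equation
  \<open>\<langle>F, \<nabla>U\<rangle> + |\<nabla>U|\<^sup>2/2 \<le> 0\<close> once \<open>\<eta>\<close> is a large multiple of \<open>\<delta>\<^sup>2\<close>: every error term
  carries a factor \<open>b\<close> and is absorbed by \<open>-2\<eta>(1 - \<eta>)b\<^sup>2 - \<mu>\<^sup>2|n|\<^sup>2/2\<close>. The action of a path is at least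
  the increment of a subsolution, whatever the duration of the path. With \<open>\<Phi> = O(\<delta>)\<close> this bounds
  \<open>W\<^sub>\<delta>\<close> from below by \<open>W\<^sup>r\<^sup>e\<^sup>d\<close> up to \<open>O(\<delta>\<^sup>3)\<close>, and it makes leaving through the lateral boundary too
  expensive when \<open>C\<^sub>0\<close> is large. Conversely, a path on the circle lifts to the curve with the same action.
\<close>

subsection \<open>Differentiability of monotone functions\<close>

text \<open>The paths competing in the action are only absolutely continuous, so the increment bound
  for a subsolution needs almost everywhere differentiability and the fundamental theorem for such
  paths. Tubular coordinates give the subsolution only on a piece of the curve shorter than a full
  turn, and a competing path may leave this piece and return. The piece is therefore prolonged by a
  length \<open>h\<close> beyond both ends of the tube. There the drift keeps its sign with size of
  order \<open>\<delta>\<close>, so \<open>\<Phi>\<close> gains a multiple of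
  \<open>\<delta>\<close>, while the factor \<open>1 - \<eta>\<close> costs only order
  \<open>\<delta> ^ 3\<close>; an excursion beyond the prolongation is too expensive for a
  minimizer. The error in the theorem is the loss \<open>\<eta> * \<Phi>\<close>. All constants
  (curvature, chord-arc, decay) must be uniform in \<open>\<delta>\<close>. They are found on the
  fixed curve \<open>q\<close> and carried over to the unit-speed curve \<open>c\<close> by an
  arclength change of parameter. This change needs a proof, since only image, orientation and one
  point of the two parametrizations are known to agree.\<close>

lemma Vitali_covering_intervals:
  fixes E U :: "real set"
  assumes fine: "\<And>t e. t \<in> E \<Longrightarrow> e > 0 \<Longrightarrow> \<exists>x y. x < t \<and> t < y \<and> y - x < e \<and> P x y"
    and U: "open U" "E \<subseteq> U"
  obtains C where "countable C" "\<And>x y. (x, y) \<in> C \<Longrightarrow> x < y \<and> P x y \<and> {x<..<y} \<subseteq> U"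
    "disjoint_family_on (\<lambda>(x, y). {x<..<y}) C" "negligible (E - (\<Union>(x, y)\<in>C. {x<..<y}))"
proof -
  define K where "K = {(x, y). x < y \<and> P x y \<and> {x<..<y} \<subseteq> U}"
  \<comment> \<open>The covering theorem is stated for balls; an open interval is the ball about its
    midpoint with half its length as radius.\<close>
  have ball_eq: "ball ((fst i + snd i) / 2) ((snd i - fst i) / 2) = {fst i<..<snd i}" for i :: "real \<times> real"
    by (auto simp: dist_real_def abs_less_iff field_simps)
  have "\<exists>i. i \<in> K \<and> t \<in> ball ((fst i + snd i) / 2) ((snd i - fst i) / 2) \<and> (snd i - fst i) / 2 < d"
    if td: "t \<in> E" "d > 0" for t d
  proof -
    from U td obtain r where r: "r > 0" "ball t r \<subseteq> U"
      by (meson open_contains_ball subsetD)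
    obtain x y where xy: "x < t" "t < y" "y - x < min r d" "P x y"
      using fine[of t "min r d"] td r by auto
    have "{x<..<y} \<subseteq> ball t r"
      using xy by (auto simp: dist_real_def)
    then have "(x, y) \<in> K"
      using xy r unfolding K_def by auto
    then show ?thesis
      unfolding ball_eq using xy by (intro exI[of _ "(x, y)"]) auto
  qed
  then obtain C where C: "countable C" "C \<subseteq> K"
     "pairwise (\<lambda>i j. disjnt (ball ((fst i + snd i) / 2) ((snd i - fst i) / 2))
        (ball ((fst j + snd j) / 2) ((snd j - fst j) / 2))) C"
     "negligible (E - (\<Union>i \<in> C. ball ((fst i + snd i) / 2) ((snd i - fst i) / 2)))"
    by (rule Vitali_covering_theorem_balls[where a="\<lambda>i. (fst i + snd i) / 2" and r="\<lambda>i. (snd i - fst i) / 2"]) blast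
  show thesis
  proof
    show "countable C" by fact
    show "\<And>x y. (x, y) \<in> C \<Longrightarrow> x < y \<and> P x y \<and> {x<..<y} \<subseteq> U"
      using C(2) unfolding K_def by auto
    show "disjoint_family_on (\<lambda>(x, y). {x<..<y}) C"
      using C(3) unfolding ball_eq
      by (auto simp: disjoint_family_on_def pairwise_def disjnt_def case_prod_beta)
    show "negligible (E - (\<Union>(x, y)\<in>C. {x<..<y}))"
      using C(4) unfolding ball_eq by (simp add: case_prod_beta)
  qed
qed

text \<open>Continuity of \<open>F\<close> takes the mass away from the right endpoint.\<close>

lemma emeasure_interval_measure_Ioo:
  assumes "x < y" "mono F" "continuous_on UNIV F"
  shows "emeasure (interval_measure F) {x<..<y} = ennreal (F y - F x)"
proof -
  have "emeasure (interval_measure F) {y..y} = ennreal (F y - F y)"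
    by (rule emeasure_interval_measure_Icc) (use assms in \<open>auto dest: monoD\<close>)
  then have "{y} \<in> null_sets (interval_measure F)"
    by (auto simp: null_sets_def)
  moreover have "emeasure (interval_measure F) {x<..y} = ennreal (F y - F x)"
    by (rule emeasure_interval_measure_Ioc)
       (use assms in \<open>auto dest: monoD simp: continuous_on_eq_continuous_within
          intro: continuous_within_subset\<close>)
  moreover have "{x<..<y} = {x<..y} - {y}"
    using assms by auto
  ultimately show ?thesis
    by (metis emeasure_Diff_null_set greaterThanAtMost_borel sets_interval_measure)
qed

lemma emeasure_UN_intervals_le:
  fixes C :: "(real \<times> real) set"
  assumes C: "countable C" "disjoint_family_on (\<lambda>(x, y). {x<..<y}) C"
    and le: "\<And>x y. (x, y) \<in> C \<Longrightarrow> emeasure M {x<..<y} \<le> k * emeasure M' {x<..<y}"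
    and M: "sets M = sets borel" "sets M' = sets borel"
  shows "emeasure M (\<Union>(x, y)\<in>C. {x<..<y}) \<le> k * emeasure M' (\<Union>(x, y)\<in>C. {x<..<y})"
proof -
  let ?X = "\<lambda>i. {fst i<..<snd i}"
  have eq: "emeasure N (\<Union>(x, y)\<in>C. {x<..<y}) = (\<integral>\<^sup>+i. emeasure N (?X i) \<partial>count_space C)"
    if "sets N = sets borel" for N
  proof -
    have "disjoint_family_on ?X C"
      using C(2) by (simp add: disjoint_family_on_def case_prod_beta)
    then have "emeasure N (\<Union>i\<in>C. ?X i) = (\<integral>\<^sup>+i. emeasure N (?X i) \<partial>count_space C)"
      using C(1) that by (intro emeasure_UN_countable) auto
    then show ?thesis by (simp add: case_prod_beta)
  qed
  have "emeasure M (\<Union>(x, y)\<in>C. {x<..<y}) = (\<integral>\<^sup>+i. emeasure M (?X i) \<partial>count_space C)"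
    by (rule eq) fact
  also have "\<dots> \<le> (\<integral>\<^sup>+i. k * emeasure M' (?X i) \<partial>count_space C)"
    by (rule nn_integral_mono) (use le in auto)
  also have "\<dots> = k * (\<integral>\<^sup>+i. emeasure M' (?X i) \<partial>count_space C)"
    by (rule nn_integral_cmult) auto
  finally show ?thesis by (simp only: eq[OF M(2)])
qed

text \<open>With a slope bound as \<open>P\<close> this is, up to the boundary case, a level set of
  the lower or upper derivate taken along intervals straddling \<open>t\<close>. Because these
  intervals contain \<open>t\<close> in their interior, the set is a countable intersection of open
  sets, hence Borel for every \<open>P\<close>.\<close>

definition slope_limit_set :: "(real \<Rightarrow> real \<Rightarrow> bool) \<Rightarrow> real set" where
  "slope_limit_set P = {t. \<forall>e>0. \<exists>x y. x < t \<and> t < y \<and> y - x < e \<and> P x y}"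

lemma borel_slope_limit_set [measurable]: "slope_limit_set P \<in> sets borel"
proof -
  have "slope_limit_set P = (\<Inter>n::nat. \<Union>{{x<..<y} | x y. y - x < inverse (Suc n) \<and> P x y})" (is "_ = ?R")
  proof (intro equalityI subsetI)
    fix t assume t: "t \<in> slope_limit_set P"
    show "t \<in> ?R"
    proof
      fix n :: nat
      have "inverse (real (Suc n)) > 0" by simp
      then obtain x y where "x < t" "t < y" "y - x < inverse (Suc n)" "P x y"
        using t unfolding slope_limit_set_def by blast
      then show "t \<in> \<Union>{{x<..<y} | x y. y - x < inverse (Suc n) \<and> P x y}"
        by (intro UnionI[of "{x<..<y}"]) auto
    qed
  next
    fix t assume t: "t \<in> ?R"
    show "t \<in> slope_limit_set P"
      unfolding slope_limit_set_def
    proof (intro CollectI allI impI)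
      fix e :: real assume "e > 0"
      then obtain n where n: "inverse (real (Suc n)) < e"
        using reals_Archimedean by blast
      from t have "t \<in> \<Union>{{x<..<y} | x y. y - x < inverse (Suc n) \<and> P x y}" by blast
      then obtain x y where "t \<in> {x<..<y}" "y - x < inverse (Suc n)" "P x y" by blast
      then show "\<exists>x y. x < t \<and> t < y \<and> y - x < e \<and> P x y"
        using n by (intro exI[of _ x] exI[of _ y]) auto
    qed
  qed
  moreover have "\<dots> \<in> sets borel"
    by (intro sets.countable_INT'' borel_open open_Union) auto
  ultimately show ?thesis by simp
qed

text \<open>On every interval of a Vitali cover inside \<open>U\<close>, \<open>v\<close> times the
  length is at most the Stieltjes mass. The intervals are disjoint and miss only a null part of
  \<open>E\<close>, so the estimates add up.\<close>

lemma emeasure_fine_cover_le: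
  assumes F: "mono F" "continuous_on UNIV F" and v: "v \<ge> 0"
    and E: "E \<in> sets borel" "E \<subseteq> slope_limit_set (\<lambda>x y. F y - F x \<ge> v * (y - x))"
    and U: "open U" "E \<subseteq> U"
  shows "ennreal v * emeasure lborel E \<le> emeasure (interval_measure F) U"
proof -
  obtain C where C: "countable C"
      "\<And>x y. (x, y) \<in> C \<Longrightarrow> x < y \<and> F y - F x \<ge> v * (y - x) \<and> {x<..<y} \<subseteq> U"
      "disjoint_family_on (\<lambda>(x, y). {x<..<y}) C" "negligible (E - (\<Union>(x, y)\<in>C. {x<..<y}))"
    by (rule Vitali_covering_intervals[of E "\<lambda>x y. F y - F x \<ge> v * (y - x)" U])
       (use E U in \<open>auto simp: slope_limit_set_def\<close>)
  let ?B = "\<Union>(x, y)\<in>C. {x<..<y}"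
  have B: "open ?B" by auto
  have "E - ?B \<in> null_sets lborel"
    using C(4) E B by (simp add: negligible_iff_null_sets null_sets_completion_iff)
  then have "emeasure lborel E \<le> emeasure lborel ?B"
    using E B by (intro emeasure_mono_AE) (auto dest: AE_not_in)
  then have "ennreal v * emeasure lborel E \<le> ennreal v * emeasure lborel ?B"
    by (rule mult_left_mono) simp
  also have "emeasure lborel ?B = 1 * emeasure lborel ?B" by simp
  also have "ennreal v * (1 * emeasure lborel ?B) = emeasure (scale_measure (ennreal v) lborel) ?B"
    by simp
  also have "\<dots> \<le> 1 * emeasure (interval_measure F) ?B"
  proof (rule emeasure_UN_intervals_le)
    fix x y assume xy: "(x, y) \<in> C"
    have "ennreal v * ennreal (y - x) \<le> ennreal (F y - F x)"
      using C(2)[OF xy] v by (auto simp flip: ennreal_mult intro!: ennreal_leI)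
    then show "emeasure (scale_measure (ennreal v) lborel) {x<..<y} \<le> 1 * emeasure (interval_measure F) {x<..<y}"
      using C(2)[OF xy] F by (simp add: emeasure_interval_measure_Ioo)
  qed (use C in auto)
  also have "\<dots> \<le> emeasure (interval_measure F) U"
    using C(2) U by (auto intro!: emeasure_mono)
  finally show ?thesis .
qed

text \<open>Lebesgue's two-slope argument. Cover \<open>E\<close> by disjoint intervals of slope at
  most \<open>u\<close> inside an open set barely larger than \<open>E\<close>, then cover
  \<open>E\<close> within their union by intervals of slope at least \<open>v\<close>. The Stieltjes
  mass of the union lies between \<open>v * a\<close> and \<open>u * (a + e)\<close>, which forces
  \<open>a = 0\<close>.\<close>

lemma null_set_two_slopes:
  assumes F: "mono F" "continuous_on UNIV F" and uv: "0 \<le> u" "u < v"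
  shows "slope_limit_set (\<lambda>x y. F y - F x \<le> u * (y - x)) \<inter> slope_limit_set (\<lambda>x y. F y - F x \<ge> v * (y - x))
    \<in> null_sets lborel" (is "?A \<inter> ?B \<in> _")
proof -
  \<comment> \<open>Bounded pieces, so that the measure of \<open>E\<close> is a real number and can
    be subtracted.\<close>
  have "?A \<inter> ?B \<inter> {- real m..real m} \<in> null_sets lborel" for m
  proof -
    define E where "E = ?A \<inter> ?B \<inter> {- real m..real m}"
    have E: "E \<in> sets borel" unfolding E_def by measurable
    have "emeasure lborel E \<le> emeasure lborel {- real m..real m}"
      unfolding E_def by (intro emeasure_mono) auto
    also have "\<dots> < \<infinity>" by simp
    finally have fin: "emeasure lborel E < \<infinity>" .
    define a where "a = measure lborel E"
    have a: "emeasure lborel E = ennreal a" "a \<ge> 0"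
      using fin by (auto simp: a_def emeasure_eq_ennreal_measure)
    have main: "v * a \<le> u * (a + e)" if e: "e > 0" for e
    proof -
      obtain U where U: "open U" "E \<subseteq> U" "emeasure lborel (U - E) < ennreal e"
        by (rule outer_regular_lborel[OF E e])
      obtain C where C: "countable C"
          "\<And>x y. (x, y) \<in> C \<Longrightarrow> x < y \<and> F y - F x \<le> u * (y - x) \<and> {x<..<y} \<subseteq> U"
          "disjoint_family_on (\<lambda>(x, y). {x<..<y}) C" "negligible (E - (\<Union>(x, y)\<in>C. {x<..<y}))"
        by (rule Vitali_covering_intervals[of E "\<lambda>x y. F y - F x \<le> u * (y - x)" U])
           (use U in \<open>auto simp: slope_limit_set_def E_def\<close>)
      let ?B = "\<Union>(x, y)\<in>C. {x<..<y}"
      have B: "open ?B" by auto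
      have "E - ?B \<in> null_sets lborel"
        using C(4) E B by (simp add: negligible_iff_null_sets null_sets_completion_iff)
      then have "emeasure lborel E \<le> emeasure lborel (E \<inter> ?B)"
        using E B by (intro emeasure_mono_AE) (auto dest: AE_not_in)
      then have "ennreal v * emeasure lborel E \<le> ennreal v * emeasure lborel (E \<inter> ?B)"
        by (rule mult_left_mono) simp
      also have "\<dots> \<le> emeasure (interval_measure F) ?B"
        by (rule emeasure_fine_cover_le[OF F]) (use uv E B in \<open>auto simp: E_def\<close>)
      also have "\<dots> \<le> ennreal u * emeasure lborel ?B"
      proof (rule emeasure_UN_intervals_le)
        fix x y assume xy: "(x, y) \<in> C"
        have "ennreal (F y - F x) \<le> ennreal u * ennreal (y - x)"
          using C(2)[OF xy] uv by (auto simp flip: ennreal_mult intro!: ennreal_leI)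
        then show "emeasure (interval_measure F) {x<..<y} \<le> ennreal u * emeasure lborel {x<..<y}"
          using C(2)[OF xy] F by (simp add: emeasure_interval_measure_Ioo)
      qed (use C in auto)
      also have "\<dots> \<le> ennreal u * emeasure lborel U"
        using C(2) U by (intro mult_left_mono emeasure_mono) auto
      also have "emeasure lborel U = emeasure lborel E + emeasure lborel (U - E)"
        using U E by (subst plus_emeasure) (auto simp: Un_absorb1)
      also have "ennreal u * \<dots> \<le> ennreal u * (ennreal a + ennreal e)"
        using U a by (intro mult_left_mono add_mono) auto
      finally have "ennreal (v * a) \<le> ennreal (u * (a + e))"
        using a uv e by (simp add: ennreal_mult ennreal_plus)
      then show ?thesis
        using a uv e by (simp add: ennreal_le_iff)
    qed
    have "a = 0"
    proof (rule ccontr)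
      assume "a \<noteq> 0"
      then have pos: "(v - u) * a > 0" using a uv by simp
      \<comment> \<open>The excess \<open>e\<close> is chosen with
        \<open>u * e < (v - u) * a\<close>; the denominator is \<open>u + 1\<close> because
        \<open>u\<close> may vanish.\<close>
      have "v * a \<le> u * (a + (v - u) * a / (u + 1))"
        by (rule main) (use pos uv in simp)
      also have "\<dots> = u * a + (v - u) * a * (u / (u + 1))"
        by (simp add: distrib_left)
      also have "\<dots> < u * a + (v - u) * a * 1"
        using pos uv by (intro add_strict_left_mono mult_strict_left_mono) (auto simp: field_simps)
      finally show False by (simp add: algebra_simps)
    qed
    then show ?thesis
      using a E unfolding E_def by (auto simp: null_sets_def)
  qed
  then have "(\<Union>m. ?A \<inter> ?B \<inter> {- real m..real m}) \<in> null_sets lborel"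
    by (rule null_sets_UN)
  moreover have "(\<Union>m. ?A \<inter> ?B \<inter> {- real m..real m}) = ?A \<inter> ?B"
  proof -
    have "\<exists>m. t \<in> {- real m..real m}" for t
      using real_arch_simple[of "\<bar>t\<bar>"] by (metis abs_le_iff atLeastAtMost_iff minus_le_iff)
    then show ?thesis by blast
  qed
  ultimately show ?thesis by simp
qed

text \<open>On a bounded piece of measure \<open>a\<close>, intervals of slope at least
  \<open>n\<close> give \<open>real n * a \<le> M\<close> for every \<open>n\<close>, where
  \<open>M\<close> is the increment of \<open>F\<close> over the piece.\<close>

lemma null_set_infinite_slope:
  assumes F: "mono F" "continuous_on UNIV F"
  shows "(\<Inter>n::nat. slope_limit_set (\<lambda>x y. F y - F x \<ge> real n * (y - x))) \<in> null_sets lborel" (is "?A \<in> _")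
proof -
  have "?A \<inter> {- real m<..<real m} \<in> null_sets lborel" for m
  proof -
    define E where "E = ?A \<inter> {- real m<..<real m}"
    have E: "E \<in> sets borel" unfolding E_def by measurable
    have "emeasure lborel E \<le> emeasure lborel {- real m<..<real m}"
      unfolding E_def by (intro emeasure_mono) auto
    also have "\<dots> < \<infinity>" by (cases "m = 0") auto
    finally have fin: "emeasure lborel E < \<infinity>" .
    define a where "a = measure lborel E"
    have a: "emeasure lborel E = ennreal a" "a \<ge> 0"
      using fin by (auto simp: a_def emeasure_eq_ennreal_measure)
    define M where "M = F (real m) - F (- real m)"
    have M: "M \<ge> 0" using F(1) by (auto simp: M_def mono_def)
    have main: "real n * a \<le> M" for n
    proof (cases "m = 0")
      case True
      then show ?thesis using a M by (simp add: E_def)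
    next
      case False
      have "ennreal (real n) * emeasure lborel E \<le> emeasure (interval_measure F) {- real m<..<real m}"
        by (rule emeasure_fine_cover_le[OF F]) (use E in \<open>auto simp: E_def\<close>)
      then have "ennreal (real n * a) \<le> ennreal M"
        using False a F by (simp add: emeasure_interval_measure_Ioo M_def ennreal_mult del: ennreal_of_nat_eq_real_of_nat)
      then show ?thesis using M by (simp add: ennreal_le_iff)
    qed
    have "a = 0"
    proof (rule ccontr)
      assume "a \<noteq> 0"
      then have "a > 0" using a by simp
      then obtain n where "M < real n * a" using reals_Archimedean3 by blast
      then show False using main[of n] by simp
    qed
    then show ?thesis
      using a E unfolding E_def by (auto simp: null_sets_def)
  qed
  then have "(\<Union>m. ?A \<inter> {- real m<..<real m}) \<in> null_sets lborel"
    by (rule null_sets_UN)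
  moreover have "(\<Union>m. ?A \<inter> {- real m<..<real m}) = ?A"
  proof -
    have "\<exists>m. t \<in> {- real m<..<real m}" for t
      using reals_Archimedean2[of "\<bar>t\<bar>"] by (metis abs_less_iff greaterThanLessThan_iff minus_less_iff)
    then show ?thesis by blast
  qed
  ultimately show ?thesis by simp
qed

text \<open>Where the straddling slopes have no finite limit, either two rational slopes separate
  their lower and upper limits or the slopes are unbounded; both events lie in the null set
  \<open>N\<close>. Continuity then turns straddling slopes into difference quotients at the
  point.\<close>

theorem mono_continuous_differentiable_ae:
  fixes F :: "real \<Rightarrow> real"
  assumes F: "mono F" "continuous_on UNIV F"
  shows "negligible {t. \<not> F differentiable (at t)}"
proof -
  let ?lo = "\<lambda>u. slope_limit_set (\<lambda>x y. F y - F x \<le> u * (y - x))"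
  let ?hi = "\<lambda>v. slope_limit_set (\<lambda>x y. F y - F x \<ge> v * (y - x))"
  define Q where "Q = {(u, v). u \<in> \<rat> \<and> v \<in> \<rat> \<and> 0 \<le> u \<and> u < (v::real)}"
  define N where "N = (\<Union>(u, v)\<in>Q. ?lo u \<inter> ?hi v) \<union> (\<Inter>n::nat. ?hi (real n))"
  have "countable Q"
    by (rule countable_subset[of _ "\<rat> \<times> \<rat>"]) (auto simp: Q_def countable_rat)
  then have "(\<Union>q\<in>Q. ?lo (fst q) \<inter> ?hi (snd q)) \<in> null_sets lborel"
    by (rule null_sets_UN') (auto simp: Q_def intro!: null_set_two_slopes F)
  then have "N \<in> null_sets lborel"
    unfolding N_def using null_set_infinite_slope[OF F] by (auto simp: case_prod_beta)
  then have N: "negligible N"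
    by (auto simp: negligible_iff_null_sets null_sets_completion_iff2)
  have "F differentiable (at t)" if t: "t \<notin> N" for t
  proof -
    \<comment> \<open>\<open>S\<close> collects the eventual upper bounds for slopes near
      \<open>t\<close>; its infimum \<open>l\<close> is the upper derivate and the candidate for the
      derivative.\<close>
    define S where "S = {v. \<exists>e>0. \<forall>x y. x < t \<and> t < y \<and> y - x < e \<longrightarrow> F y - F x \<le> v * (y - x)}"
    obtain n where "t \<notin> ?hi (real n)"
      using t by (auto simp: N_def)
    then have n: "real n \<in> S"
      unfolding slope_limit_set_def S_def by (auto simp: not_le) (meson less_imp_le)
    have S_nonneg: "v \<ge> 0" if v: "v \<in> S" for v
    proof -
      obtain e where e: "e > 0" "\<And>x y. x < t \<Longrightarrow> t < y \<Longrightarrow> y - x < e \<Longrightarrow> F y - F x \<le> v * (y - x)"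
        using v unfolding S_def by blast
      have "F (t - e/3) \<le> F (t + e/3)" using F(1) e(1) by (auto simp: mono_def)
      moreover have "F (t + e/3) - F (t - e/3) \<le> v * (2 * e / 3)"
        using e(2)[of "t - e/3" "t + e/3"] e(1) by (simp add: algebra_simps)
      ultimately have "0 \<le> v * (2 * e / 3)" by linarith
      then show ?thesis using e(1) by (simp add: zero_le_mult_iff)
    qed
    have bdd: "bdd_below S" by (rule bdd_belowI[of _ 0]) (rule S_nonneg)
    define l where "l = Inf S"
    have up: "\<exists>e>0. \<forall>x y. x < t \<and> t < y \<and> y - x < e \<longrightarrow> F y - F x \<le> (l + d) * (y - x)" if d: "d > 0" for d
    proof -
      have "Inf S < l + d" using d by (simp add: l_def)
      then obtain v where v: "v \<in> S" "v < l + d"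
        using cInf_lessD[of S "l + d"] n by blast
      then obtain e where e: "e > 0" "\<And>x y. x < t \<Longrightarrow> t < y \<Longrightarrow> y - x < e \<Longrightarrow> F y - F x \<le> v * (y - x)"
        unfolding S_def by blast
      have "v * (y - x) \<le> (l + d) * (y - x)" if "x < y" for x y
        using v that by (intro mult_right_mono) auto
      then show ?thesis using e by (intro exI[of _ e]) (smt (verit))
    qed
    have lo: "\<exists>e>0. \<forall>x y. x < t \<and> t < y \<and> y - x < e \<longrightarrow> F y - F x \<ge> (l - d) * (y - x)" if d: "d > 0" for d
    proof (rule ccontr)
      assume neg: "\<not> ?thesis"
      have A: "\<exists>x y. x < t \<and> t < y \<and> y - x < e \<and> F y - F x < (l - d) * (y - x)" if "e > 0" for e
        using neg that by (auto simp: not_le)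
      obtain x y where "x < t" "t < y" "F y - F x < (l - d) * (y - x)" using A[of 1] by auto
      moreover have "F x \<le> F y" using F(1) calculation by (auto simp: mono_def)
      ultimately have "0 < (l - d) * (y - x)" by linarith
      then have ld: "l - d > 0" using \<open>x < t\<close> \<open>t < y\<close> by (simp add: zero_less_mult_iff)
      \<comment> \<open>A slope below \<open>l - d\<close> recurs at every scale, and every number
        below \<open>l\<close> is exceeded by slopes at every scale. So any rational pair
        \<open>u < v\<close> between \<open>l - d\<close> and \<open>l - d / 2\<close> puts
        \<open>t\<close> into \<open>N\<close>.\<close>
      obtain u where u: "u \<in> \<rat>" "l - d < u" "u < l - d / 2"
        using Rats_dense_in_real[of "l - d" "l - d / 2"] d by auto
      obtain v where v: "v \<in> \<rat>" "u < v" "v < l - d / 2"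
        using Rats_dense_in_real[of u "l - d / 2"] u by auto
      have "t \<in> ?lo u"
        unfolding slope_limit_set_def
      proof (intro CollectI allI impI)
        fix e :: real assume "e > 0"
        then obtain x y where xy: "x < t" "t < y" "y - x < e" "F y - F x < (l - d) * (y - x)" using A by blast
        have "(l - d) * (y - x) \<le> u * (y - x)" using u xy by (intro mult_right_mono) auto
        then have "F y - F x \<le> u * (y - x)" using xy by linarith
        then show "\<exists>x y. x < t \<and> t < y \<and> y - x < e \<and> F y - F x \<le> u * (y - x)"
          using xy by blast
      qed
      moreover have "t \<in> ?hi v"
      proof (rule ccontr)
        assume "t \<notin> ?hi v"
        then have "v \<in> S"
          unfolding slope_limit_set_def S_def by (auto simp: not_le) (meson less_imp_le)
        then have "l \<le> v" unfolding l_def using bdd by (rule cInf_lower)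
        then show False using v d by simp
      qed
      moreover have "(u, v) \<in> Q" using u v ld by (auto simp: Q_def)
      ultimately have "t \<in> N" unfolding N_def by blast
      then show False using t by simp
    qed
    have cont: "(F \<longlongrightarrow> F t) (at t within A)" for A
      using F(2) by (meson continuous_on_eq_continuous_within continuous_within iso_tuple_UNIV_I
          tendsto_within_subset top_greatest)
    have "(F has_derivative (\<lambda>h. l * h)) (at t)"
      unfolding has_derivative_within_alt
    proof (intro conjI allI impI)
      show "bounded_linear ((*) l)" by (rule bounded_linear_mult_right)
      fix d :: real assume d: "d > 0"
      obtain e1 where e1: "e1 > 0" "\<And>x y. x < t \<Longrightarrow> t < y \<Longrightarrow> y - x < e1 \<Longrightarrow> F y - F x \<le> (l + d) * (y - x)"
        using up[OF d] by blast
      obtain e2 where e2: "e2 > 0" "\<And>x y. x < t \<Longrightarrow> t < y \<Longrightarrow> y - x < e2 \<Longrightarrow> F y - F x \<ge> (l - d) * (y - x)"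
        using lo[OF d] by blast
      define e where "e = min e1 e2"
      have e: "e > 0" using e1 e2 by (simp add: e_def)
      \<comment> \<open>The bounds concern intervals straddling \<open>t\<close>. Letting the left
        endpoint tend to \<open>t\<close>, by continuity of \<open>F\<close>, turns them into bounds
        on the increment to the right of \<open>t\<close>.\<close>
      have right: "F y - F t \<le> (l + d) * (y - t) \<and> F y - F t \<ge> (l - d) * (y - t)" if y: "t < y" "y - t < e" for y
      proof -
        have ev: "\<forall>\<^sub>F x in at_left t. x < t \<and> y - x < e1 \<and> y - x < e2"
        proof -
          have "\<forall>\<^sub>F x in at_left t. x \<in> {y - e<..<t}"
            by (rule eventually_at_leftI[of "y - e"]) (use y in auto)
          then show ?thesis by eventually_elim (auto simp: e_def)
        qed
        have lim: "((\<lambda>x. F y - F x) \<longlongrightarrow> F y - F t) (at_left t)" "((\<lambda>x. k * (y - x)) \<longlongrightarrow> k * (y - t)) (at_left t)" for k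
          by (intro tendsto_intros cont)+
        have "F y - F t \<le> (l + d) * (y - t)"
          by (rule tendsto_le[OF _ lim(2) lim(1)])
             (auto intro!: eventually_mono[OF ev] e1(2) simp: y e_def)
        moreover have "F y - F t \<ge> (l - d) * (y - t)"
          by (rule tendsto_le[OF _ lim(1) lim(2)])
             (auto intro!: eventually_mono[OF ev] e2(2) simp: y e_def)
        ultimately show ?thesis by simp
      qed
      have left: "F t - F x \<le> (l + d) * (t - x) \<and> F t - F x \<ge> (l - d) * (t - x)" if x: "x < t" "t - x < e" for x
      proof -
        have ev: "\<forall>\<^sub>F y in at_right t. t < y \<and> y - x < e1 \<and> y - x < e2"
        proof -
          have "\<forall>\<^sub>F y in at_right t. y \<in> {t<..<x + e}"
            by (rule eventually_at_rightI[of _ "x + e"]) (use x in auto)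
          then show ?thesis by eventually_elim (auto simp: e_def)
        qed
        have lim: "((\<lambda>y. F y - F x) \<longlongrightarrow> F t - F x) (at_right t)" "((\<lambda>y. k * (y - x)) \<longlongrightarrow> k * (t - x)) (at_right t)" for k
          by (intro tendsto_intros cont)+
        have "F t - F x \<le> (l + d) * (t - x)"
          by (rule tendsto_le[OF _ lim(2) lim(1)])
             (auto intro!: eventually_mono[OF ev] e1(2) simp: x e_def)
        moreover have "F t - F x \<ge> (l - d) * (t - x)"
          by (rule tendsto_le[OF _ lim(1) lim(2)])
             (auto intro!: eventually_mono[OF ev] e2(2) simp: x e_def)
        ultimately show ?thesis by simp
      qed
      have "\<bar>F y - F t - l * (y - t)\<bar> \<le> d * \<bar>y - t\<bar>" if "\<bar>y - t\<bar> < e" for y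
        using right[of y] left[of y] that by (cases y t rule: linorder_cases) (auto simp: algebra_simps)
      then show "\<exists>e>0. \<forall>y\<in>UNIV. norm (y - t) < e \<longrightarrow> norm (F y - F t - l * (y - t)) \<le> d * norm (y - t)"
        using e by auto
    qed
    then show ?thesis by (rule differentiableI)
  qed
  then have "{t. \<not> F differentiable (at t)} \<subseteq> N" by auto
  with N show ?thesis by (rule negligible_subset)
qed

subsection \<open>Absolutely continuous paths\<close>

definition interval_families :: "real \<Rightarrow> real \<Rightarrow> (nat \<times> (nat \<Rightarrow> real) \<times> (nat \<Rightarrow> real)) set" where
  "interval_families a b = {(N, s, t). (\<forall>i<N. a \<le> s i \<and> s i \<le> t i \<and> t i \<le> b) \<and>
     (\<forall>i<N. \<forall>j<N. i \<noteq> j \<longrightarrow> {s i<..<t i} \<inter> {s j<..<t j} = {})}"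

lemma sum_interval_family_le:
  assumes "(N, s, t) \<in> interval_families a b" "a \<le> b"
  shows "(\<Sum>i<N. t i - s i) \<le> b - a"
proof -
  have fam: "\<And>i. i < N \<Longrightarrow> a \<le> s i \<and> s i \<le> t i \<and> t i \<le> b"
    "\<And>i j. i < N \<Longrightarrow> j < N \<Longrightarrow> i \<noteq> j \<Longrightarrow> {s i<..<t i} \<inter> {s j<..<t j} = {}"
    using assms(1) unfolding interval_families_def by auto
  have "ennreal (\<Sum>i<N. t i - s i) = (\<Sum>i<N. emeasure lborel {s i<..<t i})"
    using fam(1) by (subst sum_ennreal[symmetric]) auto
  also have "\<dots> = emeasure lborel (\<Union>i<N. {s i<..<t i})"
    by (rule sum_emeasure) (use fam(2) in \<open>auto simp: disjoint_family_on_def\<close>)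
  also have "\<dots> \<le> emeasure lborel {a..b}"
  proof (rule emeasure_mono)
    show "(\<Union>i<N. {s i<..<t i}) \<subseteq> {a..b}"
    proof
      fix x assume "x \<in> (\<Union>i<N. {s i<..<t i})"
      then obtain i where "i < N" "s i < x" "x < t i" by auto
      then show "x \<in> {a..b}" using fam(1)[of i] by auto
    qed
  qed auto
  also have "\<dots> = ennreal (b - a)" using assms by simp
  finally show ?thesis using assms by (simp add: ennreal_le_iff)
qed

definition clip :: "real \<Rightarrow> real \<Rightarrow> real \<Rightarrow> real" where
  "clip x y u = max x (min y u)"

text \<open>The total variation on \<open>[x, y]\<close>, written as a supremum over the families of
  the fixed interval \<open>[a, b]\<close> clipped to \<open>[x, y]\<close>. The common index set
  lets a single family serve two adjacent intervals at once.\<close>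

definition var_on :: "real \<Rightarrow> real \<Rightarrow> (real \<Rightarrow> 'a::real_normed_vector) \<Rightarrow> real \<Rightarrow> real \<Rightarrow> ennreal" where
  "var_on a b f x y = (SUP (N, s, t)\<in>interval_families a b.
     ennreal (\<Sum>i<N. norm (f (clip x y (t i)) - f (clip x y (s i)))))"

lemma clip_family:
  assumes "(N, s, t) \<in> interval_families a b" "a \<le> x" "x \<le> y" "y \<le> b"
  shows "(N, \<lambda>i. clip x y (s i), \<lambda>i. clip x y (t i)) \<in> interval_families x y"
proof -
  have mono: "clip x y u \<le> clip x y v" if "u \<le> v" for u v
    using that by (auto simp: clip_def)
  have rng: "x \<le> clip x y u" "clip x y u \<le> y" for u
    using assms(3) by (auto simp: clip_def)
  have sub: "{clip x y u<..<clip x y v} \<subseteq> {u<..<v}" for u v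
    using assms(3) by (auto simp: clip_def max_def min_def split: if_splits)
  have fam: "\<And>i. i < N \<Longrightarrow> s i \<le> t i"
    "\<And>i j. i < N \<Longrightarrow> j < N \<Longrightarrow> i \<noteq> j \<Longrightarrow> {s i<..<t i} \<inter> {s j<..<t j} = {}"
    using assms(1) unfolding interval_families_def by blast+
  have "{clip x y (s i)<..<clip x y (t i)} \<inter> {clip x y (s j)<..<clip x y (t j)} = {}"
    if "i < N" "j < N" "i \<noteq> j" for i j
    using fam(2)[OF that] sub by blast
  then show ?thesis
    unfolding interval_families_def mem_Collect_eq split_conv using fam(1) mono rng by blast
qed

lemma interval_families_mono:
  "a' \<le> a \<Longrightarrow> b \<le> b' \<Longrightarrow> interval_families a b \<subseteq> interval_families a' b'"
  unfolding interval_families_def by (safe; meson order_trans)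

text \<open>An interval of the family with \<open>y\<close> in its interior is split at
  \<open>y\<close> by the triangle inequality; every other interval clips to a point in one of the
  two halves.\<close>

lemma var_on_subadd:
  assumes "a \<le> x" "x \<le> y" "y \<le> z" "z \<le> b"
  shows "var_on a b f x z \<le> var_on a b f x y + var_on a b f y z"
  unfolding var_on_def[of a b f x z]
proof (rule SUP_least, clarify)
  fix N s t assume fam: "(N, s, t) \<in> interval_families a b"
  have "(\<Sum>i<N. norm (f (clip x z (t i)) - f (clip x z (s i)))) \<le>
    (\<Sum>i<N. norm (f (clip x y (t i)) - f (clip x y (s i))) + norm (f (clip y z (t i)) - f (clip y z (s i))))"
  proof (rule sum_mono)
    fix i assume "i \<in> {..<N}"
    then have st: "s i \<le> t i" using fam by (auto simp: interval_families_def)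
    consider "t i \<le> y" | "y \<le> s i" | "s i < y" "y < t i" by linarith
    then show "norm (f (clip x z (t i)) - f (clip x z (s i))) \<le>
        norm (f (clip x y (t i)) - f (clip x y (s i))) + norm (f (clip y z (t i)) - f (clip y z (s i)))"
    proof cases
      case 1
      then have "clip x z (t i) = clip x y (t i)" "clip x z (s i) = clip x y (s i)"
        using assms st by (auto simp: clip_def)
      then show ?thesis by simp
    next
      case 2
      then have "clip x z (t i) = clip y z (t i)" "clip x z (s i) = clip y z (s i)"
        using assms st by (auto simp: clip_def)
      then show ?thesis by simp
    next
      case 3
      then have "clip x z (t i) = clip y z (t i)" "clip x z (s i) = clip x y (s i)"
        "clip x y (t i) = y" "clip y z (s i) = y"
        using assms st by (auto simp: clip_def)
      then show ?thesis
        using norm_triangle_ineq[of "f (clip y z (t i)) - f y" "f y - f (clip x y (s i))"] by simp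
    qed
  qed
  then have "ennreal (\<Sum>i<N. norm (f (clip x z (t i)) - f (clip x z (s i)))) \<le>
     ennreal (\<Sum>i<N. norm (f (clip x y (t i)) - f (clip x y (s i)))) +
     ennreal (\<Sum>i<N. norm (f (clip y z (t i)) - f (clip y z (s i))))"
    by (auto simp: sum.distrib sum_nonneg simp flip: ennreal_plus intro!: ennreal_leI)
  also have "\<dots> \<le> var_on a b f x y + var_on a b f y z"
    unfolding var_on_def using fam by (intro add_mono SUP_upper2[of "(N, s, t)"]) auto
  finally show "ennreal (\<Sum>i<N. norm (f (clip x z (t i)) - f (clip x z (s i)))) \<le>
     var_on a b f x y + var_on a b f y z" .
qed

lemma norm_add_var_on_le:
  assumes "a \<le> x" "x \<le> y" "y \<le> z" "z \<le> b"
  shows "ennreal (norm (f z - f y)) + var_on a b f x y \<le> var_on a b f x z"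
proof -
  have ne: "interval_families a b \<noteq> {}"
  proof -
    have "(0, \<lambda>_. 0, \<lambda>_. 0) \<in> interval_families a b" by (simp add: interval_families_def)
    then show ?thesis by blast
  qed
  have "ennreal (norm (f z - f y)) + var_on a b f x y =
     (SUP (N, s, t)\<in>interval_families a b. ennreal (norm (f z - f y)) +
        ennreal (\<Sum>i<N. norm (f (clip x y (t i)) - f (clip x y (s i)))))"
    unfolding var_on_def using ne
    by (subst ennreal_SUP_add_right) (auto simp: case_prod_beta intro!: SUP_cong)
  also have "\<dots> \<le> var_on a b f x z"
  proof (rule SUP_least, clarify)
    fix N s t assume fam: "(N, s, t) \<in> interval_families a b"
    \<comment> \<open>The interval \<open>[y, z]\<close> is appended as member number
      \<open>N\<close>; the others are clipped to \<open>[x, y]\<close>, so their interiors stay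
      disjoint from it.\<close>
    define s' where "s' i = (if i < N then clip x y (s i) else y)" for i
    define t' where "t' i = (if i < N then clip x y (t i) else z)" for i
    have cl: "(N, \<lambda>i. clip x y (s i), \<lambda>i. clip x y (t i)) \<in> interval_families x y"
      by (rule clip_family[OF fam]) (use assms in auto)
    have fam': "(Suc N, s', t') \<in> interval_families a b"
      using cl assms unfolding interval_families_def s'_def t'_def
      by (auto simp: less_Suc_eq disjoint_iff; smt (verit))
    have eq: "(\<Sum>i<Suc N. norm (f (clip x z (t' i)) - f (clip x z (s' i)))) =
       norm (f z - f y) + (\<Sum>i<N. norm (f (clip x y (t i)) - f (clip x y (s i))))"
    proof -
      have "clip x z (clip x y u) = clip x y u" for u
        using assms by (auto simp: clip_def)
      moreover have "clip x z z = z" "clip x z y = y" using assms by (auto simp: clip_def)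
      ultimately show ?thesis by (simp add: s'_def t'_def)
    qed
    have "ennreal (norm (f z - f y)) + ennreal (\<Sum>i<N. norm (f (clip x y (t i)) - f (clip x y (s i)))) =
      ennreal (\<Sum>i<Suc N. norm (f (clip x z (t' i)) - f (clip x z (s' i))))"
      unfolding eq by (subst ennreal_plus) (auto intro: sum_nonneg)
    also have "\<dots> \<le> var_on a b f x z"
      unfolding var_on_def by (rule SUP_upper2[OF fam']) simp
    finally show "ennreal (norm (f z - f y)) + ennreal (\<Sum>i<N. norm (f (clip x y (t i)) - f (clip x y (s i))))
       \<le> var_on a b f x z" .
  qed
  finally show ?thesis .
qed

lemma abs_continuous_onD:
  assumes "abs_continuous_on a b f" "e > 0"
  obtains d where "d > 0" "\<And>N s t. (N, s, t) \<in> interval_families a b \<Longrightarrow> (\<Sum>i<N. t i - s i) < d \<Longrightarrow>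
     (\<Sum>i<N. norm (f (t i) - f (s i))) < e"
proof -
  obtain d where "d > 0" and d: "\<forall>(N::nat) s t.
        (\<forall>i<N. a \<le> s i \<and> s i \<le> t i \<and> t i \<le> b) \<and>
        (\<forall>i<N. \<forall>j<N. i \<noteq> j \<longrightarrow> {s i<..<t i} \<inter> {s j<..<t j} = {}) \<and>
        (\<Sum>i<N. t i - s i) < d \<longrightarrow> (\<Sum>i<N. norm (f (t i) - f (s i))) < e"
    using assms unfolding abs_continuous_on_def by blast
  show thesis
  proof (rule that[OF \<open>d > 0\<close>])
    fix N s t assume "(N, s, t) \<in> interval_families a b" "(\<Sum>i<N. t i - s i) < d"
    then show "(\<Sum>i<N. norm (f (t i) - f (s i))) < e"
      using d[rule_format, of N s t] unfolding interval_families_def by simp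
  qed
qed

text \<open>Clipping confines a family to \<open>[x, y]\<close>, so its total length is below
  \<open>d\<close>.\<close>

lemma abs_continuous_on_var_on_small:
  assumes "abs_continuous_on a b f" "e > 0"
  obtains d where "d > 0" "\<And>x y. a \<le> x \<Longrightarrow> x \<le> y \<Longrightarrow> y \<le> b \<Longrightarrow> y - x < d \<Longrightarrow> var_on a b f x y \<le> ennreal e"
proof -
  obtain d where d: "d > 0" "\<And>N s t. (N, s, t) \<in> interval_families a b \<Longrightarrow> (\<Sum>i<N. t i - s i) < d \<Longrightarrow>
     (\<Sum>i<N. norm (f (t i) - f (s i))) < e"
    by (rule abs_continuous_onD[OF assms]) blast
  show thesis
  proof (rule that[OF d(1)])
    fix x y assume xy: "a \<le> x" "x \<le> y" "y \<le> b" "y - x < d"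
    show "var_on a b f x y \<le> ennreal e"
      unfolding var_on_def
    proof (rule SUP_least, clarify)
      fix N s t assume fam: "(N, s, t) \<in> interval_families a b"
      have cl: "(N, \<lambda>i. clip x y (s i), \<lambda>i. clip x y (t i)) \<in> interval_families x y"
        by (rule clip_family[OF fam]) (use xy in auto)
      then have "(\<Sum>i<N. clip x y (t i) - clip x y (s i)) < d"
        using sum_interval_family_le xy by fastforce
      moreover have "(N, \<lambda>i. clip x y (s i), \<lambda>i. clip x y (t i)) \<in> interval_families a b"
        using cl interval_families_mono xy by blast
      ultimately have "(\<Sum>i<N. norm (f (clip x y (t i)) - f (clip x y (s i)))) < e"
        using d(2) by blast
      then show "ennreal (\<Sum>i<N. norm (f (clip x y (t i)) - f (clip x y (s i)))) \<le> ennreal e"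
        by (intro ennreal_leI) simp
    qed
  qed
qed

text \<open>\<open>V\<close> is the variation from \<open>a\<close>. It is finite because steps of
  length \<open>d / 2\<close> add at most 1 each and finitely many reach \<open>x\<close>; it is
  continuous because the variation over short intervals is small. Clipping extends it constantly to
  the whole line.\<close>

lemma abs_continuous_on_dominating:
  assumes ac: "abs_continuous_on a b f" and ab: "a \<le> b"
  obtains V :: "real \<Rightarrow> real" where "mono V" "continuous_on UNIV V"
    "\<And>x y. a \<le> x \<Longrightarrow> x \<le> y \<Longrightarrow> y \<le> b \<Longrightarrow> norm (f y - f x) \<le> V y - V x"
proof -
  obtain d where d: "d > 0" "\<And>x y. a \<le> x \<Longrightarrow> x \<le> y \<Longrightarrow> y \<le> b \<Longrightarrow> y - x < d \<Longrightarrow> var_on a b f x y \<le> ennreal 1"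
    using abs_continuous_on_var_on_small[OF ac, of 1] by auto
  have fin: "var_on a b f a x < \<infinity>" if x: "a \<le> x" "x \<le> b" for x
  proof -
    have "var_on a b f a (min x (a + real k * (d / 2))) < \<infinity>" for k
    proof (induction k)
      case 0
      have "var_on a b f a a \<le> 1" using d(2)[of a a] x d(1) by simp
      then show ?case using x by (simp add: order_le_less_trans)
    next
      case (Suc k)
      let ?y = "\<lambda>k. min x (a + real k * (d / 2))"
      have "a \<le> ?y k" "?y k \<le> ?y (Suc k)" "?y (Suc k) \<le> b" "?y (Suc k) - ?y k < d"
      proof -
        have "real (Suc k) * (d / 2) = real k * (d / 2) + d / 2" "real k * (d / 2) \<ge> 0"
          using d(1) by (simp_all add: field_simps)
        then show "a \<le> ?y k" "?y k \<le> ?y (Suc k)" "?y (Suc k) \<le> b" "?y (Suc k) - ?y k < d"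
          using x d(1) by linarith+
      qed
      then have "var_on a b f a (?y (Suc k)) \<le> var_on a b f a (?y k) + var_on a b f (?y k) (?y (Suc k))"
          "var_on a b f (?y k) (?y (Suc k)) \<le> 1"
        using var_on_subadd[of a a "?y k" "?y (Suc k)" b f] d(2)[of "?y k" "?y (Suc k)"] by auto
      then have "var_on a b f a (?y (Suc k)) \<le> var_on a b f a (?y k) + 1"
        by (meson add_left_mono order_trans)
      also have "\<dots> < \<infinity>" using Suc by simp
      finally show ?case .
    qed
    moreover obtain k where "(x - a) / (d / 2) < real k" using reals_Archimedean2 by blast
    then have "min x (a + real k * (d / 2)) = x" using d(1) by (simp add: field_simps)
    ultimately show ?thesis by metis
  qed
  define V where "V x = enn2real (var_on a b f a (clip a b x))" for x
  have V: "var_on a b f a x = ennreal (V x)" if "a \<le> x" "x \<le> b" for x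
    using fin[OF that] that by (simp add: V_def clip_def)
  have Vnn: "V x \<ge> 0" for x by (simp add: V_def)
  have Vclip: "V x = V (clip a b x)" for x using ab by (simp add: V_def clip_def)
  have dom: "norm (f y - f x) \<le> V y - V x" if "a \<le> x" "x \<le> y" "y \<le> b" for x y
  proof -
    have "ennreal (norm (f y - f x)) + ennreal (V x) \<le> ennreal (V y)"
      using norm_add_var_on_le[of a a x y b f] V[of x] V[of y] that by simp
    then have "ennreal (norm (f y - f x) + V x) \<le> ennreal (V y)" using Vnn by simp
    then show ?thesis using Vnn by (simp add: ennreal_le_iff del: ennreal_plus)
  qed
  have monV: "mono V"
  proof
    fix x y :: real assume xy: "x \<le> y"
    have "norm (f (clip a b y) - f (clip a b x)) \<le> V (clip a b y) - V (clip a b x)"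
      by (rule dom) (use xy ab in \<open>auto simp: clip_def\<close>)
    then show "V x \<le> V y" using Vclip[of x] Vclip[of y] by (smt (verit) norm_ge_zero)
  qed
  have small: "\<exists>d>0. \<forall>x y. x \<le> y \<and> y - x < d \<longrightarrow> V y - V x \<le> e" if e: "e > 0" for e
  proof -
    obtain d where d: "d > 0" "\<And>x y. a \<le> x \<Longrightarrow> x \<le> y \<Longrightarrow> y \<le> b \<Longrightarrow> y - x < d \<Longrightarrow> var_on a b f x y \<le> ennreal e"
      by (rule abs_continuous_on_var_on_small[OF ac e]) blast
    have "V y - V x \<le> e" if xy: "x \<le> y" "y - x < d" for x y
    proof -
      have cl: "a \<le> clip a b x" "clip a b x \<le> clip a b y" "clip a b y \<le> b" "clip a b y - clip a b x < d"
        using xy ab d(1) by (auto simp: clip_def)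
      have "ennreal (V (clip a b y)) \<le> ennreal (V (clip a b x)) + ennreal e"
        using var_on_subadd[of a a "clip a b x" "clip a b y" b f] V[of "clip a b x"] V[of "clip a b y"] cl d(2)[OF cl]
        by (smt (verit) add_left_mono order_trans)
      then have "ennreal (V (clip a b y)) \<le> ennreal (V (clip a b x) + e)" using Vnn e by simp
      then show ?thesis
        using Vclip[of x] Vclip[of y] Vnn[of "clip a b x"] e by (simp add: ennreal_le_iff del: ennreal_plus)
    qed
    with d(1) show ?thesis by blast
  qed
  have contV: "continuous_on UNIV V"
    unfolding continuous_on_iff
  proof (intro ballI allI impI)
    fix x e :: real assume "e > 0"
    then obtain d where d: "d > 0" "\<And>x y. x \<le> y \<Longrightarrow> y - x < d \<Longrightarrow> V y - V x \<le> e / 2"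
      using small[of "e / 2"] by auto
    have "dist (V y) (V x) < e" if "dist y x < d" for y
      using d(2)[of x y] d(2)[of y x] that \<open>e > 0\<close> monoD[OF monV, of x y] monoD[OF monV, of y x]
      by (cases "x \<le> y") (auto simp: dist_real_def)
    with d(1) show "\<exists>d>0. \<forall>y\<in>UNIV. dist y x < d \<longrightarrow> dist (V y) (V x) < e" by blast
  qed
  show thesis by (rule that[OF monV contV dom])
qed

text \<open>Each coordinate is a difference of two monotone continuous functions, since adding the
  dominating function \<open>W\<close> makes it monotone. Finitely many null sets are
  discarded.\<close>

lemma abs_continuous_on_differentiable_ae:
  fixes f :: "real \<Rightarrow> 'a::euclidean_space"
  assumes ac: "abs_continuous_on a b f" and ab: "a \<le> b"
  shows "negligible {t \<in> {a<..<b}. \<not> f differentiable (at t)}"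
proof -
  obtain V :: "real \<Rightarrow> real" where V: "mono V" "continuous_on UNIV V"
    "\<And>x y. a \<le> x \<Longrightarrow> x \<le> y \<Longrightarrow> y \<le> b \<Longrightarrow> norm (f y - f x) \<le> V y - V x"
    using abs_continuous_on_dominating[OF ac ab] by blast
  define W where "W u = V (clip a b u)" for u
  define h where "h u = f (clip a b u)" for u
  have clip_mono: "clip a b x \<le> clip a b y" if "x \<le> y" for x y
    using that by (auto simp: clip_def)
  have dom: "norm (h y - h x) \<le> W y - W x" if "x \<le> y" for x y
    unfolding h_def W_def by (rule V(3)) (use clip_mono that ab in \<open>auto simp: clip_def\<close>)
  have W: "mono W" "continuous_on UNIV W"
  proof -
    show "mono W" using V(1) clip_mono by (auto simp: mono_def W_def)
    have "continuous_on UNIV (clip a b)" unfolding clip_def by (intro continuous_intros)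
    then show "continuous_on UNIV W"
      unfolding W_def by (rule continuous_on_compose2[OF V(2)]) auto
  qed
  have h: "continuous_on UNIV h"
    unfolding continuous_on_iff
  proof (intro ballI allI impI)
    fix x e :: real assume "e > 0"
    then obtain d where d: "d > 0" "\<And>y. dist y x < d \<Longrightarrow> dist (W y) (W x) < e"
      using W(2) unfolding continuous_on_iff by blast
    have "dist (h y) (h x) \<le> dist (W y) (W x)" for y
      using dom[of x y] dom[of y x] by (cases "x \<le> y") (auto simp: dist_norm norm_minus_commute)
    with d show "\<exists>d>0. \<forall>y\<in>UNIV. dist y x < d \<longrightarrow> dist (h y) (h x) < e"
      by (meson order_le_less_trans)
  qed
  define g where "g i u = W u + h u \<bullet> i" for i u
  have g: "mono (g i)" "continuous_on UNIV (g i)" if i: "i \<in> Basis" for i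
  proof -
    show "mono (g i)"
    proof
      fix x y :: real assume "x \<le> y"
      have "\<bar>(h y - h x) \<bullet> i\<bar> \<le> norm (h y - h x)" using i by (rule Basis_le_norm)
      with dom[OF \<open>x \<le> y\<close>] show "g i x \<le> g i y"
        by (simp add: g_def inner_diff_left)
    qed
    show "continuous_on UNIV (g i)"
      unfolding g_def by (intro continuous_intros W h)
  qed
  define N where "N = {t. \<not> W differentiable (at t)} \<union> (\<Union>i\<in>Basis. {t. \<not> g i differentiable (at t)})"
  have N: "negligible N"
    unfolding N_def
    by (intro negligible_Un negligible_Union mono_continuous_differentiable_ae W)
       (auto intro!: mono_continuous_differentiable_ae g)
  have "f differentiable (at t)" if t: "t \<in> {a<..<b}" "t \<notin> N" for t
  proof -
    have "(\<lambda>u. h u \<bullet> i) differentiable (at t)" if "i \<in> Basis" for i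
    proof -
      have "(\<lambda>u. g i u - W u) differentiable (at t)"
        using t that by (intro differentiable_diff) (auto simp: N_def)
      then show ?thesis by (simp add: g_def)
    qed
    then have "h differentiable (at t)"
      by (subst differentiable_componentwise_within) auto
    then obtain D where "(h has_derivative D) (at t)" by (auto simp: differentiable_def)
    then have "(f has_derivative D) (at t)"
      by (rule has_derivative_transform_within_open[of _ _ _ _ "{a<..<b}"])
         (use t in \<open>auto simp: h_def clip_def\<close>)
    then show ?thesis by (rule differentiableI)
  qed
  then have "{t \<in> {a<..<b}. \<not> f differentiable (at t)} \<subseteq> N" by auto
  with N show ?thesis by (rule negligible_subset)
qed

section \<open>The fundamental theorem for absolutely continuous paths\<close>

lemma sum_intervals_le_emeasure:
  assumes "(N, s, t) \<in> interval_families a b" "\<And>i. i < N \<Longrightarrow> {s i<..<t i} \<subseteq> S" "S \<in> sets lebesgue"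
  shows "ennreal (\<Sum>i<N. t i - s i) \<le> emeasure lebesgue S"
proof -
  have fam: "\<And>i. i < N \<Longrightarrow> s i \<le> t i"
    "\<And>i j. i < N \<Longrightarrow> j < N \<Longrightarrow> i \<noteq> j \<Longrightarrow> {s i<..<t i} \<inter> {s j<..<t j} = {}"
    using assms(1) unfolding interval_families_def by blast+
  have "ennreal (\<Sum>i<N. t i - s i) = (\<Sum>i<N. emeasure lebesgue {s i<..<t i})"
    using fam(1) by (subst sum_ennreal[symmetric]) auto
  also have "\<dots> = emeasure lebesgue (\<Union>i<N. {s i<..<t i})"
    by (rule sum_emeasure) (use fam(2) in \<open>auto simp: disjoint_family_on_def\<close>)
  also have "\<dots> \<le> emeasure lebesgue S"
    by (rule emeasure_mono) (use assms in auto)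
  finally show ?thesis .
qed

text \<open>A gauge argument. Tags off \<open>N\<close> use the derivative as usual. Tags in
  \<open>N\<close> contribute nothing to the Riemann sum since \<open>f'\<close> vanishes there;
  their intervals lie in an open set of measure below \<open>\<eta>\<close>, and absolute continuity
  makes the total increment over them small.\<close>

theorem abs_continuous_on_has_integral_derivative:
  fixes f :: "real \<Rightarrow> 'a::euclidean_space"
  assumes ac: "abs_continuous_on a b f" and ab: "a \<le> b" and N: "negligible N"
    and der: "\<And>t. t \<in> {a..b} - N \<Longrightarrow> (f has_vector_derivative f' t) (at t)"
    and zero: "\<And>t. t \<in> N \<Longrightarrow> f' t = 0"
  shows "(f' has_integral (f b - f a)) {a..b}"
proof (cases "a = b")
  case True
  then show ?thesis by auto
next
  case False
  with ab have ab: "a < b" by simp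
  show ?thesis
    unfolding has_integral_factor_content_real
  proof safe
    fix e :: real
    assume e: "e > 0"
    \<comment> \<open>Half of the tolerance goes to the tags off \<open>N\<close>, half to those in
      \<open>N\<close>.\<close>
    define e2 where "e2 = e / 2"
    have e2: "e2 > 0" "e2 * (b - a) > 0" using e ab by (auto simp: e2_def)
    obtain \<eta> where \<eta>: "\<eta> > 0" "\<And>n s t. (n, s, t) \<in> interval_families a b \<Longrightarrow> (\<Sum>i<n. t i - s i) < \<eta> \<Longrightarrow>
       (\<Sum>i<n. norm (f (t i) - f (s i))) < e2 * (b - a)"
      by (rule abs_continuous_onD[OF ac e2(2)]) blast
    obtain U where U: "open U" "N \<subseteq> U" "emeasure lebesgue (U - N) < ennreal \<eta>"
      using sets_lebesgue_outer_open[of N \<eta>] N \<eta>(1) negligible_imp_sets by metis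
    have Umeas: "emeasure lebesgue U < ennreal \<eta>"
    proof -
      have "N \<in> null_sets lebesgue" using N by (simp add: negligible_iff_null_sets)
      then have "emeasure lebesgue (U - N) = emeasure lebesgue U"
        using U(1) by (intro emeasure_Diff_null_set) auto
      with U(3) show ?thesis by simp
    qed
    have "\<exists>d>0. x \<in> {a..b} - N \<longrightarrow> (\<forall>y\<in>{a..b}. norm (y-x) < d \<longrightarrow> norm (f y - f x - (y-x) *\<^sub>R f' x) \<le> e2 * norm (y-x))" for x
    proof (cases "x \<in> {a..b} - N")
      case True
      then have "(f has_vector_derivative f' x) (at x within {a..b})"
        using der has_vector_derivative_at_within by blast
      then show ?thesis
        using e2(1) unfolding has_vector_derivative_def has_derivative_within_alt by blast
    next
      case False
      then show ?thesis by (intro exI[of _ 1]) auto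
    qed
    then obtain d1 where d1: "\<And>x. 0 < d1 x"
        "\<And>x y. \<lbrakk>x \<in> {a..b} - N; y \<in> {a..b}; norm (y-x) < d1 x\<rbrakk>
           \<Longrightarrow> norm (f y - f x - (y-x) *\<^sub>R f' x) \<le> e2 * norm (y-x)"
      by metis
    have "\<exists>d>0. x \<in> N \<longrightarrow> ball x d \<subseteq> U" for x
      using U by (cases "x \<in> N") (auto simp: open_contains_ball intro: exI[of _ 1])
    then obtain d2 where d2: "\<And>x. 0 < d2 x" "\<And>x. x \<in> N \<Longrightarrow> ball x (d2 x) \<subseteq> U"
      by metis
    define d where "d x = (if x \<in> N then d2 x else d1 x)" for x
    have dpos: "0 < d x" for x using d1 d2 by (simp add: d_def)
    show "\<exists>d. gauge d \<and> (\<forall>p. p tagged_division_of {a..b} \<and> d fine p \<longrightarrow>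
      norm ((\<Sum>(x, k)\<in>p. measure lborel k *\<^sub>R f' x) - (f b - f a)) \<le> e * measure lborel {a..b})"
    proof (rule exI, safe)
      show "gauge (\<lambda>x. ball x (d x))"
        using dpos gauge_ball_dependent by blast
    next
      fix p
      assume ptag: "p tagged_division_of {a..b}" and finep: "(\<lambda>x. ball x (d x)) fine p"
      have fin: "finite p" using ptag by blast
      have K: "\<exists>u v. K = {u..v} \<and> u \<le> v \<and> a \<le> u \<and> v \<le> b \<and> x \<in> {u..v} \<and> {u..v} \<subseteq> ball x (d x)"
        if xK: "(x, K) \<in> p" for x K
      proof -
        obtain u v where "K = cbox u v" using tagged_division_ofD(4)[OF ptag xK] by blast
        moreover have "x \<in> K" "K \<subseteq> {a..b}" using tagged_division_ofD(2,3)[OF ptag xK] by auto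
        moreover have "K \<subseteq> ball x (d x)" using finep xK by blast
        ultimately have uv: "K = {u..v}" "x \<in> {u..v}" "{u..v} \<subseteq> {a..b}" "{u..v} \<subseteq> ball x (d x)" by auto
        then have "u \<le> v" "u \<in> {a..b}" "v \<in> {a..b}" by auto
        with uv show ?thesis by auto
      qed
      have ba: "b - a = (\<Sum>(x,K)\<in>p. Sup K - Inf K)" "f b - f a = (\<Sum>(x,K)\<in>p. f(Sup K) - f(Inf K))"
        using additive_tagged_division_1[of a b p "\<lambda>x. x"] additive_tagged_division_1[of a b p f]
              ab ptag by simp_all
      define q where "q = {z \<in> p. fst z \<in> N}"
      have q: "finite q" "q \<subseteq> p" using fin by (auto simp: q_def)
      have small: "(\<Sum>z\<in>q. norm (f (Sup (snd z)) - f (Inf (snd z)))) < e2 * (b - a)"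
      proof -
        \<comment> \<open>The division intervals with tags in \<open>N\<close> are enumerated, so
          that they form a family to which absolute continuity applies.\<close>
        obtain h where h: "bij_betw h {0..<card q} q"
          using ex_bij_betw_nat_finite[OF q(1)] by blast
        then have hq: "h i \<in> q" if "i < card q" for i
          using that by (auto simp: bij_betw_def)
        define s where "s i = Inf (snd (h i))" for i
        define t where "t i = Sup (snd (h i))" for i
        have Ki: "snd (h i) = {s i..t i} \<and> s i \<le> t i \<and> a \<le> s i \<and> t i \<le> b \<and> {s i..t i} \<subseteq> U"
          if i: "i < card q" for i
        proof -
          obtain x K' where xK: "h i = (x, K')" by fastforce
          have xp: "(x, K') \<in> p" "x \<in> N" using hq[OF i] xK by (auto simp: q_def)
          then obtain u v where uv: "K' = {u..v}" "u \<le> v" "a \<le> u" "v \<le> b" "{u..v} \<subseteq> ball x (d x)"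
            using K by blast
          then show ?thesis using xp d2(2)[of x] by (auto simp: s_def t_def xK d_def)
        qed
        have fam: "(card q, s, t) \<in> interval_families a b"
        proof -
          have "{s i<..<t i} \<inter> {s j<..<t j} = {}" if "i < card q" "j < card q" "i \<noteq> j" for i j
          proof -
            have "h i \<noteq> h j" using h that by (auto simp: bij_betw_def inj_on_def)
            moreover have "h i \<in> p" "h j \<in> p" using hq that q by auto
            ultimately have "interior (snd (h i)) \<inter> interior (snd (h j)) = {}"
              using tagged_division_ofD(5)[OF ptag] by (metis prod.collapse)
            then show ?thesis using Ki that by simp
          qed
          then show ?thesis unfolding interval_families_def using Ki by blast
        qed
        have "ennreal (\<Sum>i<card q. t i - s i) \<le> emeasure lebesgue U"
        proof (rule sum_intervals_le_emeasure[OF fam])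
          show "{s i<..<t i} \<subseteq> U" if "i < card q" for i
            using Ki[OF that] by force
        qed (use U in auto)
        also have "\<dots> < ennreal \<eta>" by (rule Umeas)
        finally have "(\<Sum>i<card q. t i - s i) < \<eta>"
          by (meson ennreal_leI not_le)
        then have "(\<Sum>i<card q. norm (f (t i) - f (s i))) < e2 * (b - a)"
          using \<eta>(2)[OF fam] by blast
        also have "(\<Sum>i<card q. norm (f (t i) - f (s i))) = (\<Sum>z\<in>q. norm (f (Sup (snd z)) - f (Inf (snd z))))"
          unfolding s_def t_def lessThan_atLeast0 by (rule sum.reindex_bij_betw[OF h])
        finally show ?thesis .
      qed
      let ?n = "\<lambda>z. norm (f (Sup (snd z)) - f (Inf (snd z)))"
      have bound: "norm (measure lborel K *\<^sub>R f' x - (f (Sup K) - f (Inf K))) \<le> e2 * (Sup K - Inf K) + (if x \<in> N then ?n (x, K) else 0)"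
        if xK: "(x, K) \<in> p" for x K
      proof -
        obtain u v where k: "K = {u..v}" "u \<le> v" "a \<le> u" "v \<le> b" "x \<in> {u..v}" "{u..v} \<subseteq> ball x (d x)"
          using K[OF xK] by blast
        show ?thesis
        proof (cases "x \<in> N")
          case True
          then show ?thesis using zero[OF True] k e2 by (simp add: norm_minus_commute)
        next
          case False
          have uin: "norm (u - x) < d1 x" and vin: "norm (v - x) < d1 x"
          proof -
            have "u \<in> ball x (d x)" "v \<in> ball x (d x)"
              using k(2) k(6) by (metis atLeastAtMost_iff order_refl subsetD)+
            then show "norm (u - x) < d1 x" "norm (v - x) < d1 x"
              using False by (auto simp: d_def dist_norm norm_minus_commute)
          qed
          have "norm ((v - u) *\<^sub>R f' x - (f v - f u)) = norm (f u - f x - (u - x) *\<^sub>R f' x - (f v - f x - (v - x) *\<^sub>R f' x))"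
            by (auto simp: algebra_simps)
          also have "\<dots> \<le> norm (f u - f x - (u - x) *\<^sub>R f' x) + norm (f v - f x - (v - x) *\<^sub>R f' x)"
            by (rule norm_triangle_ineq4)
          also have "\<dots> \<le> e2 * norm (u - x) + e2 * norm (v - x)"
            by (intro add_mono d1(2)) (use uin vin k False in auto)
          also have "\<dots> \<le> e2 * (v - u)"
            using k by (auto simp: field_simps)
          finally show ?thesis using k False by simp
        qed
      qed
      have "(\<Sum>(x, k)\<in>p. measure lborel k *\<^sub>R f' x) - (f b - f a) =
          (\<Sum>z\<in>p. measure lborel (snd z) *\<^sub>R f' (fst z) - (f (Sup (snd z)) - f (Inf (snd z))))"
        by (simp add: ba split_def sum_subtractf [symmetric])
      also have "norm \<dots> \<le> (\<Sum>z\<in>p. e2 * (Sup (snd z) - Inf (snd z)) + (if fst z \<in> N then ?n z else 0))"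
      proof (rule sum_norm_le)
        fix z assume "z \<in> p"
        then have "(fst z, snd z) \<in> p" by simp
        from bound[OF this] show "norm (measure lborel (snd z) *\<^sub>R f' (fst z) - (f (Sup (snd z)) - f (Inf (snd z))))
          \<le> e2 * (Sup (snd z) - Inf (snd z)) + (if fst z \<in> N then ?n z else 0)" by (auto split: if_splits)
      qed
      also have "\<dots> = e2 * (b - a) + (\<Sum>z\<in>q. ?n z)"
      proof -
        have "(\<Sum>z\<in>p. if fst z \<in> N then ?n z else 0) = (\<Sum>z\<in>q. ?n z)"
          unfolding q_def using fin by (simp add: sum.inter_filter)
        then show ?thesis
          by (simp add: sum.distrib ba(1) split_def sum_distrib_left)
      qed
      also have "\<dots> \<le> e * (b - a)"
        using small by (simp add: e2_def field_simps)
      finally show "norm ((\<Sum>(x, k)\<in>p. measure lborel k *\<^sub>R f' x) - (f b - f a)) \<le> e * measure lborel {a..b}"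
        using ab by simp
    qed
  qed
qed

text \<open>\<open>g\<close> may fail to be measurable, so it is not integrated directly. The
  derivative \<open>h\<close> is gauge integrable, hence measurable, and its positive part lies
  below \<open>g\<close>. Once the right-hand side is finite this positive part is Lebesgue
  integrable, and it dominates \<open>h\<close> in the gauge integral.\<close>

lemma abs_continuous_on_increment_le_nn_integral:
  fixes f :: "real \<Rightarrow> real"
  assumes ac: "abs_continuous_on a b f" and ab: "a \<le> b" and N: "negligible N"
    and der: "\<And>t. t \<in> {a<..<b} - N \<Longrightarrow> \<exists>D. (f has_real_derivative D) (at t) \<and> D \<le> g t"
    and g: "\<And>t. g t \<ge> 0"
  shows "ennreal (f b - f a) \<le> (\<integral>\<^sup>+t\<in>{a..b}. ennreal (g t) \<partial>lborel)" (is "_ \<le> ?I")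
proof (cases "?I = \<infinity>")
  case True
  then show ?thesis by simp
next
  case False
  \<comment> \<open>The endpoints join the exceptional set because derivatives are only given in the
    open interval.\<close>
  define N' where "N' = N \<union> {a, b}"
  have N': "negligible N'" using N by (simp add: N'_def)
  obtain D where D: "\<And>t. t \<in> {a..b} - N' \<Longrightarrow> (f has_real_derivative D t) (at t) \<and> D t \<le> g t"
  proof -
    have "\<forall>t\<in>{a..b} - N'. \<exists>D. (f has_real_derivative D) (at t) \<and> D \<le> g t"
      using der by (auto simp: N'_def)
    then show thesis using that by metis
  qed
  define h where "h t = (if t \<in> N' then 0 else D t)" for t
  have hint: "(h has_integral (f b - f a)) {a..b}"
    by (rule abs_continuous_on_has_integral_derivative[OF ac ab N'])
       (use D in \<open>auto simp: h_def has_real_derivative_iff_has_vector_derivative\<close>)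
  have hg: "h t \<le> g t" if "t \<in> {a..b}" for t
    using D[of t] that g[of t] by (auto simp: h_def)
  define k where "k t = (if t \<in> {a..b} then max (h t) 0 else 0)" for t
  have "h \<in> borel_measurable (lebesgue_on {a..b})"
    using hint by (intro integrable_imp_measurable) auto
  then have "(\<lambda>t. if t \<in> {a..b} then h t else 0) \<in> borel_measurable lebesgue"
    by (rule borel_measurable_if_I) auto
  then have "(\<lambda>t. max (if t \<in> {a..b} then h t else 0) 0) \<in> borel_measurable lebesgue"
    by measurable
  also have "(\<lambda>t. max (if t \<in> {a..b} then h t else 0) 0) = k" by (auto simp: k_def)
  \<comment> \<open>Measurability is obtained for the completed measure, whereas the action
    integrates over \<open>lborel\<close>; the nonnegative integral is the same for both.\<close>
  finally have kmeas: "k \<in> borel_measurable lebesgue" .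
  have "(\<integral>\<^sup>+t. ennreal (k t) \<partial>lebesgue) = (\<integral>\<^sup>+t. ennreal (k t) \<partial>lborel)"
    by (rule nn_integral_completion)
  also have "\<dots> \<le> ?I"
    by (rule nn_integral_mono) (use hg g in \<open>auto simp: k_def indicator_def intro!: ennreal_leI\<close>)
  finally have le: "(\<integral>\<^sup>+t. ennreal (k t) \<partial>lebesgue) \<le> ?I" .
  have kint: "integrable lebesgue k"
    by (rule integrableI_nonneg)
       (use kmeas le False in \<open>auto simp: k_def less_top order_le_less_trans\<close>)
  have "(k has_integral (integral\<^sup>L lebesgue k)) UNIV"
    using kint by (rule has_integral_integral_lebesgue)
  then have "((\<lambda>t. max (h t) 0) has_integral (integral\<^sup>L lebesgue k)) {a..b}"
    unfolding k_def by (subst (asm) has_integral_restrict_UNIV)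
  then have "f b - f a \<le> integral\<^sup>L lebesgue k"
    by (rule has_integral_le[OF hint]) auto
  then have "ennreal (f b - f a) \<le> ennreal (integral\<^sup>L lebesgue k)" by (rule ennreal_leI)
  also have "\<dots> = (\<integral>\<^sup>+t. ennreal (k t) \<partial>lebesgue)"
    using kint by (intro nn_integral_eq_integral[symmetric]) (auto simp: k_def)
  finally show ?thesis using le by simp
qed

lemma abs_continuous_on_subinterval:
  assumes "abs_continuous_on a b f" "a \<le> a'" "b' \<le> b"
  shows "abs_continuous_on a' b' f"
  unfolding abs_continuous_on_def
proof (intro allI impI)
  fix e :: real assume "e > 0"
  then obtain d where d: "d > 0" "\<And>N s t. (N, s, t) \<in> interval_families a b \<Longrightarrow> (\<Sum>i<N. t i - s i) < d \<Longrightarrow>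
     (\<Sum>i<N. norm (f (t i) - f (s i))) < e"
    by (rule abs_continuous_onD[OF assms(1)]) blast
  show "\<exists>\<eta>>0. \<forall>(N::nat) s t.
        (\<forall>i<N. a' \<le> s i \<and> s i \<le> t i \<and> t i \<le> b') \<and>
        (\<forall>i<N. \<forall>j<N. i \<noteq> j \<longrightarrow> {s i<..<t i} \<inter> {s j<..<t j} = {}) \<and>
        (\<Sum>i<N. t i - s i) < \<eta> \<longrightarrow>
        (\<Sum>i<N. norm (f (t i) - f (s i))) < e"
  proof (rule exI, rule conjI[OF d(1)], intro allI impI, elim conjE)
    fix N :: nat and s t
    assume *: "\<forall>i<N. a' \<le> s i \<and> s i \<le> t i \<and> t i \<le> b'"
        "\<forall>i<N. \<forall>j<N. i \<noteq> j \<longrightarrow> {s i<..<t i} \<inter> {s j<..<t j} = {}" "(\<Sum>i<N. t i - s i) < d"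
    then have "(N, s, t) \<in> interval_families a' b'"
      unfolding interval_families_def by blast
    then have "(N, s, t) \<in> interval_families a b"
      using interval_families_mono assms by blast
    then show "(\<Sum>i<N. norm (f (t i) - f (s i))) < e" using d(2) *(3) by blast
  qed
qed

text \<open>The step condition \<open>r\<close> lets this apply to maps that are Lipschitz only at small scales.\<close>
lemma abs_continuous_on_Lipschitz_image:
  fixes f :: "real \<Rightarrow> 'a::real_normed_vector" and g :: "real \<Rightarrow> 'b::real_normed_vector"
  assumes ac: "abs_continuous_on a b f" and r: "r > 0" and k: "k > 0"
    and lip: "\<And>x y. a \<le> x \<Longrightarrow> x \<le> y \<Longrightarrow> y \<le> b \<Longrightarrow> norm (f y - f x) < r \<Longrightarrow> norm (g y - g x) \<le> k * norm (f y - f x)"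
  shows "abs_continuous_on a b g"
  unfolding abs_continuous_on_def
proof (intro allI impI)
  fix e :: real assume e: "e > 0"
  define e' where "e' = min r (e / k)"
  have "e' > 0" using e r k by (simp add: e'_def)
  then obtain d where d: "d > 0" "\<And>N s t. (N, s, t) \<in> interval_families a b \<Longrightarrow> (\<Sum>i<N. t i - s i) < d \<Longrightarrow>
     (\<Sum>i<N. norm (f (t i) - f (s i))) < e'"
    by (rule abs_continuous_onD[OF ac]) blast
  show "\<exists>\<eta>>0. \<forall>(N::nat) s t.
        (\<forall>i<N. a \<le> s i \<and> s i \<le> t i \<and> t i \<le> b) \<and>
        (\<forall>i<N. \<forall>j<N. i \<noteq> j \<longrightarrow> {s i<..<t i} \<inter> {s j<..<t j} = {}) \<and>
        (\<Sum>i<N. t i - s i) < \<eta> \<longrightarrow>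
        (\<Sum>i<N. norm (g (t i) - g (s i))) < e"
  proof (rule exI, rule conjI[OF d(1)], intro allI impI, elim conjE)
    fix N :: nat and s t
    assume *: "\<forall>i<N. a \<le> s i \<and> s i \<le> t i \<and> t i \<le> b"
        "\<forall>i<N. \<forall>j<N. i \<noteq> j \<longrightarrow> {s i<..<t i} \<inter> {s j<..<t j} = {}" "(\<Sum>i<N. t i - s i) < d"
    then have "(N, s, t) \<in> interval_families a b"
      unfolding interval_families_def by blast
    then have S: "(\<Sum>i<N. norm (f (t i) - f (s i))) < e'" using d(2) *(3) by blast
    have "norm (g (t i) - g (s i)) \<le> k * norm (f (t i) - f (s i))" if i: "i < N" for i
    proof (rule lip)
      have "norm (f (t i) - f (s i)) \<le> (\<Sum>i<N. norm (f (t i) - f (s i)))"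
        by (rule member_le_sum[of i "{..<N}" "\<lambda>i. norm (f (t i) - f (s i))"]) (use i in auto)
      then show "norm (f (t i) - f (s i)) < r" using S by (simp add: e'_def)
    qed (use * i in auto)
    then have "(\<Sum>i<N. norm (g (t i) - g (s i))) \<le> k * (\<Sum>i<N. norm (f (t i) - f (s i)))"
      unfolding sum_distrib_left by (intro sum_mono) auto
    also have "\<dots> < k * e'" using S k by simp
    also have "\<dots> \<le> k * (e / k)" using k by (intro mult_left_mono) (auto simp: e'_def)
    finally show "(\<Sum>i<N. norm (g (t i) - g (s i))) < e" using k by simp
  qed
qed

lemma abs_continuous_on_imp_continuous_on:
  assumes "abs_continuous_on a b f"
  shows "continuous_on {a..b} f"
  unfolding continuous_on_iff
proof (intro ballI allI impI)
  fix x e :: real assume x: "x \<in> {a..b}" and e: "e > 0"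
  obtain d where d: "d > 0" "\<And>N s t. (N, s, t) \<in> interval_families a b \<Longrightarrow> (\<Sum>i<N. t i - s i) < d \<Longrightarrow>
     (\<Sum>i<N. norm (f (t i) - f (s i))) < e"
    by (rule abs_continuous_onD[OF assms e]) blast
  have one: "norm (f t - f s) < e" if "a \<le> s" "s \<le> t" "t \<le> b" "t - s < d" for s t
    using d(2)[of 1 "\<lambda>_. s" "\<lambda>_. t"] that by (auto simp: interval_families_def)
  have "dist (f y) (f x) < e" if "y \<in> {a..b}" "dist y x < d" for y
    using one[of x y] one[of y x] that x
    by (cases "x \<le> y") (auto simp: dist_norm norm_minus_commute)
  with d(1) show "\<exists>d>0. \<forall>y\<in>{a..b}. dist y x < d \<longrightarrow> dist (f y) (f x) < e" by blast
qed

text \<open>The bridge from a pointwise inequality to the action: \<open>Y\<close> is differentiable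
  almost everywhere, so \<open>der\<close> need only treat times with a genuine velocity
  \<open>v\<close>. Stopping at \<open>t1\<close> is harmless since the integrand is
  nonnegative.\<close>

lemma increment_le_action:
  fixes Y :: "real \<Rightarrow> 'a::euclidean_space"
  assumes Y: "abs_continuous_on T 0 Y" and f: "abs_continuous_on T t1 f" and t1: "T \<le> t1" "t1 \<le> 0"
    and der: "\<And>t v. T < t \<Longrightarrow> t < t1 \<Longrightarrow> (Y has_vector_derivative v) (at t) \<Longrightarrow>
      \<exists>D. (f has_real_derivative D) (at t) \<and> D \<le> (norm (v - F (Y t)))\<^sup>2 / 2"
  shows "ennreal (f t1 - f T) \<le> action F T Y"
proof -
  let ?g = "\<lambda>t. (norm (vector_derivative Y (at t) - F (Y t)))\<^sup>2"
  \<comment> \<open>The action carries a factor 1/2, so \<open>2 * f\<close> is compared with the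
    squared norm.\<close>
  have "ennreal (2 * f t1 - 2 * f T) \<le> (\<integral>\<^sup>+t\<in>{T..t1}. ennreal (?g t) \<partial>lborel)"
  proof (rule abs_continuous_on_increment_le_nn_integral)
    show "abs_continuous_on T t1 (\<lambda>t. 2 * f t)"
      by (rule abs_continuous_on_Lipschitz_image[OF f, of 1 2]) (auto simp: abs_if)
    show "negligible {t \<in> {T<..<0}. \<not> Y differentiable (at t)}"
      by (rule abs_continuous_on_differentiable_ae[OF Y]) (use t1 in auto)
    fix t assume t: "t \<in> {T<..<t1} - {t \<in> {T<..<0}. \<not> Y differentiable (at t)}"
    then have "(Y has_vector_derivative vector_derivative Y (at t)) (at t)"
      using t1 by (auto simp: vector_derivative_works[symmetric])
    then obtain D where "(f has_real_derivative D) (at t)" "D \<le> ?g t / 2"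
      using der[of t] t by auto
    then show "\<exists>D. ((\<lambda>t. 2 * f t) has_real_derivative D) (at t) \<and> D \<le> ?g t"
      by (intro exI[of _ "2 * D"]) (auto intro!: derivative_eq_intros)
  qed (use t1 in auto)
  also have "\<dots> \<le> (\<integral>\<^sup>+t\<in>{T..0}. ennreal (?g t) \<partial>lborel)"
    by (rule nn_integral_mono) (use t1 in \<open>auto simp: indicator_def\<close>)
  finally have "ennreal (2 * f t1 - 2 * f T) / 2 \<le> (\<integral>\<^sup>+t\<in>{T..0}. ennreal (?g t) \<partial>lborel) / 2"
    by (rule divide_right_mono_ennreal)
  \<comment> \<open>A negative increment is truncated to 0 by \<open>ennreal\<close> on both
    sides.\<close>
  moreover have "ennreal (2 * f t1 - 2 * f T) / 2 = ennreal (f t1 - f T)"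
  proof (cases "f t1 - f T \<ge> 0")
    case True
    have "ennreal (2 * f t1 - 2 * f T) / ennreal 2 = ennreal ((2 * f t1 - 2 * f T) / 2)"
      by (rule divide_ennreal) (use True in auto)
    moreover have "(2 * f t1 - 2 * f T) / 2 = f t1 - f T" by simp
    ultimately show ?thesis by simp
  next
    case False
    then show ?thesis by (simp add: ennreal_neg)
  qed
  ultimately show ?thesis unfolding action_def by simp
qed

subsection \<open>Functions of class \<open>C\<^sup>k\<close>\<close>

lemma C_k_Suc_imp: "C_k (Suc k) f \<Longrightarrow> C_k k f"
proof (induction k arbitrary: f)
  case 0
  then show ?case
    by (auto simp: continuous_on_eq_continuous_at intro: differentiable_imp_continuous_within)
next
  case (Suc k)
  then show ?case by simp
qed

lemma C_k_le: "C_k n f \<Longrightarrow> k \<le> n \<Longrightarrow> C_k k f"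
  by (induction n) (auto simp: le_Suc_eq dest: C_k_Suc_imp simp del: C_k.simps)

lemma C_k_Suc_has_derivative:
  "C_k (Suc k) f \<Longrightarrow> (f has_derivative frechet_derivative f (at x)) (at x)"
  by (simp add: frechet_derivative_works)

lemma C_k_imp_continuous_on: "C_k k f \<Longrightarrow> continuous_on UNIV f"
  using C_k_le[of k f 0] by simp

lemma C_k_add:
  assumes "C_k k f" "C_k k g" shows "C_k k (\<lambda>x. f x + g x)"
  using assms
proof (induction k arbitrary: f g)
  case 0
  then show ?case by (simp add: continuous_on_add)
next
  case (Suc k)
  have "frechet_derivative (\<lambda>x. f x + g x) (at x) v =
      frechet_derivative f (at x) v + frechet_derivative g (at x) v" for x v
  proof -
    have "((\<lambda>x. f x + g x) has_derivative (\<lambda>v. frechet_derivative f (at x) v + frechet_derivative g (at x) v)) (at x)"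
      using Suc.prems by (intro has_derivative_add C_k_Suc_has_derivative)
    from fun_cong[OF frechet_derivative_at[OF this], of v] show ?thesis by simp
  qed
  then show ?case using Suc by (simp add: differentiable_add)
qed

lemma C_k_scaleR_right:
  assumes "C_k k f" shows "C_k k (\<lambda>x. f x *\<^sub>R i)"
  using assms
proof (induction k arbitrary: f)
  case 0
  then show ?case by (auto intro: continuous_intros)
next
  case (Suc k)
  have D: "((\<lambda>x. f x *\<^sub>R i) has_derivative (\<lambda>v. frechet_derivative f (at x) v *\<^sub>R i)) (at x)" for x
    using Suc.prems by (intro has_derivative_scaleR_left C_k_Suc_has_derivative)
  have "frechet_derivative (\<lambda>x. f x *\<^sub>R i) (at x) v = frechet_derivative f (at x) v *\<^sub>R i" for x v
    using fun_cong[OF frechet_derivative_at[OF D[of x]], of v] by simp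
  moreover have "(\<lambda>x. f x *\<^sub>R i) differentiable (at x)" for x
    using D by (rule differentiableI)
  ultimately show ?case using Suc by simp
qed

lemma C_k_const: "C_k k (\<lambda>x. a)"
  by (induction k arbitrary: a) (auto simp: frechet_derivative_const)

lemma C_k_sum:
  assumes "finite I" "\<And>i. i \<in> I \<Longrightarrow> C_k k (f i)" shows "C_k k (\<lambda>x. \<Sum>i\<in>I. f i x)"
  using assms by (induction I rule: finite_induct) (auto intro: C_k_add C_k_const simp del: C_k.simps)

text \<open>\<open>C_k\<close> speaks of derivatives in one fixed direction at a time; this crude
  operator bound turns finitely many directional bounds into a uniform one.\<close>

lemma norm_linear_le_sum_Basis:
  fixes f :: "'a::euclidean_space \<Rightarrow> 'b::real_normed_vector"
  assumes "linear f"
  shows "norm (f v) \<le> (\<Sum>i\<in>Basis. norm (f i)) * norm v"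
proof -
  have "f v = f (\<Sum>i\<in>Basis. (v \<bullet> i) *\<^sub>R i)" by (simp add: euclidean_representation)
  also have "\<dots> = (\<Sum>i\<in>Basis. (v \<bullet> i) *\<^sub>R f i)"
    using assms by (simp add: linear_sum linear_cmul)
  also have "norm \<dots> \<le> (\<Sum>i\<in>Basis. norm (f i) * norm v)"
  proof (rule sum_norm_le)
    fix i :: 'a assume "i \<in> Basis"
    then have "\<bar>v \<bullet> i\<bar> * norm (f i) \<le> norm v * norm (f i)"
      by (intro mult_right_mono Basis_le_norm) auto
    then show "norm ((v \<bullet> i) *\<^sub>R f i) \<le> norm (f i) * norm v" by (simp add: mult.commute)
  qed
  finally show ?thesis by (simp add: sum_distrib_right)
qed

lemma continuous_bounded_on_cball:
  fixes f :: "'a::euclidean_space \<Rightarrow> 'b::real_normed_vector"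
  assumes "continuous_on UNIV f"
  obtains B where "B \<ge> 0" "\<And>x. x \<in> cball 0 R \<Longrightarrow> norm (f x) \<le> B"
proof -
  have "compact (f ` cball 0 R)"
    using assms by (intro compact_continuous_image continuous_on_subset[OF assms]) auto
  then obtain B where "\<forall>y\<in>f ` cball 0 R. norm y \<le> B"
    using compact_imp_bounded bounded_iff by metis
  then have "norm (f x) \<le> max B 0" if "x \<in> cball 0 R" for x
    using that by (simp add: le_max_iff_disj)
  then show thesis by (intro that[of "max B 0"]) auto
qed

lemma C_1_Lipschitz_on_cball:
  fixes f :: "'a::euclidean_space \<Rightarrow> 'b::real_normed_vector"
  assumes f: "C_k (Suc 0) f"
  obtains K where "K \<ge> 0" "\<And>x y. x \<in> cball 0 R \<Longrightarrow> y \<in> cball 0 R \<Longrightarrow> norm (f x - f y) \<le> K * norm (x - y)"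
proof -
  have "\<forall>i. \<exists>B. B \<ge> 0 \<and> (\<forall>x\<in>cball 0 R. norm (frechet_derivative f (at x) i) \<le> B)"
  proof
    fix i :: 'a
    have "continuous_on UNIV (\<lambda>x. frechet_derivative f (at x) i)" using f by simp
    from continuous_bounded_on_cball[OF this, of R]
    show "\<exists>B. B \<ge> 0 \<and> (\<forall>x\<in>cball 0 R. norm (frechet_derivative f (at x) i) \<le> B)" by metis
  qed
  then obtain B where B: "\<And>i. B i \<ge> 0" "\<And>i x. x \<in> cball 0 R \<Longrightarrow> norm (frechet_derivative f (at x) i) \<le> B i"
    by metis
  define K where "K = (\<Sum>i\<in>Basis. B i)"
  show thesis
  proof (rule that[of K])
    show "K \<ge> 0" unfolding K_def using B by (simp add: sum_nonneg)
    show "norm (f x - f y) \<le> K * norm (x - y)" if xy: "x \<in> cball 0 R" "y \<in> cball 0 R" for x y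
    proof (rule differentiable_bound[of "cball 0 R" f "\<lambda>x. frechet_derivative f (at x)"])
      fix z :: 'a assume z: "z \<in> cball 0 R"
      show "(f has_derivative frechet_derivative f (at z)) (at z within cball 0 R)"
        using C_k_Suc_has_derivative[OF f] by (rule has_derivative_at_withinI)
      show "onorm (frechet_derivative f (at z)) \<le> K"
      proof (rule onorm_le)
        fix v
        have "linear (frechet_derivative f (at z))"
          using C_k_Suc_has_derivative[OF f] has_derivative_linear by blast
        then have "norm (frechet_derivative f (at z) v) \<le> (\<Sum>i\<in>Basis. norm (frechet_derivative f (at z) i)) * norm v"
          by (rule norm_linear_le_sum_Basis)
        also have "\<dots> \<le> K * norm v"
          unfolding K_def using B(2)[OF z] by (intro mult_right_mono sum_mono) auto
        finally show "norm (frechet_derivative f (at z) v) \<le> K * norm v" .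
      qed
    qed (use xy in auto)
  qed
qed

text \<open>\<open>C_1_Lipschitz_on_cball\<close> is applied to each partial derivative, and the
  constants are summed over the basis.\<close>

lemma C_2_derivative_Lipschitz_on_cball:
  fixes f :: "'a::euclidean_space \<Rightarrow> 'b::real_normed_vector"
  assumes f: "C_k (Suc (Suc 0)) f"
  obtains K where "K \<ge> 0" "\<And>x y v. x \<in> cball 0 R \<Longrightarrow> y \<in> cball 0 R \<Longrightarrow>
      norm (frechet_derivative f (at x) v - frechet_derivative f (at y) v) \<le> K * norm (x - y) * norm v"
proof -
  have "\<forall>i. \<exists>B. B \<ge> 0 \<and> (\<forall>x\<in>cball 0 R. \<forall>y\<in>cball 0 R.
      norm (frechet_derivative f (at x) i - frechet_derivative f (at y) i) \<le> B * norm (x - y))"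
  proof
    fix i :: 'a
    have "C_k (Suc 0) (\<lambda>x. frechet_derivative f (at x) i)" using f by simp
    from C_1_Lipschitz_on_cball[OF this, of R]
    show "\<exists>B. B \<ge> 0 \<and> (\<forall>x\<in>cball 0 R. \<forall>y\<in>cball 0 R.
      norm (frechet_derivative f (at x) i - frechet_derivative f (at y) i) \<le> B * norm (x - y))" by metis
  qed
  then obtain B where B: "\<And>i. B i \<ge> 0" "\<And>i x y. x \<in> cball 0 R \<Longrightarrow> y \<in> cball 0 R \<Longrightarrow>
      norm (frechet_derivative f (at x) i - frechet_derivative f (at y) i) \<le> B i * norm (x - y)"
    by metis
  define K where "K = (\<Sum>i\<in>Basis. B i)"
  show thesis
  proof (rule that[of K])
    show "K \<ge> 0" unfolding K_def using B by (simp add: sum_nonneg)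
    fix x y v :: 'a assume xy: "x \<in> cball 0 R" "y \<in> cball 0 R"
    have "linear (\<lambda>v. frechet_derivative f (at x) v - frechet_derivative f (at y) v)"
      using C_k_Suc_has_derivative[OF f] has_derivative_linear by (intro linear_compose_sub) blast+
    then have "norm (frechet_derivative f (at x) v - frechet_derivative f (at y) v) \<le>
        (\<Sum>i\<in>Basis. norm (frechet_derivative f (at x) i - frechet_derivative f (at y) i)) * norm v"
      by (rule norm_linear_le_sum_Basis)
    also have "\<dots> \<le> (\<Sum>i\<in>Basis. B i * norm (x - y)) * norm v"
      using B(2)[OF xy] by (intro mult_right_mono sum_mono) auto
    finally show "norm (frechet_derivative f (at x) v - frechet_derivative f (at y) v) \<le> K * norm (x - y) * norm v"
      by (simp add: K_def sum_distrib_right)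
  qed
qed

text \<open>The mean value inequality for \<open>f\<close> minus its linear part at
  \<open>y\<close>, on the segment from \<open>y\<close> to \<open>x\<close>. It yields the
  Lipschitz constant of the derivative itself rather than half of it.\<close>

lemma C_2_Taylor_on_cball:
  fixes f :: "'a::euclidean_space \<Rightarrow> 'b::real_normed_vector"
  assumes f: "C_k (Suc (Suc 0)) f"
  obtains K where "K \<ge> 0" "\<And>x y. x \<in> cball 0 R \<Longrightarrow> y \<in> cball 0 R \<Longrightarrow>
      norm (f x - f y - frechet_derivative f (at y) (x - y)) \<le> K * (norm (x - y))\<^sup>2"
proof -
  obtain K where K: "K \<ge> 0" "\<And>x y v. x \<in> cball 0 R \<Longrightarrow> y \<in> cball 0 R \<Longrightarrow>
      norm (frechet_derivative f (at x) v - frechet_derivative f (at y) v) \<le> K * norm (x - y) * norm v"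
    by (rule C_2_derivative_Lipschitz_on_cball[OF f, of R]) blast
  show thesis
  proof (rule that[OF K(1)])
    fix x y :: 'a assume xy: "x \<in> cball 0 R" "y \<in> cball 0 R"
    let ?S = "closed_segment y x"
    have S: "?S \<subseteq> cball 0 R" using xy by (intro closed_segment_subset) auto
    let ?h = "\<lambda>z. f z - frechet_derivative f (at y) z"
    have lin: "linear (frechet_derivative f (at z))" for z
      using C_k_Suc_has_derivative[OF f] has_derivative_linear by blast
    have "norm (?h x - ?h y) \<le> (K * norm (x - y)) * norm (x - y)"
    proof (rule differentiable_bound[of ?S ?h "\<lambda>z v. frechet_derivative f (at z) v - frechet_derivative f (at y) v"])
      fix z :: 'a assume z: "z \<in> ?S"
      show "(?h has_derivative (\<lambda>v. frechet_derivative f (at z) v - frechet_derivative f (at y) v)) (at z within ?S)"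
        by (intro has_derivative_diff has_derivative_at_withinI[OF C_k_Suc_has_derivative[OF f]]
            linear_imp_has_derivative lin)
      show "onorm (\<lambda>v. frechet_derivative f (at z) v - frechet_derivative f (at y) v) \<le> K * norm (x - y)"
      proof (rule onorm_le)
        fix v
        have "norm (frechet_derivative f (at z) v - frechet_derivative f (at y) v) \<le> K * norm (z - y) * norm v"
          using K(2) S z xy by blast
        also have "\<dots> \<le> K * norm (x - y) * norm v"
          using segment_bound(1)[OF z] K(1) by (intro mult_right_mono mult_left_mono) auto
        finally show "norm (frechet_derivative f (at z) v - frechet_derivative f (at y) v) \<le> K * norm (x - y) * norm v" .
      qed
    qed auto
    then show "norm (f x - f y - frechet_derivative f (at y) (x - y)) \<le> K * (norm (x - y))\<^sup>2"
      using lin[of y] by (simp add: linear_diff power2_eq_square algebra_simps)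
  qed
qed

lemma C_k_curve:
  fixes c :: "real \<Rightarrow> 'a::real_normed_vector"
  assumes "C_k (Suc k) c"
  shows "(c has_vector_derivative velocity c s) (at s)" "C_k k (velocity c)"
proof -
  have D: "(c has_derivative frechet_derivative c (at s)) (at s)" for s
    using assms by (rule C_k_Suc_has_derivative)
  then have "c differentiable (at s)" for s by (rule differentiableI)
  then show "(c has_vector_derivative velocity c s) (at s)" for s
    by (simp add: vector_derivative_works)
  then have "frechet_derivative c (at s) = (\<lambda>h. h *\<^sub>R velocity c s)" for s
    using D has_derivative_unique unfolding has_vector_derivative_def by blast
  then have "frechet_derivative c (at s) 1 = velocity c s" for s by simp
  moreover have "C_k k (\<lambda>s. frechet_derivative c (at s) 1)" using assms by simp
  ultimately show "C_k k (velocity c)" by simp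
qed

text \<open>\<open>grad\<close> is a definite description; the vector of partial derivatives is
  exhibited and shown to be the only candidate.\<close>

lemma C_k_grad:
  fixes V :: "'a::euclidean_space \<Rightarrow> real"
  assumes V: "C_k (Suc k) V"
  shows "(V has_derivative (\<lambda>v. grad V x \<bullet> v)) (at x)" "C_k k (grad V)"
proof -
  let ?g = "\<lambda>x. \<Sum>i\<in>Basis. frechet_derivative V (at x) i *\<^sub>R i"
  have D: "(V has_derivative frechet_derivative V (at x)) (at x)" for x
    using V by (rule C_k_Suc_has_derivative)
  have eq: "frechet_derivative V (at x) = (\<lambda>v. v \<bullet> ?g x)" for x
  proof
    fix v
    have "linear (frechet_derivative V (at x))" using D has_derivative_linear by blast
    then show "frechet_derivative V (at x) v = v \<bullet> ?g x"
      by (subst euclidean_representation[symmetric, of v])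
         (simp add: linear_sum linear_cmul inner_sum_right mult.commute)
  qed
  have G: "GDERIV V x :> ?g x" for x
    unfolding gderiv_def using D[of x] eq[of x] by simp
  have "grad V x = ?g x" for x
    unfolding grad_def
  proof (rule the_equality[where P="\<lambda>D. GDERIV V x :> D"])
    fix D assume "GDERIV V x :> D"
    then have "(\<lambda>v. v \<bullet> D) = (\<lambda>v. v \<bullet> ?g x)"
      using G[of x] unfolding gderiv_def by (rule has_derivative_unique)
    then have "(D - ?g x) \<bullet> D = (D - ?g x) \<bullet> ?g x" by (rule fun_cong)
    then have "(D - ?g x) \<bullet> (D - ?g x) = 0"
      by (simp only: inner_diff_right)
    then show "D = ?g x" by simp
  qed (rule G)
  then have geq: "grad V = ?g" by auto
  show "(V has_derivative (\<lambda>v. grad V x \<bullet> v)) (at x)"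
    using G[of x] unfolding geq gderiv_def by (simp add: inner_commute)
  show "C_k k (grad V)"
    unfolding geq using V by (intro C_k_sum C_k_scaleR_right) auto
qed

lemma hessian_mult:
  fixes V :: "real^'n \<Rightarrow> real"
  assumes "C_k (Suc (Suc k)) V"
  shows "hessian V x *v v = frechet_derivative (grad V) (at x) v"
proof -
  have "C_k (Suc k) (grad V)" using assms by (rule C_k_grad)
  then have "grad V differentiable (at x)" by simp
  then show ?thesis
    unfolding hessian_def by (metis jacobian_works frechet_derivative_at)
qed

text \<open>The second difference of \<open>V\<close> over a small parallelogram is symmetric in the
  two sides. By the mean value theorem and a Taylor bound for the gradient it equals
  \<open>h\<^sup>2 * (?H w \<bullet> v)\<close> up to order \<open>h ^ 3\<close>; exchanging
  \<open>v\<close> and \<open>w\<close> and letting \<open>h\<close> tend to 0 gives the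
  symmetry.\<close>

lemma second_derivative_symmetric:
  fixes V :: "'a::euclidean_space \<Rightarrow> real"
  assumes V: "C_k (Suc (Suc (Suc k))) V"
  shows "frechet_derivative (grad V) (at x) v \<bullet> w = frechet_derivative (grad V) (at x) w \<bullet> v"
proof -
  let ?g = "grad V" and ?H = "frechet_derivative (grad V) (at x)"
  have g: "C_k (Suc (Suc 0)) ?g" using C_k_le[OF C_k_grad(2)[OF V], of "Suc (Suc 0)"] by (simp del: C_k.simps)
  have DV: "(V has_derivative (\<lambda>u. ?g y \<bullet> u)) (at y)" for y
    using V by (rule C_k_grad)
  have lin: "linear ?H" using C_k_Suc_has_derivative[OF g] has_derivative_linear by blast
  \<comment> \<open>Large enough for the ball to contain the whole parallelogram when
    \<open>h \<le> 1\<close>.\<close>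
  define R where "R = norm x + norm v + norm w"
  obtain K where K: "K \<ge> 0" "\<And>y z. y \<in> cball 0 R \<Longrightarrow> z \<in> cball 0 R \<Longrightarrow>
      norm (?g y - ?g z - frechet_derivative ?g (at z) (y - z)) \<le> K * (norm (y - z))\<^sup>2"
    by (rule C_2_Taylor_on_cball[OF g, of R]) blast
  have key: "\<bar>(V (x + h *\<^sub>R v + h *\<^sub>R w) - V (x + h *\<^sub>R v) - V (x + h *\<^sub>R w) + V x) - h\<^sup>2 * (?H w \<bullet> v)\<bar>
      \<le> 2 * K * (norm v + norm w)^2 * norm v * h^3"
    if h: "0 < h" "h \<le> 1" and vw: "norm x + norm v + norm w \<le> R" for h v w
  proof -
    let ?f = "\<lambda>s. V (x + s *\<^sub>R v + h *\<^sub>R w) - V (x + s *\<^sub>R v)"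
    let ?f' = "\<lambda>s. (?g (x + s *\<^sub>R v + h *\<^sub>R w) - ?g (x + s *\<^sub>R v)) \<bullet> v"
    have "(?f has_real_derivative ?f' s) (at s)" for s
    proof -
      have "(?f has_derivative (\<lambda>u. ?g (x + s *\<^sub>R v + h *\<^sub>R w) \<bullet> (u *\<^sub>R v) - ?g (x + s *\<^sub>R v) \<bullet> (u *\<^sub>R v))) (at s)"
        by (intro has_derivative_diff has_derivative_compose[OF _ DV])
           (auto intro!: derivative_eq_intros)
      moreover have "(\<lambda>u. ?g (x + s *\<^sub>R v + h *\<^sub>R w) \<bullet> (u *\<^sub>R v) - ?g (x + s *\<^sub>R v) \<bullet> (u *\<^sub>R v)) = (*) (?f' s)"
        by (auto simp: fun_eq_iff inner_diff_left right_diff_distrib' mult.commute)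
      ultimately show ?thesis by (simp add: has_field_derivative_def)
    qed
    then obtain z where z: "0 < z" "z < h" "?f h - ?f 0 = (h - 0) * ?f' z"
      using MVT2[of 0 h ?f ?f'] h by auto
    have bd: "norm (?g (x + u) - ?g x - ?H u) \<le> K * (h * (norm v + norm w))\<^sup>2"
      if u: "norm u \<le> h * (norm v + norm w)" for u
    proof -
      have "h * (norm v + norm w) \<le> 1 * (norm v + norm w)" using h by (intro mult_right_mono) auto
      then have "x + u \<in> cball 0 R" "x \<in> cball 0 R"
        unfolding mem_cball_0
        using u vw norm_triangle_ineq[of x u] norm_ge_zero[of v] norm_ge_zero[of w] by (simp_all only: mult_1)
      then have "norm (?g (x + u) - ?g x - ?H (x + u - x)) \<le> K * (norm (x + u - x))\<^sup>2"
        by (rule K(2))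
      also have "\<dots> \<le> K * (h * (norm v + norm w))\<^sup>2"
        using u K(1) by (intro mult_left_mono power_mono) auto
      finally show ?thesis by simp
    qed
    have n1: "norm (z *\<^sub>R v + h *\<^sub>R w) \<le> h * (norm v + norm w)"
    proof -
      have "norm (z *\<^sub>R v + h *\<^sub>R w) \<le> z * norm v + h * norm w"
        using norm_triangle_ineq[of "z *\<^sub>R v" "h *\<^sub>R w"] z h by simp
      also have "\<dots> \<le> h * norm v + h * norm w" using z by (intro add_right_mono mult_right_mono) auto
      finally show ?thesis by (simp add: algebra_simps)
    qed
    have n2: "norm (z *\<^sub>R v) \<le> h * (norm v + norm w)"
    proof -
      have "z * norm v \<le> h * norm v" "0 \<le> h * norm w" using z h by (auto intro: mult_right_mono)
      moreover have "norm (z *\<^sub>R v) = z * norm v" using z by simp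
      ultimately show ?thesis unfolding distrib_left by linarith
    qed
    define e where "e = ?g (x + z *\<^sub>R v + h *\<^sub>R w) - ?g (x + z *\<^sub>R v) - h *\<^sub>R ?H w"
    \<comment> \<open>Both gradient values are expanded at \<open>x\<close>. The contributions of
      \<open>z *\<^sub>R v\<close> cancel by linearity, so the unknown intermediate point leaves no
      trace in the main term.\<close>
    have "e = (?g (x + (z *\<^sub>R v + h *\<^sub>R w)) - ?g x - ?H (z *\<^sub>R v + h *\<^sub>R w)) - (?g (x + z *\<^sub>R v) - ?g x - ?H (z *\<^sub>R v))"
      using lin by (simp add: e_def linear_add linear_cmul add.assoc)
    then have "norm e \<le> K * (h * (norm v + norm w))\<^sup>2 + K * (h * (norm v + norm w))\<^sup>2"
      using bd[OF n1] bd[OF n2] norm_triangle_ineq4 by (smt (verit))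
    then have e: "norm e \<le> 2 * K * (norm v + norm w)^2 * h^2"
      unfolding power_mult_distrib by (simp add: mult_ac)
    have "(V (x + h *\<^sub>R v + h *\<^sub>R w) - V (x + h *\<^sub>R v) - V (x + h *\<^sub>R w) + V x) - h\<^sup>2 * (?H w \<bullet> v) = h * (e \<bullet> v)"
      using z(3) by (simp add: e_def inner_diff_left power2_eq_square algebra_simps)
    also have "\<bar>\<dots>\<bar> \<le> h * (norm e * norm v)"
      using h Cauchy_Schwarz_ineq2[of e v] by (simp add: abs_mult)
    also have "\<dots> \<le> h * (2 * K * (norm v + norm w)^2 * h^2 * norm v)"
      using h e by (intro mult_left_mono mult_right_mono) auto
    finally show ?thesis by (simp add: power3_eq_cube power2_eq_square algebra_simps)
  qed
  define C where "C = 2 * K * (norm v + norm w)^2 * norm v + 2 * K * (norm v + norm w)^2 * norm w"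
  have "\<bar>?H w \<bullet> v - ?H v \<bullet> w\<bar> \<le> C * h" if h: "0 < h" "h \<le> 1" for h
  proof -
    have "\<bar>h\<^sup>2 * (?H w \<bullet> v) - h\<^sup>2 * (?H v \<bullet> w)\<bar> \<le> C * h^3"
      using key[OF h, of v w] key[OF h, of w v]
      by (simp add: R_def C_def algebra_simps) 
    moreover have "\<bar>h\<^sup>2 * (?H w \<bullet> v) - h\<^sup>2 * (?H v \<bullet> w)\<bar> = h\<^sup>2 * \<bar>?H w \<bullet> v - ?H v \<bullet> w\<bar>"
      by (simp add: abs_mult flip: right_diff_distrib)
    moreover have "C * h^3 = h\<^sup>2 * (C * h)"
      by (simp add: power3_eq_cube power2_eq_square)
    ultimately have "h\<^sup>2 * \<bar>?H w \<bullet> v - ?H v \<bullet> w\<bar> \<le> h\<^sup>2 * (C * h)" by simp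
    then show ?thesis using h by simp
  qed
  then have "\<forall>\<^sub>F h in at_right 0. \<bar>?H w \<bullet> v - ?H v \<bullet> w\<bar> \<le> C * h"
    by (auto simp: eventually_at_right_field intro!: exI[of _ 1])
  moreover have "((\<lambda>h. C * h) \<longlongrightarrow> C * 0) (at_right 0)" by (intro tendsto_intros)
  ultimately have "\<bar>?H w \<bullet> v - ?H v \<bullet> w\<bar> \<le> C * 0"
    using tendsto_lowerbound trivial_limit_at_right_real by blast
  then show ?thesis by simp
qed

subsection \<open>Tubular coordinates\<close>

lemma periodic_of_int:
  fixes c :: "real \<Rightarrow> 'a"
  assumes "\<And>s. c (s + L) = c s"
  shows "c (s + of_int k * L) = c s"
proof -
  have nat: "c (s + of_nat n * L) = c s" for s n
  proof (induction n)
    case (Suc n)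
    have "s + of_nat (Suc n) * L = (s + of_nat n * L) + L" by (simp add: algebra_simps)
    then show ?case using Suc assms by metis
  qed auto
  show ?thesis
  proof (cases "k \<ge> 0")
    case True
    then show ?thesis using nat[of s "nat k"] by simp
  next
    case False
    then show ?thesis using nat[of "s + of_int k * L" "nat (- k)"] by simp
  qed
qed

text \<open>\<open>K\<close> bounds the curvature and \<open>c0\<close> is a chord-arc constant
  modulo the period: points close in space have close parameters. The radii \<open>r1\<close> and
  \<open>r0\<close> depend on these two numbers alone, which makes the tube uniform in a family of
  curves.\<close>

locale tubular_curve =
  fixes c c' c'' :: "real \<Rightarrow> 'a::euclidean_space" and L K c0 :: real
  assumes L: "L > 0" and periodic: "c (s + L) = c s" and periodic': "c' (s + L) = c' s"
    and der: "(c has_vector_derivative c' s) (at s)"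
    and der': "(c' has_vector_derivative c'' s) (at s)"
    and unit: "norm (c' s) = 1"
    and curvature: "norm (c'' s) \<le> K" and K: "K \<ge> 1"
    and c0: "0 < c0" "c0 \<le> 1"
    and separated: "\<exists>k::int. c0 * \<bar>s - s' - of_int k * L\<bar> \<le> norm (c s - c s')"
begin

text \<open>Two scales. Within parameter distance \<open>r1\<close> of a foot the curve bends too
  little for a second foot (\<open>K * r1 = 1 / 4\<close>). Two points of the curve closer than
  \<open>4 * r0 = c0 * r1\<close> have parameters within \<open>r1\<close> modulo the
  period.\<close>

definition r1 :: real where "r1 = 1 / (4 * K)"
definition r0 :: real where "r0 = c0 * r1 / 4"

lemma r1: "r1 > 0" "K * r1 = 1 / 4" using K by (auto simp: r1_def)

lemma r0: "r0 > 0" "4 * r0 = c0 * r1" "K * r0 \<le> 1 / 16"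
proof -
  show "r0 > 0" "4 * r0 = c0 * r1" using r1 c0 by (auto simp: r0_def)
  have "K * r0 = c0 * (K * r1) / 4" by (simp add: r0_def)
  then show "K * r0 \<le> 1 / 16" using c0 r1 by simp
qed

lemma periodic_int: "c (s + of_int k * L) = c s" "c' (s + of_int k * L) = c' s"
  using periodic_of_int[of c L s k, OF periodic] periodic_of_int[of c' L s k, OF periodic'] .

lemma continuous_c: "continuous_on S c"
  using der by (meson continuous_at_imp_continuous_on has_vector_derivative_continuous)

lemma norm_c_diff_le: "norm (c s - c s') \<le> \<bar>s - s'\<bar>"
proof -
  have "norm (c s - c s') \<le> 1 * norm (s - s')"
  proof (rule differentiable_bound[of UNIV c "\<lambda>x h. h *\<^sub>R c' x"])
    show "(c has_derivative (\<lambda>h. h *\<^sub>R c' x)) (at x within UNIV)" for x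
      using der by (simp add: has_vector_derivative_def)
    show "onorm (\<lambda>h. h *\<^sub>R c' x) \<le> 1" for x
      by (rule onorm_le) (simp add: unit)
  qed auto
  then show ?thesis by simp
qed

text \<open>The first-order condition for a nearest point, restricted to distances below
  \<open>r0\<close>. There it turns out to be equivalent to being nearest, and unlike nearness it
  can be differentiated along a path.\<close>

definition foot :: "'a \<Rightarrow> real \<Rightarrow> bool" where
  "foot Z s \<longleftrightarrow> (Z - c s) \<bullet> c' s = 0 \<and> norm (Z - c s) < r0"

lemma foot_periodic: "foot Z (s + of_int k * L) \<longleftrightarrow> foot Z s"
  by (simp add: foot_def periodic_int)

lemma foot_c: "foot (c s) s" using r0 by (simp add: foot_def)

lemma phase_has_derivative:
  "((\<lambda>x. (Z - c x) \<bullet> c' x) has_real_derivative ((Z - c x) \<bullet> c'' x - 1)) (at x)"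
proof -
  have "((\<lambda>x. (Z - c x) \<bullet> c' x) has_derivative
      (\<lambda>h. (Z - c x) \<bullet> (h *\<^sub>R c'' x) + (0 - h *\<^sub>R c' x) \<bullet> c' x)) (at x)"
    using der[of x] der'[of x] unfolding has_vector_derivative_def
    by (intro has_derivative_inner has_derivative_diff has_derivative_const)
  moreover have "(\<lambda>h. (Z - c x) \<bullet> (h *\<^sub>R c'' x) + (0 - h *\<^sub>R c' x) \<bullet> c' x) = (*) ((Z - c x) \<bullet> c'' x - 1)"
    using unit[of x] by (auto simp: fun_eq_iff algebra_simps power2_norm_eq_inner[symmetric])
  ultimately show ?thesis by (simp add: has_field_derivative_def)
qed

text \<open>The derivative of the phase is \<open>(Z - c x) \<bullet> c'' x - 1\<close>, at most
  \<open>- 1 / 2\<close> as long as \<open>Z\<close> stays within half of the radius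
  \<open>1 / K\<close>.\<close>

lemma phase_decrease:
  assumes near: "\<And>x. x \<in> {s..s'} \<Longrightarrow> norm (Z - c x) \<le> 1 / (2 * K)" and "s \<le> s'"
  shows "(Z - c s') \<bullet> c' s' \<le> (Z - c s) \<bullet> c' s - (s' - s) / 2"
proof (cases "s = s'")
  case True then show ?thesis by simp
next
  case False
  with \<open>s \<le> s'\<close> have "s < s'" by simp
  have "\<exists>z>s. z < s' \<and> (Z - c s') \<bullet> c' s' - (Z - c s) \<bullet> c' s = (s' - s) * ((Z - c z) \<bullet> c'' z - 1)"
    by (rule MVT2[OF \<open>s < s'\<close>]) (rule phase_has_derivative)
  then obtain z where z: "s < z" "z < s'"
    "(Z - c s') \<bullet> c' s' - (Z - c s) \<bullet> c' s = (s' - s) * ((Z - c z) \<bullet> c'' z - 1)" by blast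
  have "(Z - c z) \<bullet> c'' z \<le> norm (Z - c z) * norm (c'' z)" by (rule norm_cauchy_schwarz)
  also have "\<dots> \<le> (1 / (2 * K)) * K"
    using near[of z] z curvature[of z] K by (intro mult_mono) auto
  finally have "(Z - c z) \<bullet> c'' z - 1 \<le> - 1 / 2" using K by simp
  then have "(s' - s) * ((Z - c z) \<bullet> c'' z - 1) \<le> (s' - s) * (- 1 / 2)"
    using \<open>s < s'\<close> by (intro mult_left_mono) auto
  then show ?thesis using z(3) by simp
qed

lemma norm_near:
  assumes "norm (Z - c s) \<le> 3 * r0" "\<bar>x - s\<bar> \<le> r1"
  shows "norm (Z - c x) \<le> 1 / (2 * K)"
proof -
  have "norm (Z - c x) \<le> norm (Z - c s) + norm (c s - c x)"
    using norm_triangle_ineq[of "Z - c s" "c s - c x"] by simp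
  also have "\<dots> \<le> 3 * r0 + r1" using assms norm_c_diff_le[of s x] by simp
  also have "\<dots> \<le> 1 / (2 * K)"
  proof -
    have "K * (3 * r0 + r1) \<le> 1 / 2" using r0 r1 by (simp add: distrib_left)
    then show ?thesis using K by (simp add: field_simps)
  qed
  finally show ?thesis .
qed

lemma sqdist_has_derivative:
  "((\<lambda>x. (norm (Z - c x))\<^sup>2) has_real_derivative - 2 * ((Z - c x) \<bullet> c' x)) (at x)"
proof -
  have "((\<lambda>x. (Z - c x) \<bullet> (Z - c x)) has_derivative
      (\<lambda>h. (Z - c x) \<bullet> (0 - h *\<^sub>R c' x) + (0 - h *\<^sub>R c' x) \<bullet> (Z - c x))) (at x)"
    using der[of x] unfolding has_vector_derivative_def
    by (intro has_derivative_inner has_derivative_diff has_derivative_const)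
  moreover have "(\<lambda>h. (Z - c x) \<bullet> (0 - h *\<^sub>R c' x) + (0 - h *\<^sub>R c' x) \<bullet> (Z - c x)) = (*) (- 2 * ((Z - c x) \<bullet> c' x))"
    by (auto simp: fun_eq_iff inner_commute algebra_simps)
  ultimately show ?thesis
    by (simp add: has_field_derivative_def power2_norm_eq_inner)
qed

text \<open>The squared distance has derivative minus twice the phase. The phase decreases and
  vanishes at the foot, so the distance grows on either side of it.\<close>

lemma foot_nearer:
  assumes Z: "foot Z s" and s': "\<bar>s' - s\<bar> \<le> r1" "s' \<noteq> s"
  shows "norm (Z - c s) < norm (Z - c s')"
proof -
  let ?g = "\<lambda>x. (norm (Z - c x))\<^sup>2"
  note D = sqdist_has_derivative[of Z]
  have near: "norm (Z - c x) \<le> 1 / (2 * K)" if "\<bar>x - s\<bar> \<le> r1" for x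
    using Z that r0(1) by (intro norm_near) (auto simp: foot_def)
  have foot0: "(Z - c s) \<bullet> c' s = 0" using Z by (simp add: foot_def)
  have "?g s < ?g s'"
  proof (cases "s < s'")
    case True
    then obtain z where z: "s < z" "z < s'" "?g s' - ?g s = (s' - s) * (- 2 * ((Z - c z) \<bullet> c' z))"
      using MVT2[OF True D] by auto
    have "(Z - c z) \<bullet> c' z \<le> (Z - c s) \<bullet> c' s - (z - s) / 2"
      by (rule phase_decrease) (use z s' near in auto)
    also have "\<dots> < 0" using foot0 z(1) by simp
    finally have "- 2 * ((Z - c z) \<bullet> c' z) > 0" by simp
    then have "(s' - s) * (- 2 * ((Z - c z) \<bullet> c' z)) > 0" by (rule mult_pos_pos[rotated]) (use True in auto)
    then show ?thesis using z(3) by linarith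
  next
    case False
    then have lt: "s' < s" using s' by simp
    then obtain z where z: "s' < z" "z < s" "?g s - ?g s' = (s - s') * (- 2 * ((Z - c z) \<bullet> c' z))"
      using MVT2[OF lt D] by auto
    have "(Z - c s) \<bullet> c' s \<le> (Z - c z) \<bullet> c' z - (s - z) / 2"
      by (rule phase_decrease) (use z s' near in auto)
    then have "(Z - c z) \<bullet> c' z > 0" using foot0 z(2) by argo
    then have "2 * ((Z - c z) \<bullet> c' z) > 0" by simp
    then have "(s - s') * (2 * ((Z - c z) \<bullet> c' z)) > 0" by (rule mult_pos_pos[rotated]) (use lt in auto)
    then show ?thesis using z(3) by (simp add: algebra_simps)
  qed
  then show ?thesis by (rule power_less_imp_less_base) simp
qed

text \<open>Parameters within \<open>r1\<close> are treated by \<open>foot_nearer\<close>. Any other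
  parameter, after removing periods, gives a chord longer than \<open>4 * r0\<close>; as
  \<open>Z\<close> is within \<open>r0\<close> of one end of the chord, it is farther from the
  other.\<close>

lemma foot_nearest:
  assumes Z: "foot Z s"
  shows "norm (Z - c s) \<le> norm (Z - c s')"
    and "norm (Z - c s') \<le> norm (Z - c s) \<Longrightarrow> \<exists>k::int. s' = s + of_int k * L"
proof -
  obtain k :: int where k: "c0 * \<bar>s' - s - of_int k * L\<bar> \<le> norm (c s' - c s)"
    using separated by blast
  define t where "t = s' - of_int k * L"
  have ct: "c t = c s'" using periodic_int(1)[of t k] by (simp add: t_def)
  have "norm (Z - c s) < norm (Z - c s') \<or> t = s"
  proof (cases "\<bar>t - s\<bar> \<le> r1")
    case True
    then show ?thesis using foot_nearer[OF Z True] ct by auto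
  next
    case False
    then have "c0 * r1 < c0 * \<bar>s' - s - of_int k * L\<bar>" using c0 by (simp add: t_def algebra_simps)
    then have "4 * r0 < norm (c s' - c s)" using k r0 by simp
    moreover have "norm (c s' - c s) \<le> norm (Z - c s) + norm (Z - c s')"
      using norm_triangle_ineq4[of "Z - c s" "Z - c s'"] by simp
    moreover have "norm (Z - c s) < r0" using Z by (simp add: foot_def)
    ultimately show ?thesis using r0(1) by linarith
  qed
  moreover have "norm (Z - c s) = norm (Z - c s')" if "t = s" using ct that by simp
  ultimately show "norm (Z - c s) \<le> norm (Z - c s')"
      "norm (Z - c s') \<le> norm (Z - c s) \<Longrightarrow> \<exists>k::int. s' = s + of_int k * L"
    by (auto simp: t_def intro!: exI[of _ k])
qed

lemma compact_range: "compact (range c)"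
proof -
  have "range c = c ` {0..L}"
  proof (intro equalityI subsetI)
    fix x assume "x \<in> range c"
    then obtain s where s: "x = c s" by auto
    have "s rmod L \<in> {0..L}" using L rmod_nonneg[of L s] rmod_less[of L s] by simp
    moreover have "c (s rmod L) = c s"
      using periodic_int(1)[of s "- \<lfloor>s / L\<rfloor>"] L by (simp add: rmod_def mult.commute)
    ultimately show "x \<in> c ` {0..L}" using s by (metis imageI)
  qed auto
  then show ?thesis using continuous_c compact_continuous_image by (metis compact_Icc)
qed

lemma foot_infdist:
  assumes "foot Z s"
  shows "infdist Z (range c) = norm (Z - c s)"
proof (rule antisym)
  show "infdist Z (range c) \<le> norm (Z - c s)"
    using infdist_le[of "c s" "range c" Z] by (simp add: dist_norm)
  show "norm (Z - c s) \<le> infdist Z (range c)"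
    unfolding infdist_def using foot_nearest(1)[OF assms]
    by (auto simp: dist_norm intro!: cINF_greatest)
qed

lemma foot_exists:
  assumes "infdist Z (range c) < r0"
  obtains s where "foot Z s"
proof -
  obtain x where "x \<in> range c" "infdist Z (range c) = dist Z x"
    by (rule infdist_attains_inf[of "range c" Z]) (use compact_range in \<open>auto intro: compact_imp_closed\<close>)
  then obtain s where s: "infdist Z (range c) = norm (Z - c s)" by (auto simp: dist_norm)
  have "norm (Z - c s) \<le> norm (Z - c x)" for x
    using infdist_le[of "c x" "range c" Z] s by (simp add: dist_norm)
  then have "- 2 * ((Z - c s) \<bullet> c' s) = 0"
    by (intro DERIV_local_min[OF sqdist_has_derivative, of 1]) auto
  then have "foot Z s" using s assms by (simp add: foot_def)
  then show thesis by (rule that)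
qed

lemma nearest_iff_foot:
  assumes "infdist Z (range c) < r0"
  shows "norm (Z - c s) = infdist Z (range c) \<longleftrightarrow> foot Z s"
proof
  obtain s1 where s1: "foot Z s1" using foot_exists[OF assms] .
  assume "norm (Z - c s) = infdist Z (range c)"
  then obtain k :: int where "s = s1 + of_int k * L"
    using foot_nearest(2)[OF s1, of s] foot_infdist[OF s1] by auto
  then show "foot Z s" using s1 foot_periodic by simp
qed (simp add: foot_infdist)

lemma foot_unique: "foot Z s \<Longrightarrow> foot Z s' \<Longrightarrow> \<exists>k::int. s' = s + of_int k * L"
  using foot_nearest foot_infdist by (metis order_refl)

text \<open>The two curve points are closer than \<open>4 * r0\<close> by the triangle inequality,
  which the chord-arc constant turns into \<open>r1\<close> for the parameters.\<close>

lemma foot_close: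
  assumes "foot Z1 s1" "foot Z2 s2" "norm (Z1 - Z2) < r0"
  shows "\<exists>k::int. \<bar>s1 - s2 - of_int k * L\<bar> < r1"
proof -
  obtain k :: int where k: "c0 * \<bar>s1 - s2 - of_int k * L\<bar> \<le> norm (c s1 - c s2)"
    using separated by blast
  have "norm (c s1 - c s2) \<le> norm (Z1 - Z2) + norm (Z2 - c s2) + norm (Z1 - c s1)"
    using norm_triangle_ineq[of "Z1 - Z2" "Z2 - c s2"] norm_triangle_ineq4[of "Z1 - c s2" "Z1 - c s1"] by simp
  also have "\<dots> < 4 * r0" using assms r0(1) unfolding foot_def by linarith
  finally have "c0 * \<bar>s1 - s2 - of_int k * L\<bar> < c0 * r1" using k r0 by simp
  then show ?thesis using c0 by (intro exI[of _ k]) simp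
qed

text \<open>At the later foot parameter \<open>t\<close> the phase of \<open>Z1\<close> equals
  \<open>(Z1 - Z2) \<bullet> c' t\<close>, while by \<open>phase_decrease\<close> it has dropped
  from 0 by at least half the parameter distance.\<close>

lemma foot_Lipschitz:
  assumes Z: "foot Z1 s1" "foot Z2 s2" "\<bar>s1 - s2\<bar> \<le> r1"
  shows "\<bar>s1 - s2\<bar> \<le> 2 * norm (Z1 - Z2)"
proof -
  have main: "t - s \<le> 2 * norm (Z1 - Z2)"
    if foot: "foot Z1 s" "foot Z2 t" "s \<le> t" "t - s \<le> r1" for Z1 Z2 s t
  proof -
    have "(Z1 - c t) \<bullet> c' t \<le> (Z1 - c s) \<bullet> c' s - (t - s) / 2"
    proof (rule phase_decrease)
      show "norm (Z1 - c x) \<le> 1 / (2 * K)" if "x \<in> {s..t}" for x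
        using foot that r0(1) by (intro norm_near[of Z1 s]) (auto simp: foot_def)
    qed (use foot in auto)
    moreover have "(Z1 - c t) \<bullet> c' t = (Z1 - Z2) \<bullet> c' t"
      using foot by (simp add: foot_def inner_diff_left)
    moreover have "\<bar>(Z1 - Z2) \<bullet> c' t\<bar> \<le> norm (Z1 - Z2)"
      using Cauchy_Schwarz_ineq2[of "Z1 - Z2" "c' t"] unit[of t] by simp
    moreover have "(Z1 - c s) \<bullet> c' s = 0" using foot by (simp add: foot_def)
    ultimately have "(t - s) / 2 \<le> norm (Z1 - Z2)" by (simp only: abs_le_iff) argo
    then show ?thesis by simp
  qed
  show ?thesis
    using main[of Z1 s1 Z2 s2] main[of Z2 s2 Z1 s1] Z
    by (cases "s1 \<le> s2") (auto simp: norm_minus_commute)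
qed

text \<open>Implicit differentiation of the foot condition. The path is only known to be
  differentiable at \<open>t\<close> itself, so instead of an implicit function theorem the phase is
  written with Caratheodory's slope function \<open>g\<close>, and the difference quotient of
  \<open>p\<close> is solved for exactly.\<close>

lemma foot_param_has_derivative:
  fixes Y :: "real \<Rightarrow> 'a" and p :: "real \<Rightarrow> real"
  assumes Y: "(Y has_vector_derivative v) (at t)"
    and foot: "\<And>\<tau>. \<tau> \<in> S \<Longrightarrow> foot (Y \<tau>) (p \<tau>)" and S: "open S" "t \<in> S"
    and cont: "isCont p t"
  shows "(p has_real_derivative (v \<bullet> c' (p t)) / (1 - (Y t - c (p t)) \<bullet> c'' (p t))) (at t)"
    and "\<bar>(Y t - c (p t)) \<bullet> c'' (p t)\<bar> \<le> 1 / 2"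
proof -
  let ?s = "p t"
  let ?m = "1 - (Y t - c ?s) \<bullet> c'' ?s"
  have "\<bar>(Y t - c ?s) \<bullet> c'' ?s\<bar> \<le> norm (Y t - c ?s) * norm (c'' ?s)" by (rule Cauchy_Schwarz_ineq2)
  also have "\<dots> \<le> r0 * K"
    using foot[OF S(2)] curvature[of ?s] r0(1) by (intro mult_mono) (auto simp: foot_def)
  finally show small: "\<bar>(Y t - c (p t)) \<bullet> c'' (p t)\<bar> \<le> 1 / 2" using r0(3) by (simp add: mult.commute)
  then have m: "?m > 0" by simp
  have "\<exists>g. (\<forall>x. (Y t - c x) \<bullet> c' x - (Y t - c ?s) \<bullet> c' ?s = g x * (x - ?s)) \<and> isCont g ?s \<and> g ?s = - ?m"
    using phase_has_derivative[of "Y t" ?s] by (subst (asm) CARAT_DERIV) simp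
  then obtain g where g: "\<And>x. (Y t - c x) \<bullet> c' x - (Y t - c ?s) \<bullet> c' ?s = g x * (x - ?s)"
      "isCont g ?s" "g ?s = - ?m" by blast
  have gp: "isCont (\<lambda>\<tau>. g (p \<tau>)) t" using cont g(2) by (rule isCont_o2)
  then have gp_lim: "((\<lambda>\<tau>. g (p \<tau>)) \<longlongrightarrow> - ?m) (at t)" using g(3) by (simp add: isCont_def)
  have c'p: "((\<lambda>\<tau>. c' (p \<tau>)) \<longlongrightarrow> c' ?s) (at t)"
  proof -
    have "isCont c' ?s" using der' has_vector_derivative_continuous by blast
    with cont have "isCont (\<lambda>\<tau>. c' (p \<tau>)) t" by (rule isCont_o2)
    then show ?thesis by (simp add: isCont_def)
  qed
  have Ylim: "((\<lambda>\<tau>. (Y \<tau> - Y t) /\<^sub>R (\<tau> - t)) \<longlongrightarrow> v) (at t)"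
  proof (rule LIM_zero_cancel, rule tendsto_norm_zero_cancel)
    have "((\<lambda>\<tau>. norm (Y \<tau> - Y t - (\<tau> - t) *\<^sub>R v) / norm (\<tau> - t)) \<longlongrightarrow> 0) (at t)"
      using Y unfolding has_vector_derivative_def has_derivative_iff_norm by blast
    then show "((\<lambda>\<tau>. norm ((Y \<tau> - Y t) /\<^sub>R (\<tau> - t) - v)) \<longlongrightarrow> 0) (at t)"
    proof (rule Lim_transform_eventually)
      have "norm (Y \<tau> - Y t - (\<tau> - t) *\<^sub>R v) / norm (\<tau> - t) = norm ((Y \<tau> - Y t) /\<^sub>R (\<tau> - t) - v)"
        if "\<tau> \<noteq> t" for \<tau>
      proof -
        have "(Y \<tau> - Y t) /\<^sub>R (\<tau> - t) - v = (Y \<tau> - Y t - (\<tau> - t) *\<^sub>R v) /\<^sub>R (\<tau> - t)"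
          using that by (simp add: scaleR_diff_right)
        then show ?thesis by (simp add: divide_inverse mult.commute)
      qed
      then show "\<forall>\<^sub>F \<tau> in at t. norm (Y \<tau> - Y t - (\<tau> - t) *\<^sub>R v) / norm (\<tau> - t) = norm ((Y \<tau> - Y t) /\<^sub>R (\<tau> - t) - v)"
        by (auto simp: eventually_at_filter)
    qed
  qed
  have lim: "((\<lambda>\<tau>. - (((Y \<tau> - Y t) /\<^sub>R (\<tau> - t)) \<bullet> c' (p \<tau>)) / g (p \<tau>)) \<longlongrightarrow> - (v \<bullet> c' ?s) / (- ?m)) (at t)"
    by (intro tendsto_intros Ylim c'p gp_lim) (use m in auto)
  have ev: "\<forall>\<^sub>F \<tau> in at t. \<tau> \<in> S \<and> \<tau> \<noteq> t \<and> g (p \<tau>) < 0"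
  proof -
    have "\<forall>\<^sub>F \<tau> in at t. \<tau> \<in> S" using S eventually_at_topological by blast
    moreover have "\<forall>\<^sub>F \<tau> in at t. \<tau> \<noteq> t" by (simp add: eventually_at_filter)
    moreover have "\<forall>\<^sub>F \<tau> in at t. g (p \<tau>) < 0" using gp_lim m by (intro order_tendstoD) auto
    ultimately show ?thesis by eventually_elim auto
  qed
  have "((\<lambda>\<tau>. (p \<tau> - p t) / (\<tau> - t)) \<longlongrightarrow> - (v \<bullet> c' ?s) / (- ?m)) (at t)"
  proof (rule Lim_transform_eventually[OF lim])
    show "\<forall>\<^sub>F \<tau> in at t. - (((Y \<tau> - Y t) /\<^sub>R (\<tau> - t)) \<bullet> c' (p \<tau>)) / g (p \<tau>) = (p \<tau> - p t) / (\<tau> - t)"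
      using ev
    proof eventually_elim
      case (elim \<tau>)
      have "0 = (Y \<tau> - c (p \<tau>)) \<bullet> c' (p \<tau>)" using foot elim by (simp add: foot_def)
      also have "\<dots> = (Y \<tau> - Y t) \<bullet> c' (p \<tau>) + (Y t - c (p \<tau>)) \<bullet> c' (p \<tau>)"
        by (simp add: inner_diff_left)
      also have "(Y t - c (p \<tau>)) \<bullet> c' (p \<tau>) = g (p \<tau>) * (p \<tau> - p t)"
        using g(1)[of "p \<tau>"] foot[OF S(2)] by (simp add: foot_def)
      finally have "p \<tau> - p t = - ((Y \<tau> - Y t) \<bullet> c' (p \<tau>)) / g (p \<tau>)"
        using elim by (simp add: field_simps)
      then show ?case by (simp add: divide_inverse mult.commute mult.left_commute)
    qed
  qed
  then show "(p has_real_derivative (v \<bullet> c' (p t)) / ?m) (at t)"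
    by (simp only: has_field_derivative_iff minus_divide_divide)
qed

end

subsection \<open>The Hamilton-Jacobi inequality\<close>

text \<open>Here \<open>e\<close> stands for the unit tangent, \<open>n\<close> for the normal
  displacement, \<open>m\<close> for the Jacobian \<open>1 - n \<bullet> c''\<close> of tubular
  coordinates, and \<open>?u\<close> is the gradient of the subsolution. Young's inequality reduces
  the claim to \<open>f \<bullet> ?u + (norm ?u)\<^sup>2 / 2 \<le> 0\<close>.\<close>

lemma energy_inequality:
  fixes v f e n :: "'a::real_inner" and M K \<delta> \<mu> \<eta> \<beta> m :: real
  assumes e: "norm e = 1" "n \<bullet> e = 0"
    and m: "1 / 2 \<le> m" "m \<le> 3 / 2" "1 - m \<le> K * norm n"
    and tang: "\<bar>f \<bullet> e - \<beta>\<bar> \<le> M * (\<delta> * norm n + (norm n)\<^sup>2)"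
    and norml: "n \<bullet> f \<le> - \<mu> * (norm n)\<^sup>2"
    and \<beta>: "\<bar>\<beta>\<bar> \<le> M * \<delta>"
    and pos: "M > 0" "\<delta> > 0" "\<mu> > 0" "K \<ge> 0" and small: "16 * M\<^sup>2 * \<delta> \<le> \<mu>\<^sup>2"
    and \<eta>: "\<eta> = 9 / 4 * (8 * K * M + 4 * M)\<^sup>2 * \<delta>\<^sup>2 / \<mu>\<^sup>2" "\<eta> \<le> 1 / 2"
  shows "(1 - \<eta>) * (- 2 * \<beta>) * ((v \<bullet> e) / m) + \<mu> * (n \<bullet> v) \<le> (norm (v - f))\<^sup>2 / 2"
proof -
  define r where "r = norm n"
  have r: "r \<ge> 0" by (simp add: r_def)
  have \<eta>0: "\<eta> \<ge> 0" unfolding \<eta>(1) by simp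
  define \<alpha> where "\<alpha> = - 2 * (1 - \<eta>) * \<beta> / m"
  \<comment> \<open>The coefficient of the cross term \<open>\<bar>\<beta>\<bar> * r\<close>:
    \<open>8 * K * M\<close> comes from the Jacobian, \<open>4 * M\<close> from the tangential
    drift.\<close>
  define N where "N = (8 * K * M + 4 * M) * \<delta>"
  have N: "4 / 9 * \<eta> = N\<^sup>2 / \<mu>\<^sup>2" unfolding \<eta>(1) N_def by (simp add: power_mult_distrib)
  let ?u = "\<alpha> *\<^sub>R e + \<mu> *\<^sub>R n"
  have u2: "(norm ?u)\<^sup>2 = \<alpha>\<^sup>2 + \<mu>\<^sup>2 * r\<^sup>2"
  proof -
    have "?u \<bullet> ?u = \<alpha>\<^sup>2 * (e \<bullet> e) + 2 * \<alpha> * \<mu> * (n \<bullet> e) + \<mu>\<^sup>2 * (n \<bullet> n)"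
      by (simp add: inner_add_left inner_add_right inner_commute power2_eq_square algebra_simps)
    then show ?thesis using e by (simp add: r_def flip: power2_norm_eq_inner)
  qed
  have lhs: "(1 - \<eta>) * (- 2 * \<beta>) * ((v \<bullet> e) / m) + \<mu> * (n \<bullet> v) = (v - f) \<bullet> ?u + (\<alpha> * (f \<bullet> e) + \<mu> * (n \<bullet> f))"
  proof -
    have eq: "(1 - \<eta>) * (- 2 * \<beta>) * ((v \<bullet> e) / m) = \<alpha> * (v \<bullet> e)"
      using m(1) by (simp add: \<alpha>_def field_simps)
    show ?thesis unfolding eq
      by (simp add: inner_add_right inner_diff_left inner_commute[of n] right_diff_distrib)
  qed
  have young: "(v - f) \<bullet> ?u \<le> (norm (v - f))\<^sup>2 / 2 + (\<alpha>\<^sup>2 + \<mu>\<^sup>2 * r\<^sup>2) / 2"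
  proof -
    have "(v - f) \<bullet> ?u \<le> norm (v - f) * norm ?u" by (rule norm_cauchy_schwarz)
    also have "\<dots> \<le> ((norm (v - f))\<^sup>2 + (norm ?u)\<^sup>2) / 2"
      using sum_squares_bound[of "norm (v - f)" "norm ?u"] by simp
    finally show ?thesis unfolding u2 by argo
  qed
  have \<alpha>_le: "\<bar>\<alpha>\<bar> \<le> 4 * \<bar>\<beta>\<bar>"
  proof -
    have "\<bar>\<alpha>\<bar> = 2 * (1 - \<eta>) * \<bar>\<beta>\<bar> / m" using m \<eta> by (simp add: \<alpha>_def abs_mult)
    also have "\<dots> \<le> 2 * \<bar>\<beta>\<bar> / (1 / 2)"
      using m \<eta>(2) \<eta>0 by (intro frac_le mult_right_mono) auto
    finally show ?thesis by simp
  qed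
  have t1: "\<alpha> * (\<alpha> / 2 + \<beta>) \<le> 8 * K * \<beta>\<^sup>2 * r - 4 / 9 * \<eta> * \<beta>\<^sup>2"
  proof -
    define A where "A = 2 * (1 - \<eta>) / m\<^sup>2"
    have A0: "A \<ge> 0" using \<eta>(2) by (simp add: A_def)
    \<comment> \<open>For \<open>\<eta> = 0\<close> and \<open>m = 1\<close> this vanishes: the
      reduced potential solves the one-dimensional Hamilton-Jacobi equation exactly. The
      \<open>\<eta>\<close> term is the gain that pays for the errors.\<close>
    have "\<alpha> * (\<alpha> / 2 + \<beta>) = A * \<beta>\<^sup>2 * ((1 - m) - \<eta>)"
      using m by (simp add: A_def \<alpha>_def field_simps power2_eq_square)
    also have "\<dots> = A * \<beta>\<^sup>2 * (1 - m) - A * (\<eta> * \<beta>\<^sup>2)"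
      by (simp add: algebra_simps)
    also have "A * \<beta>\<^sup>2 * (1 - m) \<le> 8 * \<beta>\<^sup>2 * (K * r)"
    proof -
      have "(1/2)\<^sup>2 \<le> m\<^sup>2" using m by (intro power_mono) auto
      then have "A \<le> 2 / (1/2)\<^sup>2"
        unfolding A_def using \<eta>(2) \<eta>0 by (intro frac_le) auto
      then have "A \<le> 8" by (simp add: power2_eq_square)
      then have "A * \<beta>\<^sup>2 \<le> 8 * \<beta>\<^sup>2" by (intro mult_right_mono) auto
      moreover have "A * \<beta>\<^sup>2 \<ge> 0" using A0 by simp
      moreover have "K * r \<ge> 0" using pos r by simp
      ultimately show ?thesis using m(3) unfolding r_def[symmetric]
        by (meson mult_left_mono mult_right_mono order_trans)
    qed
    finally have main: "\<alpha> * (\<alpha> / 2 + \<beta>) \<le> 8 * \<beta>\<^sup>2 * (K * r) - A * (\<eta> * \<beta>\<^sup>2)" by simp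
    \<comment> \<open>\<open>m \<le> 3 / 2\<close> and \<open>\<eta> \<le> 1 / 2\<close> give
      \<open>A \<ge> 4 / 9\<close>, which is where the factor \<open>9 / 4\<close> in
      \<open>\<eta>\<close> comes from.\<close>
    have "A * (\<eta> * \<beta>\<^sup>2) \<ge> 4 / 9 * (\<eta> * \<beta>\<^sup>2)"
    proof (rule mult_right_mono)
      have "m\<^sup>2 \<le> (3/2)\<^sup>2" using m by (intro power_mono) auto
      then have "1 / (3/2)\<^sup>2 \<le> A" unfolding A_def using \<eta>(2) m by (intro frac_le) auto
      then show "4 / 9 \<le> A" by (simp add: power2_eq_square)
    qed (use \<eta>0 in simp)
    then show ?thesis using main by (simp add: algebra_simps)
  qed
  have t2: "\<beta>\<^sup>2 \<le> M * \<delta> * \<bar>\<beta>\<bar>"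
    using mult_right_mono[OF \<beta>, of "\<bar>\<beta>\<bar>"] by (simp add: power2_eq_square flip: abs_mult)
  have t3: "\<alpha> * (f \<bullet> e - \<beta>) \<le> 4 * M * \<delta> * \<bar>\<beta>\<bar> * r + 4 * M\<^sup>2 * \<delta> * r\<^sup>2"
  proof -
    have nn: "0 \<le> M * (\<delta> * r + r\<^sup>2)" using pos r by simp
    have "\<alpha> * (f \<bullet> e - \<beta>) \<le> \<bar>\<alpha>\<bar> * \<bar>f \<bullet> e - \<beta>\<bar>" by (metis abs_ge_self abs_mult)
    also have "\<dots> \<le> (4 * \<bar>\<beta>\<bar>) * (M * (\<delta> * r + r\<^sup>2))"
      using \<alpha>_le tang by (intro mult_mono) (auto simp: r_def)
    also have "\<dots> = 4 * M * \<delta> * \<bar>\<beta>\<bar> * r + 4 * M * (\<bar>\<beta>\<bar> * r\<^sup>2)" by (simp add: algebra_simps)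
    also have "4 * M * (\<bar>\<beta>\<bar> * r\<^sup>2) \<le> 4 * M * ((M * \<delta>) * r\<^sup>2)"
      using \<beta> pos by (intro mult_left_mono mult_right_mono) auto
    finally show ?thesis by (simp add: power2_eq_square algebra_simps)
  qed
  have t4: "8 * K * \<beta>\<^sup>2 * r \<le> 8 * K * (M * \<delta> * \<bar>\<beta>\<bar>) * r"
    using t2 pos r by (intro mult_right_mono mult_left_mono) auto
  \<comment> \<open>Young's inequality, weighted so that its second part is exactly the gain
    \<open>4 / 9 * \<eta> * \<beta>\<^sup>2\<close>.\<close>
  have t5: "N * \<bar>\<beta>\<bar> * r \<le> \<mu>\<^sup>2 * r\<^sup>2 / 4 + N\<^sup>2 / \<mu>\<^sup>2 * \<beta>\<^sup>2"
  proof -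
    have "0 \<le> (\<mu> * r / 2 - N * \<bar>\<beta>\<bar> / \<mu>)\<^sup>2" by simp
    also have "\<dots> = \<mu>\<^sup>2 * r\<^sup>2 / 4 + N\<^sup>2 / \<mu>\<^sup>2 * \<beta>\<^sup>2 - N * \<bar>\<beta>\<bar> * r"
      using pos by (simp add: power2_diff power_mult_distrib power_divide)
    finally show ?thesis by simp
  qed
  have t6: "4 * M\<^sup>2 * \<delta> * r\<^sup>2 \<le> \<mu>\<^sup>2 * r\<^sup>2 / 4"
    using mult_right_mono[OF small, of "r\<^sup>2"] by simp
  have t7: "\<mu> * (n \<bullet> f) \<le> - (\<mu>\<^sup>2 * r\<^sup>2)"
    using mult_left_mono[OF norml, of \<mu>] pos by (simp add: r_def power2_eq_square mult.assoc)
  have "\<alpha> * (f \<bullet> e) + \<alpha>\<^sup>2 / 2 = \<alpha> * (\<alpha> / 2 + \<beta>) + \<alpha> * (f \<bullet> e - \<beta>)"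
    by (simp add: power2_eq_square algebra_simps)
  also have "\<dots> \<le> (N * \<bar>\<beta>\<bar> * r - 4 / 9 * \<eta> * \<beta>\<^sup>2) + 4 * M\<^sup>2 * \<delta> * r\<^sup>2"
    using t1 t3 t4 by (simp add: N_def algebra_simps)
  \<comment> \<open>Half of \<open>\<mu>\<^sup>2 * r\<^sup>2\<close> is spent here and the other
    half on the normal part of \<open>(norm ?u)\<^sup>2 / 2\<close>; \<open>t7\<close> supplies the
    whole.\<close>
  also have "\<dots> \<le> \<mu>\<^sup>2 * r\<^sup>2 / 4 + \<mu>\<^sup>2 * r\<^sup>2 / 4"
    using t5 t6 unfolding N by argo
  finally show ?thesis
    unfolding lhs using young t7 by argo
qed

section \<open>One-dimensional paths against the drift\<close>

lemma continuous_antiderivative: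
  fixes f :: "real \<Rightarrow> real"
  assumes "continuous_on UNIV f"
  obtains G where "\<And>x. (G has_real_derivative f x) (at x)"
proof (rule that)
  fix x :: real
  define R where "R = \<bar>x\<bar> + 1"
  have "((\<lambda>u. LBINT y=ereal 0..ereal u. f y) has_vector_derivative f x) (at x within {- R..R})"
    by (rule interval_integral_FTC2) (use assms in \<open>auto simp: R_def intro: continuous_on_subset\<close>)
  moreover have "at x within {- R..R} = at x"
    by (rule at_within_interior) (auto simp: R_def abs_if)
  ultimately show "((\<lambda>u. LBINT y=ereal 0..ereal u. f y) has_real_derivative f x) (at x)"
    by (simp add: has_real_derivative_iff_has_vector_derivative)
qed

text \<open>Separation of variables: \<open>w\<close> is a time shift of the inverse of
  \<open>H\<close>, an antiderivative of \<open>1 / \<psi>\<close>. The bound \<open>B\<close> on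
  the speed makes \<open>H\<close> grow at least linearly, hence surjective, so \<open>w\<close>
  exists for all times.\<close>

lemma autonomous_ode_path:
  fixes \<psi> :: "real \<Rightarrow> real"
  assumes cont: "continuous_on UNIV \<psi>" and pos: "\<And>x. \<psi> x > 0" and bd: "\<And>x. \<psi> x \<le> B" and l: "l > 0"
  obtains w T where "T < 0" "w T = 0" "w 0 = l" "\<And>t. (w has_real_derivative \<psi> (w t)) (at t)"
    "\<And>s t. s \<le> t \<Longrightarrow> w s \<le> w t"
proof -
  have "continuous_on UNIV (\<lambda>x. 1 / \<psi> x)" using cont pos by (intro continuous_intros) (auto simp: less_imp_neq[symmetric] order_less_imp_not_eq2)
  then obtain H where H: "\<And>x. (H has_real_derivative 1 / \<psi> x) (at x)"
    using continuous_antiderivative by blast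
  have B: "B > 0" using pos bd less_le_trans by blast
  have incr: "H x + (y - x) / B \<le> H y" if "x \<le> y" for x y
  proof (cases "x = y")
    case False
    with that have "x < y" by simp
    then obtain z where z: "H y - H x = (y - x) * (1 / \<psi> z)"
      using MVT2[of x y H "\<lambda>x. 1 / \<psi> x"] H by blast
    have "1 / B \<le> 1 / \<psi> z" using pos bd by (intro divide_left_mono) (auto intro: mult_pos_pos B)
    then have "(y - x) * (1 / B) \<le> (y - x) * (1 / \<psi> z)" using that by (intro mult_left_mono) auto
    then show ?thesis using z by simp
  qed auto
  have strict: "H x < H y" if "x < y" for x y
  proof -
    have "(y - x) / B > 0" using that B by simp
    then show ?thesis using incr[of x y] that by linarith
  qed
  have contH: "isCont H x" for x using H DERIV_isCont by blast
  have surj: "\<exists>x. H x = t" for t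
  proof -
    define d where "d = B * \<bar>t - H 0\<bar>"
    have d: "d \<ge> 0" "d / B = \<bar>t - H 0\<bar>" using B by (auto simp: d_def)
    have "H (- d) \<le> t" "t \<le> H d"
      using incr[of "- d" 0] incr[of 0 d] d by auto
    then show ?thesis using IVT[of H "- d" t d] contH d by auto
  qed
  define w0 where "w0 = inv H"
  have inj: "inj H" using strict by (metis injI linorder_neq_iff order_less_irrefl)
  have Hw: "H (w0 t) = t" for t unfolding w0_def using surj by (metis f_inv_into_f rangeI)
  have wH: "w0 (H x) = x" for x unfolding w0_def using inj by simp
  have w0mono: "w0 s \<le> w0 t" if "s \<le> t" for s t
    using strict[of "w0 t" "w0 s"] Hw that by (metis not_le)
  have dw0: "(w0 has_real_derivative \<psi> (w0 t)) (at t)" for t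
  proof -
    have "(w0 has_real_derivative inverse (1 / \<psi> (w0 t))) (at t)"
    proof (rule DERIV_inverse_function[where f=H and g=w0 and a="t - 1" and b="t + 1"])
      show "(H has_real_derivative 1 / \<psi> (w0 t)) (at (w0 t))" by (rule H)
      show "1 / \<psi> (w0 t) \<noteq> 0" using pos[of "w0 t"] by simp
      show "isCont w0 t"
        using isCont_inverse_function[of 1 "w0 t" w0 H] wH contH Hw by simp
    qed (use Hw in auto)
    then show ?thesis by simp
  qed
  define w where "w t = w0 (t + H l)" for t
  show thesis
  proof (rule that[of "H 0 - H l" w])
    show "H 0 - H l < 0" using strict[OF l] by simp
    show "w (H 0 - H l) = 0" "w 0 = l" by (simp_all add: w_def wH)
    show "(w has_real_derivative \<psi> (w t)) (at t)" for t
      using dw0[of "t + H l"] unfolding w_def by (simp add: DERIV_shift)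
    show "w s \<le> w t" if "s \<le> t" for s t unfolding w_def by (rule w0mono) (use that in simp)
  qed
qed

lemma Lipschitz_imp_abs_continuous_on:
  fixes f :: "real \<Rightarrow> 'a::real_normed_vector"
  assumes "\<And>x y. a \<le> x \<Longrightarrow> x \<le> y \<Longrightarrow> y \<le> b \<Longrightarrow> norm (f y - f x) \<le> k * (y - x)"
  shows "abs_continuous_on a b f"
proof (rule abs_continuous_on_Lipschitz_image[of a b "\<lambda>x. x" 1 "max k 1"])
  show "abs_continuous_on a b (\<lambda>x::real. x)"
    unfolding abs_continuous_on_def by (metis (no_types, lifting) abs_of_nonneg diff_ge_0_iff_ge lessThan_iff real_norm_def sum.cong)
  show "norm (f y - f x) \<le> max k 1 * norm (y - x)" if "a \<le> x" "x \<le> y" "y \<le> b" for x y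
  proof -
    have "k * (y - x) \<le> max k 1 * (y - x)" using that by (intro mult_right_mono) auto
    then show ?thesis using assms[OF that] that by simp
  qed
qed auto

text \<open>The path \<open>\<phi>' = - b(\<phi>)\<close> would need infinite time; \<open>\<epsilon>\<close> is added to its speed.\<close>
lemma circle_quasipotential_le_potential:
  assumes b: "continuous_on UNIV b" and bd: "\<And>x. \<bar>b x\<bar> \<le> B"
    and \<Phi>: "\<And>x. (\<Phi> has_real_derivative - 2 * b x) (at x)"
    and \<sigma>: "\<sigma> = 1 \<or> \<sigma> = -1" and l: "l > 0"
    and sign: "\<And>x. 0 \<le> x \<Longrightarrow> x \<le> l \<Longrightarrow> \<sigma> * b (a + \<sigma> * x) \<le> 0"
  shows "circle_quasipotential L b a (a + \<sigma> * l) \<le> ennreal (\<Phi> (a + \<sigma> * l) - \<Phi> a)"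
proof -
  have le: "circle_quasipotential L b a (a + \<sigma> * l) \<le> ennreal (\<Phi> (a + \<sigma> * l) - \<Phi> a + 2 * \<epsilon> * l)" if \<epsilon>: "\<epsilon> > 0" for \<epsilon>
  proof -
    define \<psi> where "\<psi> x = \<bar>b (a + \<sigma> * x)\<bar> + \<epsilon>" for x
    have "continuous_on UNIV \<psi>"
      unfolding \<psi>_def by (intro continuous_intros continuous_on_compose2[OF b]) auto
    moreover have "\<psi> x > 0" "\<psi> x \<le> B + \<epsilon>" for x
      unfolding \<psi>_def using \<epsilon> bd[of "a + \<sigma> * x"] by auto
    ultimately obtain w T where w: "T < 0" "w T = 0" "w 0 = l" "\<And>t. (w has_real_derivative \<psi> (w t)) (at t)"
        "\<And>s t. s \<le> t \<Longrightarrow> w s \<le> w t"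
      using autonomous_ode_path[of \<psi> "B + \<epsilon>" l] l by blast
    have wrange: "0 \<le> w t \<and> w t \<le> l" if "t \<in> {T..0}" for t
      using w(2,3,5) that by (metis atLeastAtMost_iff)
    define Y where "Y t = a + \<sigma> * w t" for t
    have dY: "(Y has_real_derivative \<sigma> * \<psi> (w t)) (at t)" for t
      unfolding Y_def by (auto intro!: derivative_eq_intros w(4))
    \<comment> \<open>\<open>\<sigma>\<close> is the direction of travel; by \<open>sign\<close> the
      drift opposes it or vanishes along the whole path.\<close>
    have bY: "b (Y t) = - \<sigma> * \<bar>b (Y t)\<bar>" if "t \<in> {T..0}" for t
      using sign[of "w t"] wrange[OF that] \<sigma> by (auto simp: Y_def)
    have acY: "abs_continuous_on T 0 Y"
    proof (rule Lipschitz_imp_abs_continuous_on)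
      fix x y assume "T \<le> x" "x \<le> y" "y \<le> 0"
      show "norm (Y y - Y x) \<le> (B + \<epsilon>) * (y - x)"
      proof (cases "x = y")
        case False
        with \<open>x \<le> y\<close> have "x < y" by simp
        then obtain z where z: "Y y - Y x = (y - x) * (\<sigma> * \<psi> (w z))"
          using MVT2[of x y Y "\<lambda>t. \<sigma> * \<psi> (w t)"] dY by blast
        have "norm (Y y - Y x) = (y - x) * \<psi> (w z)"
          unfolding z using \<sigma> \<open>x < y\<close> \<open>\<And>x. \<psi> x > 0\<close>[of "w z"] by (auto simp: abs_mult)
        also have "\<dots> \<le> (y - x) * (B + \<epsilon>)" using \<open>x < y\<close> \<open>\<And>x. \<psi> x \<le> B + \<epsilon>\<close> by (intro mult_left_mono) auto
        finally show ?thesis by (simp add: mult.commute)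
      qed simp
    qed
    let ?I = "\<integral>\<^sup>+t\<in>{T..0}. ennreal (4 * (\<psi> (w t))\<^sup>2) \<partial>lborel"
    have "action b T Y \<le> ?I / 2"
      unfolding action_def
    proof (intro divide_right_mono_ennreal nn_integral_mono)
      fix t :: real
      show "ennreal ((norm (vector_derivative Y (at t) - b (Y t)))\<^sup>2) * indicator {T..0} t
          \<le> ennreal (4 * (\<psi> (w t))\<^sup>2) * indicator {T..0} t"
      proof (cases "t \<in> {T..0}")
        case True
        have "vector_derivative Y (at t) = \<sigma> * \<psi> (w t)"
          using dY[of t] by (intro vector_derivative_at) (simp add: has_real_derivative_iff_has_vector_derivative)
        then have "vector_derivative Y (at t) - b (Y t) = \<sigma> * (\<psi> (w t) + \<bar>b (Y t)\<bar>)"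
          using bY[OF True] by (simp add: distrib_left)
        then have "(norm (vector_derivative Y (at t) - b (Y t)))\<^sup>2 = (\<psi> (w t) + \<bar>b (Y t)\<bar>)\<^sup>2"
          using \<sigma> by (auto simp: power_mult_distrib)
        also have "\<dots> \<le> (2 * \<psi> (w t))\<^sup>2"
          using \<epsilon> by (intro power_mono) (auto simp: \<psi>_def Y_def)
        finally show ?thesis by (auto simp: power_mult_distrib intro!: mult_right_mono ennreal_leI)
      qed simp
    qed
    \<comment> \<open>As \<open>\<psi>\<close> is \<open>\<bar>b\<bar> + \<epsilon>\<close> along
      the path, \<open>4 * \<psi>\<^sup>2\<close> is exactly the derivative of
      \<open>2 * (\<Phi> + 2 * \<epsilon> * w)\<close>, so the integral is evaluated in closed
      form.\<close>
    also have "?I = ennreal (2 * (\<Phi> (Y 0) + 2 * \<epsilon> * w 0) - 2 * (\<Phi> (Y T) + 2 * \<epsilon> * w T))"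
    proof (rule nn_integral_FTC_Icc)
      show "(\<lambda>t. 4 * (\<psi> (w t))\<^sup>2) \<in> borel_measurable borel"
      proof (rule borel_measurable_continuous_onI)
        have "continuous_on UNIV w" using w(4) by (meson DERIV_isCont continuous_at_imp_continuous_on)
        then have "continuous_on UNIV (\<lambda>t. \<psi> (w t))"
          by (rule continuous_on_compose2[OF \<open>continuous_on UNIV \<psi>\<close>]) auto
        then show "continuous_on UNIV (\<lambda>t. 4 * (\<psi> (w t))\<^sup>2)" by (intro continuous_intros)
      qed
      fix t assume t: "t \<in> {T..0}"
      have \<Phi>Y: "((\<lambda>t. \<Phi> (Y t)) has_real_derivative (- 2 * b (Y t)) * (\<sigma> * \<psi> (w t))) (at t)"
        using DERIV_chain2[OF \<Phi> dY] .
      have "(- 2 * b (Y t)) * (\<sigma> * \<psi> (w t)) = 2 * \<bar>b (Y t)\<bar> * \<psi> (w t)"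
      proof -
        have "b (Y t) * \<sigma> = - (\<sigma> * \<sigma>) * \<bar>b (Y t)\<bar>" by (subst bY[OF t]) simp
        then have "b (Y t) * \<sigma> = - \<bar>b (Y t)\<bar>" using \<sigma> by auto
        moreover have "(- 2 * b (Y t)) * (\<sigma> * \<psi> (w t)) = - 2 * (b (Y t) * \<sigma>) * \<psi> (w t)"
          by (simp only: mult_ac)
        ultimately have "(- 2 * b (Y t)) * (\<sigma> * \<psi> (w t)) = - 2 * (- \<bar>b (Y t)\<bar>) * \<psi> (w t)" by metis
        then show ?thesis by (simp only: mult_minus_left mult_minus_right minus_minus)
      qed
      then have eq: "2 * ((- 2 * b (Y t)) * (\<sigma> * \<psi> (w t)) + 2 * \<epsilon> * \<psi> (w t)) = 4 * (\<psi> (w t))\<^sup>2"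
        by (simp add: \<psi>_def Y_def power2_eq_square algebra_simps)
      have "((\<lambda>t. 2 * (\<Phi> (Y t) + 2 * \<epsilon> * w t)) has_real_derivative
          2 * ((- 2 * b (Y t)) * (\<sigma> * \<psi> (w t)) + 2 * \<epsilon> * \<psi> (w t))) (at t)"
        by (intro DERIV_cmult DERIV_add \<Phi>Y w(4))
      then show "((\<lambda>t. 2 * (\<Phi> (Y t) + 2 * \<epsilon> * w t)) has_real_derivative 4 * (\<psi> (w t))\<^sup>2) (at t)"
        unfolding eq .
    qed (use w(1) in auto)
    also have "\<dots> = ennreal (2 * (\<Phi> (a + \<sigma> * l) - \<Phi> a + 2 * \<epsilon> * l))"
      by (simp add: Y_def w(2,3) algebra_simps)
    also have "\<dots> / 2 = ennreal (\<Phi> (a + \<sigma> * l) - \<Phi> a + 2 * \<epsilon> * l)"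
    proof (cases "\<Phi> (a + \<sigma> * l) - \<Phi> a + 2 * \<epsilon> * l \<ge> 0")
      case True
      then show ?thesis
        using divide_ennreal[of "2 * (\<Phi> (a + \<sigma> * l) - \<Phi> a + 2 * \<epsilon> * l)" 2] by simp
    next
      case False
      then show ?thesis by (simp add: ennreal_neg)
    qed
    finally have "action b T Y \<le> ennreal (\<Phi> (a + \<sigma> * l) - \<Phi> a + 2 * \<epsilon> * l)" .
    moreover have "circle_quasipotential L b a (a + \<sigma> * l) \<le> action b T Y"
      unfolding circle_quasipotential_def
      by (rule INF_lower2[of "(T, Y)"]) (use w acY in \<open>auto simp: Y_def\<close>)
    ultimately show ?thesis by (rule order_trans[rotated])
  qed
  \<comment> \<open>The extra speed costs \<open>2 * \<epsilon> * l\<close>, which vanishes as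
    \<open>\<epsilon>\<close> tends to 0.\<close>
  have lim: "((\<lambda>\<epsilon>. ennreal (\<Phi> (a + \<sigma> * l) - \<Phi> a + 2 * \<epsilon> * l)) \<longlongrightarrow>
      ennreal (\<Phi> (a + \<sigma> * l) - \<Phi> a + 2 * 0 * l)) (at_right 0)"
    by (intro tendsto_intros)
  have "circle_quasipotential L b a (a + \<sigma> * l) \<le> ennreal (\<Phi> (a + \<sigma> * l) - \<Phi> a + 2 * 0 * l)"
    by (rule tendsto_lowerbound[OF lim])
       (use le in \<open>auto simp: eventually_at_right_field intro!: exI[of _ 1]\<close>)
  then show ?thesis by simp
qed

subsection \<open>The quasipotential in a tube\<close>

context tubular_curve
begin

lemma not_between_periods:
  fixes k :: int
  assumes "0 < of_int k * L" "of_int k * L < L"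
  shows False
proof -
  have "0 < (of_int k :: real)" using zero_less_mult_pos2[OF assms(1) L] .
  moreover have "of_int k < (1::real)" using assms(2) L by simp
  ultimately show False by simp
qed

lemma proj_param_foot:
  assumes "foot Z s"
  shows "[proj_param L c Z = s] (rmod L)" "foot Z (proj_param L c Z)"
proof -
  let ?s = "s rmod L"
  have rep: "?s = s + of_int (- \<lfloor>s / L\<rfloor>) * L" using L by (simp add: rmod_def mult.commute)
  have foot: "foot Z ?s" unfolding rep using assms by (simp only: foot_periodic)
  have "infdist Z (range c) < r0" using assms foot_infdist by (simp add: foot_def)
  note near = nearest_iff_foot[OF this]
  have "proj_param L c Z = ?s"
    unfolding proj_param_def near
  proof (rule the_equality)
    show "0 \<le> ?s \<and> ?s < L \<and> foot Z ?s" using foot L rmod_nonneg[of L s] rmod_less[of L s] by simp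
    fix t assume t: "0 \<le> t \<and> t < L \<and> foot Z t"
    then obtain k :: int where k: "t = ?s + of_int k * L" using foot_unique[OF foot] by blast
    have "t rmod L = ?s" using rmod_unique[of ?s L t k] L k rmod_nonneg[of L s] rmod_less[of L s] by simp
    then show "t = ?s" using t L by simp
  qed
  then show "[proj_param L c Z = s] (rmod L)" "foot Z (proj_param L c Z)"
    using foot by (simp_all add: rcong_def)
qed

lemma foot_rcong: "[s = s'] (rmod L) \<Longrightarrow> foot Z s \<longleftrightarrow> foot Z s'"
  unfolding rcong_altdef using foot_periodic by metis

text \<open>Replaces the definite description in \<open>proj_param\<close> by a condition on nearest
  points, whose solution set is closed by \<open>closed_nearest\<close>.\<close>

lemma tube_eq:
  assumes "r < r0"
  shows "tube L c r lo hi = {Z. infdist Z (range c) \<le> r \<and> (\<exists>s\<in>{lo..hi}. norm (Z - c s) = infdist Z (range c))}"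
proof (intro set_eqI)
  fix Z
  show "Z \<in> tube L c r lo hi \<longleftrightarrow> Z \<in> {Z. infdist Z (range c) \<le> r \<and> (\<exists>s\<in>{lo..hi}. norm (Z - c s) = infdist Z (range c))}"
  proof (cases "infdist Z (range c) \<le> r")
    case True
    then have lt: "infdist Z (range c) < r0" using assms by simp
    obtain s0 where s0: "foot Z s0" by (rule foot_exists[OF lt])
    have "foot Z s \<longleftrightarrow> [proj_param L c Z = s] (rmod L)" for s
      using proj_param_foot[of Z s] proj_param_foot(2)[OF s0] foot_rcong by blast
    then show ?thesis using True by (simp add: tube_def nearest_iff_foot[OF lt])
  qed (simp add: tube_def)
qed

text \<open>Projection of a closed set along the compact factor \<open>[lo, hi]\<close>.\<close>

lemma closed_nearest: "closed {Z. \<exists>s\<in>{lo..hi}. norm (Z - c s) = infdist Z (range c)}"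
proof -
  have "closed {Z. \<exists>s. s \<in> {lo..hi} \<and> (s, Z) \<in> {p. norm (snd p - c (fst p)) = infdist (snd p) (range c)}}"
  proof (rule closed_compact_projection)
    show "closed {p. norm (snd p - c (fst p)) = infdist (snd p) (range c)}"
      by (intro closed_Collect_eq continuous_intros continuous_on_compose2[OF continuous_c[of UNIV]]) auto
  qed simp
  then show ?thesis by (simp add: Bex_def)
qed

end

text \<open>The tube of the theorem lies over \<open>[lo, hi]\<close>, the subsolution over the
  larger window \<open>[lo', hi']\<close>. \<open>S\<close> is the potential at the cheaper end of
  the tube, and the three \<open>gap\<close> conditions make the subsolution exceed it by
  \<open>g\<close> at both ends of the window and on the lateral boundary. The spare length
  \<open>r1\<close> in \<open>order\<close> makes lifts of nearby feet comparable without a jump by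
  a period.\<close>

locale reduced_flow = tubular_curve c c' c'' L K c0
  for c c' c'' :: "real \<Rightarrow> 'a::euclidean_space" and L K c0 +
  fixes F :: "'a \<Rightarrow> 'a" and b \<Phi> :: "real \<Rightarrow> real" and M \<delta> \<mu> \<rho> \<eta> a lo hi lo' hi' S g :: real
  assumes F_c: "F (c s) = b s *\<^sub>R c' s"
    and b_cont: "continuous_on UNIV b"
    and b_le: "\<bar>b s\<bar> \<le> M * \<delta>"
    and rho: "0 < \<rho>" "\<rho> < r0"
    and tang: "foot Z s \<Longrightarrow> norm (Z - c s) \<le> \<rho> \<Longrightarrow>
        \<bar>F Z \<bullet> c' s - b s\<bar> \<le> M * (\<delta> * norm (Z - c s) + (norm (Z - c s))\<^sup>2)"
    and norml: "foot Z s \<Longrightarrow> norm (Z - c s) \<le> \<rho> \<Longrightarrow> (Z - c s) \<bullet> F Z \<le> - \<mu> * (norm (Z - c s))\<^sup>2"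
    and pos: "M > 0" "\<delta> > 0" "\<mu> > 0" and small: "16 * M\<^sup>2 * \<delta> \<le> \<mu>\<^sup>2"
    and eta: "\<eta> = 9 / 4 * (8 * K * M + 4 * M)\<^sup>2 * \<delta>\<^sup>2 / \<mu>\<^sup>2" "\<eta> \<le> 1 / 2"
    and pot: "(\<Phi> has_real_derivative - 2 * b s) (at s)" "\<Phi> a = 0"
    and order: "lo' < lo" "lo < a" "a < hi" "hi < hi'" "hi' - lo' + r1 < L"
    and b_lo: "lo \<le> s \<Longrightarrow> s \<le> a \<Longrightarrow> b s \<ge> 0"
    and b_hi: "a \<le> s \<Longrightarrow> s \<le> hi \<Longrightarrow> b s \<le> 0"
    and pot_nonneg: "lo' \<le> s \<Longrightarrow> s \<le> hi' \<Longrightarrow> \<Phi> s \<ge> 0"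
    and S: "S = min (\<Phi> lo) (\<Phi> hi)" and g: "g > 0"
    and gap: "S + g \<le> (1 - \<eta>) * \<Phi> lo'" "S + g \<le> (1 - \<eta>) * \<Phi> hi'" "S + g \<le> \<mu> / 2 * \<rho>\<^sup>2"
begin

section \<open>Feet and the barrier inside the window\<close>

lemma eta_nonneg: "\<eta> \<ge> 0" unfolding eta(1) by simp

lemma foot_in_window_unique:
  assumes "foot Z s" "foot Z s'" "s \<in> {lo'..hi'}" "s' \<in> {lo'..hi'}"
  shows "s = s'"
proof -
  obtain k :: int where k: "s' = s + of_int k * L" using foot_unique assms by blast
  have "\<bar>of_int k * L\<bar> < 1 * L" using k assms order r1(1) by auto
  then have "\<bar>of_int k :: real\<bar> < 1" using L by (simp add: abs_mult)
  then have "k = 0" by linarith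
  then show ?thesis using k by simp
qed

text \<open>Nearby points have feet within \<open>r1\<close> modulo the period; the window is
  shorter than \<open>L - r1\<close>, so the number of periods involved is 0.\<close>

lemma foot_in_window_Lipschitz:
  assumes "foot Z s" "foot Z' s'" "s \<in> {lo'..hi'}" "s' \<in> {lo'..hi'}" "norm (Z - Z') < r0"
  shows "\<bar>s - s'\<bar> \<le> 2 * norm (Z - Z')"
proof -
  obtain k :: int where k: "\<bar>s - s' - of_int k * L\<bar> < r1" using foot_close assms by blast
  then have "\<bar>of_int k * L\<bar> < 1 * L" using assms order by auto
  then have "\<bar>of_int k :: real\<bar> < 1" using L by (simp add: abs_mult)
  then have "k = 0" by linarith
  then show ?thesis using k foot_Lipschitz assms by simp
qed

definition in_tube :: "'a \<Rightarrow> real \<Rightarrow> bool" where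
  "in_tube Z s \<longleftrightarrow> foot Z s \<and> norm (Z - c s) \<le> \<rho> \<and> s \<in> {lo'..hi'}"

text \<open>The subsolution of the Hamilton-Jacobi equation in tubular coordinates.\<close>
definition barrier :: "'a \<Rightarrow> real \<Rightarrow> real" where
  "barrier Z s = (1 - \<eta>) * \<Phi> s + \<mu> / 2 * (norm (Z - c s))\<^sup>2"

lemma potential_Lipschitz: "\<bar>\<Phi> s - \<Phi> s'\<bar> \<le> 2 * M * \<delta> * \<bar>s - s'\<bar>"
proof -
  have "norm (\<Phi> s - \<Phi> s') \<le> (2 * M * \<delta>) * norm (s - s')"
  proof (rule field_differentiable_bound[of UNIV \<Phi> "\<lambda>s. - 2 * b s"])
    show "norm (- 2 * b z) \<le> 2 * M * \<delta>" for z using b_le[of z] by (simp add: abs_mult)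
  qed (use pot in \<open>auto intro: has_field_derivative_at_within\<close>)
  then show ?thesis by simp
qed

lemma barrier_Lipschitz:
  assumes "in_tube Z s" "in_tube Z' s'" "norm (Z - Z') < r0"
  shows "\<bar>barrier Z s - barrier Z' s'\<bar> \<le> (4 * M * \<delta> + 3 * \<mu> * r0) * norm (Z - Z')"
proof -
  have ss: "\<bar>s - s'\<bar> \<le> 2 * norm (Z - Z')"
    using foot_in_window_Lipschitz assms by (auto simp: in_tube_def)
  let ?u = "norm (Z - c s)" and ?u' = "norm (Z' - c s')"
  have "\<bar>?u - ?u'\<bar> \<le> norm ((Z - c s) - (Z' - c s'))" by (rule norm_triangle_ineq3)
  also have "\<dots> = norm ((Z - Z') - (c s - c s'))" by (simp add: algebra_simps)
  also have "\<dots> \<le> norm (Z - Z') + norm (c s - c s')" by (rule norm_triangle_ineq4)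
  also have "\<dots> \<le> 3 * norm (Z - Z')" using norm_c_diff_le[of s s'] ss by simp
  finally have uu: "\<bar>?u - ?u'\<bar> \<le> 3 * norm (Z - Z')" .
  have "\<bar>?u\<^sup>2 - ?u'\<^sup>2\<bar> = \<bar>?u - ?u'\<bar> * (?u + ?u')"
    by (simp add: power2_eq_square square_diff_square_factored abs_mult mult.commute)
  also have "\<dots> \<le> (3 * norm (Z - Z')) * (r0 + r0)"
    using uu assms rho by (intro mult_mono) (auto simp: in_tube_def foot_def)
  finally have sq: "\<mu> / 2 * \<bar>?u\<^sup>2 - ?u'\<^sup>2\<bar> \<le> \<mu> / 2 * (6 * r0 * norm (Z - Z'))"
    using pos by (intro mult_left_mono) (auto simp: mult_ac)
  have pot_part: "(1 - \<eta>) * \<bar>\<Phi> s - \<Phi> s'\<bar> \<le> 1 * (2 * M * \<delta> * (2 * norm (Z - Z')))"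
  proof (rule mult_mono)
    show "\<bar>\<Phi> s - \<Phi> s'\<bar> \<le> 2 * M * \<delta> * (2 * norm (Z - Z'))"
      by (rule order_trans[OF potential_Lipschitz mult_left_mono[OF ss]]) (use pos in simp)
  qed (use eta_nonneg in auto)
  have "\<bar>barrier Z s - barrier Z' s'\<bar> \<le> \<bar>(1 - \<eta>) * (\<Phi> s - \<Phi> s')\<bar> + \<bar>\<mu> / 2 * (?u\<^sup>2 - ?u'\<^sup>2)\<bar>"
  proof -
    have "barrier Z s - barrier Z' s' = (1 - \<eta>) * (\<Phi> s - \<Phi> s') + \<mu> / 2 * (?u\<^sup>2 - ?u'\<^sup>2)"
      by (simp add: barrier_def right_diff_distrib)
    then show ?thesis by (simp only: abs_triangle_ineq)
  qed
  also have "\<dots> = (1 - \<eta>) * \<bar>\<Phi> s - \<Phi> s'\<bar> + \<mu> / 2 * \<bar>?u\<^sup>2 - ?u'\<^sup>2\<bar>"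
    using eta(2) pos by (simp add: abs_mult)
  also have "\<dots> \<le> 1 * (2 * M * \<delta> * (2 * norm (Z - Z'))) + \<mu> / 2 * (6 * r0 * norm (Z - Z'))"
    using pot_part sq by (rule add_mono)
  also have "\<dots> = (4 * M * \<delta> + 3 * \<mu> * r0) * norm (Z - Z')" by (simp add: distrib_right)
  finally show ?thesis .
qed

text \<open>Along the path the barrier is a function of time whose derivative is bounded through
  \<open>energy_inequality\<close>, and it starts at 0 on \<open>c a\<close>. Uniqueness of feet in
  the window makes the foot parameter a function of the position that is Lipschitz at small
  scales.\<close>

lemma barrier_le_action:
  assumes T: "T < 0" and Y: "abs_continuous_on T 0 Y" "Y T = c a" and t1: "T \<le> t1" "t1 \<le> 0"
    and stay: "\<And>t. T \<le> t \<Longrightarrow> t \<le> t1 \<Longrightarrow> \<exists>s. in_tube (Y t) s" and s: "in_tube (Y t1) s"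
  shows "ennreal (barrier (Y t1) s) \<le> action F T Y"
proof -
  define p where "p t = (SOME s. in_tube (Y t) s)" for t
  have p: "in_tube (Y t) (p t)" if "T \<le> t" "t \<le> t1" for t
    unfolding p_def using stay[OF that] by (rule someI_ex)
  have unique: "s = s'" if "in_tube Z s" "in_tube Z s'" for Z s s'
    using foot_in_window_unique that unfolding in_tube_def by blast
  have pT: "p T = a"
    using p[of T] unique[of "c a" "p T" a] t1 Y(2) order rho foot_c[of a] by (simp add: in_tube_def)
  have pt1: "p t1 = s" using p[of t1] unique s t1 by simp
  define f where "f t = barrier (Y t) (p t)" for t
  have Y1: "abs_continuous_on T t1 Y" using abs_continuous_on_subinterval[OF Y(1)] t1 by simp
  have "abs_continuous_on T t1 p"
  proof (rule abs_continuous_on_Lipschitz_image[OF Y1 r0(1), of 2])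
    fix x y assume "T \<le> x" "x \<le> y" "y \<le> t1" "norm (Y y - Y x) < r0"
    then show "norm (p y - p x) \<le> 2 * norm (Y y - Y x)"
      using foot_in_window_Lipschitz[of "Y y" "p y" "Y x" "p x"] p[of x] p[of y] by (auto simp: in_tube_def)
  qed simp
  then have p_cont: "continuous_on {T..t1} p" by (rule abs_continuous_on_imp_continuous_on)
  have f_ac: "abs_continuous_on T t1 f"
  proof (rule abs_continuous_on_Lipschitz_image[OF Y1 r0(1), of "4 * M * \<delta> + 3 * \<mu> * r0"])
    show "0 < 4 * M * \<delta> + 3 * \<mu> * r0" using pos r0(1) by (simp add: add_pos_pos)
    fix x y assume "T \<le> x" "x \<le> y" "y \<le> t1" "norm (Y y - Y x) < r0"
    then show "norm (f y - f x) \<le> (4 * M * \<delta> + 3 * \<mu> * r0) * norm (Y y - Y x)"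
      using barrier_Lipschitz[of "Y y" "p y" "Y x" "p x"] p[of x] p[of y] by (simp add: f_def)
  qed
  have "ennreal (f t1 - f T) \<le> action F T Y"
  proof (rule increment_le_action[OF Y(1) f_ac t1])
    fix t v assume t: "T < t" "t < t1" and v: "(Y has_vector_derivative v) (at t)"
    let ?s = "p t"
    define n where "n = Y t - c ?s"
    define m where "m = 1 - n \<bullet> c'' ?s"
    have isc: "isCont p t"
      using p_cont t by (intro continuous_on_interior[of "{T..t1}"]) auto
    have foot: "foot (Y \<tau>) (p \<tau>)" if "\<tau> \<in> {T<..<t1}" for \<tau>
      using p[of \<tau>] that by (auto simp: in_tube_def)
    have D: "(p has_real_derivative (v \<bullet> c' ?s) / m) (at t)" and mn: "\<bar>n \<bullet> c'' ?s\<bar> \<le> 1 / 2"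
      using foot_param_has_derivative[where S="{T<..<t1}", OF v foot _ _ isc] t by (auto simp: n_def m_def)
    have in_t: "in_tube (Y t) ?s" using p t by simp
    have n0: "n \<bullet> c' ?s = 0" using in_t by (simp add: in_tube_def foot_def n_def)
    define d where "d = (v \<bullet> c' ?s) / m"
    \<comment> \<open>The foot moves tangentially and \<open>n\<close> is normal, so the velocity
      \<open>d *\<^sub>R c' ?s\<close> of the foot drops out.\<close>
    have Dn: "((\<lambda>t. (norm (Y t - c (p t)))\<^sup>2) has_real_derivative 2 * (n \<bullet> v)) (at t)"
    proof -
      have "((\<lambda>t. c (p t)) has_vector_derivative d *\<^sub>R c' ?s) (at t)"
        using vector_diff_chain_at[of p d t c "c' ?s"] D der[of ?s]
        by (simp add: d_def o_def has_real_derivative_iff_has_vector_derivative)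
      with v have "((\<lambda>t. Y t - c (p t)) has_vector_derivative v - d *\<^sub>R c' ?s) (at t)"
        by (rule has_vector_derivative_diff)
      then have "((\<lambda>t. (Y t - c (p t)) \<bullet> (Y t - c (p t))) has_derivative
          (\<lambda>h. n \<bullet> (h *\<^sub>R (v - d *\<^sub>R c' ?s)) + (h *\<^sub>R (v - d *\<^sub>R c' ?s)) \<bullet> n)) (at t)"
        unfolding has_vector_derivative_def n_def by (intro has_derivative_inner)
      moreover have "(\<lambda>h. n \<bullet> (h *\<^sub>R (v - d *\<^sub>R c' ?s)) + (h *\<^sub>R (v - d *\<^sub>R c' ?s)) \<bullet> n) = (*) (2 * (n \<bullet> v))"
      proof
        have nv: "n \<bullet> (v - d *\<^sub>R c' ?s) = n \<bullet> v" using n0 by (simp add: inner_diff_right)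
        show "n \<bullet> (h *\<^sub>R (v - d *\<^sub>R c' ?s)) + (h *\<^sub>R (v - d *\<^sub>R c' ?s)) \<bullet> n = 2 * (n \<bullet> v) * h" for h
          unfolding inner_scaleR_left inner_scaleR_right inner_commute[of "v - d *\<^sub>R c' ?s" n] nv by simp
      qed
      ultimately show ?thesis by (simp add: has_field_derivative_def power2_norm_eq_inner)
    qed
    have Df: "(f has_real_derivative (1 - \<eta>) * ((- 2 * b ?s) * d) + \<mu> / 2 * (2 * (n \<bullet> v))) (at t)"
      unfolding f_def barrier_def
      by (intro DERIV_add DERIV_cmult Dn DERIV_chain2[OF pot(1)]) (use D in \<open>simp add: d_def\<close>)
    have "(1 - \<eta>) * (- 2 * b ?s) * ((v \<bullet> c' ?s) / m) + \<mu> * (n \<bullet> v) \<le> (norm (v - F (Y t)))\<^sup>2 / 2"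
    proof (rule energy_inequality[where K=K and M=M and \<delta>=\<delta>])
      show "1 / 2 \<le> m" "m \<le> 3 / 2" using mn by (auto simp: m_def abs_le_iff)
      have "n \<bullet> c'' ?s \<le> norm n * norm (c'' ?s)" by (rule norm_cauchy_schwarz)
      also have "\<dots> \<le> norm n * K" using curvature by (intro mult_left_mono) auto
      finally show "1 - m \<le> K * norm n" by (simp add: m_def mult.commute)
      show "\<bar>F (Y t) \<bullet> c' ?s - b ?s\<bar> \<le> M * (\<delta> * norm n + (norm n)\<^sup>2)"
        unfolding n_def using in_t by (intro tang) (auto simp: in_tube_def)
      show "n \<bullet> F (Y t) \<le> - \<mu> * (norm n)\<^sup>2"
        unfolding n_def using in_t by (intro norml) (auto simp: in_tube_def)
    qed (use unit n0 b_le pos small eta K in auto)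
    then show "\<exists>D. (f has_real_derivative D) (at t) \<and> D \<le> (norm (v - F (Y t)))\<^sup>2 / 2"
      using Df by (intro exI conjI) (auto simp: d_def mult.assoc)
  qed
  moreover have "f T = 0" using pT Y(2) pot(2) by (simp add: f_def barrier_def)
  ultimately show ?thesis using pt1 by (simp add: f_def)
qed

text \<open>The window is cut out by excluding the complementary arc from \<open>hi'\<close> to
  \<open>lo' + L\<close>, a closed condition; this gives openness without discussing continuity of
  the foot.\<close>

definition open_tube :: "'a set" where
  "open_tube = {Z. infdist Z (range c) < \<rho>} - {Z. \<exists>s\<in>{hi'..lo' + L}. norm (Z - c s) = infdist Z (range c)}"

lemma open_open_tube: "open open_tube"
  unfolding open_tube_def by (intro open_Diff closed_nearest open_Collect_less continuous_intros)

lemma foot_shift_into: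
  assumes "foot Z s" "x \<le> y" 
  obtains s' where "foot Z s'" "s' \<in> {x..y} \<or> s' \<in> {y..x + L}"
proof -
  define k where "k = \<lfloor>(s - x) / L\<rfloor>"
  have "of_int k \<le> (s - x) / L" "(s - x) / L < of_int k + 1" by (auto simp: k_def)
  then have "of_int k * L \<le> s - x" "s - x < (of_int k + 1) * L" using L by (auto simp: field_simps)
  then have "x \<le> s - of_int k * L" "s - of_int k * L \<le> x + L" by (auto simp: algebra_simps)
  moreover have "foot Z (s + of_int (- k) * L)" using assms by (simp only: foot_periodic)
  ultimately show thesis by (intro that[of "s - of_int k * L"]) auto
qed

lemma open_tube_imp_in_tube:
  assumes "Z \<in> open_tube" obtains s where "in_tube Z s" "lo' < s" "s < hi'" "norm (Z - c s) < \<rho>"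
proof -
  have lt: "infdist Z (range c) < \<rho>" and no: "\<not> (\<exists>s\<in>{hi'..lo' + L}. norm (Z - c s) = infdist Z (range c))"
    using assms by (auto simp: open_tube_def)
  have lt0: "infdist Z (range c) < r0" using lt rho by simp
  note near = nearest_iff_foot[OF lt0]
  obtain s0 where "foot Z s0" by (rule foot_exists[OF lt0])
  then obtain s where s: "foot Z s" "s \<in> {lo'..hi'} \<or> s \<in> {hi'..lo' + L}"
    using foot_shift_into[of Z s0 lo' hi'] order by auto
  have no': "\<not> foot Z t" if "t \<in> {hi'..lo' + L}" for t using no near that by blast
  have sin: "s \<in> {lo'..hi'}" using s no' by blast
  have L': "hi' \<le> lo' + L" using order r1(1) by simp
  have "s \<noteq> hi'" using no'[of hi'] s(1) L' by auto
  moreover have "s \<noteq> lo'"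
  proof
    assume "s = lo'"
    then have "foot Z (lo' + of_int 1 * L)" using s(1) foot_periodic[of Z lo' 1] by simp
    then show False using no'[of "lo' + L"] L' by simp
  qed
  moreover have "norm (Z - c s) < \<rho>" using lt foot_infdist[OF s(1)] by simp
  ultimately show thesis using sin s(1) by (intro that[of s]) (auto simp: in_tube_def)
qed

text \<open>A point of the closed tube outside the open one either has normal distance
  \<open>\<rho>\<close> or also has a foot on the complementary arc. In the second case the two feet
  differ by 0 or 1 periods, which puts \<open>s\<close> at an end of the window. The three
  \<open>gap\<close> bounds cover these cases.\<close>

lemma not_in_open_tube:
  assumes "in_tube Z s" "Z \<notin> open_tube"
  shows "S + g \<le> barrier Z s"
proof -
  have s: "foot Z s" "norm (Z - c s) \<le> \<rho>" "s \<in> {lo'..hi'}" using assms by (auto simp: in_tube_def)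
  have Us: "barrier Z s \<ge> (1 - \<eta>) * \<Phi> s" "barrier Z s \<ge> \<mu> / 2 * (norm (Z - c s))\<^sup>2"
    using pos eta(2) pot_nonneg[of s] s by (auto simp: barrier_def)
  have inf: "infdist Z (range c) = norm (Z - c s)" using foot_infdist[OF s(1)] .
  have lt0: "infdist Z (range c) < r0" using inf s rho by simp
  show ?thesis
  proof (cases "norm (Z - c s) < \<rho>")
    case False
    then have "norm (Z - c s) = \<rho>" using s by simp
    then show ?thesis using Us(2) gap(3) by simp
  next
    case True
    then obtain t where t: "t \<in> {hi'..lo' + L}" "foot Z t"
      using assms(2) inf nearest_iff_foot[OF lt0] by (auto simp: open_tube_def)
    obtain k :: int where k: "t = s + of_int k * L" using foot_unique[OF s(1) t(2)] by blast
    have "k \<ge> 0"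
    proof (rule ccontr)
      assume "\<not> k \<ge> 0"
      then have "of_int k * L \<le> (-1) * L" using L by (intro mult_right_mono) auto
      moreover have "hi' \<le> t" "s \<le> hi'" using t s by auto
      ultimately show False using k L by linarith
    qed
    moreover have "k \<le> 1"
    proof (rule ccontr)
      assume "\<not> k \<le> 1"
      then have "of_int k * L \<ge> 2 * L" using L by (intro mult_right_mono) auto
      moreover have "t \<le> lo' + L" "lo' \<le> s" using t s by auto
      ultimately show False using k L by linarith
    qed
    ultimately consider "k = 0" | "k = 1" by linarith
    then have "s = hi' \<or> s = lo'" using k t s by cases auto
    then show ?thesis using Us(1) gap by auto
  qed
qed

text \<open>The open tube lies in a closed set of points that still have a foot in the window; this
  keeps the barrier defined at the exit time.\<close>

lemma closure_open_tube: "closure open_tube \<subseteq> {Z. \<exists>s. in_tube Z s}"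
proof -
  let ?E = "{Z. infdist Z (range c) \<le> \<rho>} \<inter> {Z. \<exists>s\<in>{lo'..hi'}. norm (Z - c s) = infdist Z (range c)}"
  have "open_tube \<subseteq> ?E"
  proof
    fix Z assume "Z \<in> open_tube"
    then obtain s where "in_tube Z s" by (rule open_tube_imp_in_tube)
    then show "Z \<in> ?E" using foot_infdist by (auto simp: in_tube_def)
  qed
  moreover have "closed ?E" by (intro closed_Int closed_nearest closed_Collect_le continuous_intros)
  ultimately have "closure open_tube \<subseteq> ?E" by (rule closure_minimal)
  moreover have "?E \<subseteq> {Z. \<exists>s. in_tube Z s}"
  proof
    fix Z assume "Z \<in> ?E"
    then obtain s where s: "infdist Z (range c) \<le> \<rho>" "s \<in> {lo'..hi'}" "norm (Z - c s) = infdist Z (range c)" by auto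
    then have "foot Z s" using nearest_iff_foot[of Z s] rho by simp
    then show "Z \<in> {Z. \<exists>s. in_tube Z s}" using s by (auto simp: in_tube_def)
  qed
  ultimately show ?thesis by blast
qed

text \<open>Stop the path when it first leaves the open tube. The exit point lies in the closure, so
  the barrier is still defined there and has reached \<open>S + g\<close>; what happens afterwards
  cannot lower the action.\<close>

lemma action_dichotomy:
  assumes T: "T < 0" and Y: "abs_continuous_on T 0 Y" "Y T = c a"
  shows "ennreal (S + g) \<le> action F T Y \<or> (\<exists>s. in_tube (Y 0) s \<and> norm (Y 0 - c s) < \<rho> \<and> ennreal (barrier (Y 0) s) \<le> action F T Y)"
proof (cases "\<forall>t\<in>{T..0}. Y t \<in> open_tube")
  case True
  then obtain s where s: "in_tube (Y 0) s" "norm (Y 0 - c s) < \<rho>"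
    using open_tube_imp_in_tube[of "Y 0"] T by auto
  have "\<exists>s. in_tube (Y t) s" if "T \<le> t" "t \<le> 0" for t
    using True that open_tube_imp_in_tube[of "Y t"] by auto
  then show ?thesis using barrier_le_action[OF T Y, of 0 s] s T by auto
next
  case False
  define X where "X = {t \<in> {T..0}. Y t \<in> - open_tube}"
  have contY: "continuous_on {T..0} Y" by (rule abs_continuous_on_imp_continuous_on[OF Y(1)])
  have "closed X"
  proof -
    have "X = {T..0} \<inter> Y -` (- open_tube)" by (auto simp: X_def)
    moreover have "closed ({T..0} \<inter> Y -` (- open_tube))"
      by (rule continuous_closed_preimage[OF contY]) (auto intro: closed_Compl open_open_tube)
    ultimately show ?thesis by simp
  qed
  moreover have X: "X \<noteq> {}" "X \<subseteq> {T..0}" using False by (auto simp: X_def)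
  ultimately have "compact X" using compact_Icc closed_Int_compact[of X "{T..0}"] by (simp add: Int_absorb2)
  then obtain t1 where t1: "t1 \<in> X" "\<And>t. t \<in> X \<Longrightarrow> t1 \<le> t"
    using compact_attains_inf[OF _ X(1)] by blast
  have before: "Y t \<in> open_tube" if "T \<le> t" "t < t1" for t
    using t1(2)[of t] t1(1) that by (force simp: X_def)
  have YT: "Y T \<in> open_tube"
  proof -
    have "infdist (c a) (range c) = 0" by simp
    moreover have "\<not> (\<exists>s\<in>{hi'..lo' + L}. norm (c a - c s) = 0)"
    proof
      assume "\<exists>s\<in>{hi'..lo' + L}. norm (c a - c s) = 0"
      then obtain s where s: "s \<in> {hi'..lo' + L}" "c s = c a" by auto
      then have "foot (c a) s" using r0(1) by (simp add: foot_def)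
      then obtain k :: int where k: "s = a + of_int k * L" using foot_unique[OF foot_c] by blast
      moreover have "hi' \<le> s" "s \<le> lo' + L" using s by auto
      ultimately have "0 < of_int k * L" "of_int k * L < L" using order by linarith+
      then show False by (rule not_between_periods)
    qed
    ultimately show ?thesis using Y(2) rho by (simp add: open_tube_def)
  qed
  have Tt1: "T < t1" using t1(1) YT by (cases "t1 = T") (auto simp: X_def)
  have "Y t1 \<in> closure open_tube"
  proof -
    have "t1 \<in> closure {T..<t1}" using Tt1 by simp
    moreover have "continuous_on (closure {T..<t1}) Y"
      using continuous_on_subset[OF contY] Tt1 t1(1) by (simp add: X_def)
    moreover have "Y ` {T..<t1} \<subseteq> closure open_tube" using before closure_subset by force
    ultimately show ?thesis using image_closure_subset[of "{T..<t1}" Y "closure open_tube"] by auto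
  qed
  then obtain s where s: "in_tube (Y t1) s" using closure_open_tube by blast
  have "\<exists>s. in_tube (Y t) s" if "T \<le> t" "t \<le> t1" for t
    using before[of t] open_tube_imp_in_tube[of "Y t"] s that by (cases "t = t1") auto
  then have "ennreal (barrier (Y t1) s) \<le> action F T Y"
    using Tt1 t1(1) s by (intro barrier_le_action[OF T Y]) (auto simp: X_def)
  moreover have "S + g \<le> barrier (Y t1) s" using not_in_open_tube[OF s] t1(1) by (simp add: X_def)
  then have "ennreal (S + g) \<le> ennreal (barrier (Y t1) s)" by (rule ennreal_leI)
  ultimately show ?thesis using order_trans by blast
qed

text \<open>The field is tangent along the curve, so a path on the circle and its image have
  integrands that agree wherever the path is differentiable, hence almost everywhere.\<close>

lemma quasipotential_le_circle_quasipotential: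
  "quasipotential F (c s1) (c s2) \<le> circle_quasipotential L b s1 s2"
  unfolding circle_quasipotential_def
proof (rule INF_greatest, clarify)
  fix T Y assume T: "T < 0" and Y: "abs_continuous_on T 0 Y" "[Y T = s1] (rmod L)" "[Y 0 = s2] (rmod L)"
  have cc: "c x = c y" if "[x = y] (rmod L)" for x y
    using that periodic_int unfolding rcong_altdef by auto
  have ac: "abs_continuous_on T 0 (\<lambda>t. c (Y t))"
    by (rule abs_continuous_on_Lipschitz_image[OF Y(1), of 1 1]) (auto simp: norm_c_diff_le)
  have neg: "negligible {t \<in> {T<..<0}. \<not> Y differentiable (at t)}"
    by (rule abs_continuous_on_differentiable_ae[OF Y(1)]) (use T in simp)
  have "negligible ({t \<in> {T<..<0}. \<not> Y differentiable (at t)} \<union> {T, 0})" using neg by simp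
  then have AE: "AE t in lebesgue. t \<notin> {t \<in> {T<..<0}. \<not> Y differentiable (at t)} \<union> {T, 0}"
    unfolding negligible_iff_null_sets by (rule AE_not_in)
  have "action F T (\<lambda>t. c (Y t)) = action b T Y"
  proof -
    let ?f = "\<lambda>t. ennreal ((norm (vector_derivative (\<lambda>t. c (Y t)) (at t) - F (c (Y t))))\<^sup>2) * indicator {T..0} t"
    let ?g = "\<lambda>t. ennreal ((norm (vector_derivative Y (at t) - b (Y t)))\<^sup>2) * indicator {T..0} t"
    have "(\<integral>\<^sup>+t. ?f t \<partial>lebesgue) = (\<integral>\<^sup>+t. ?g t \<partial>lebesgue)"
    proof (rule nn_integral_cong_AE, use AE in eventually_elim)
      fix t assume t: "t \<notin> {t \<in> {T<..<0}. \<not> Y differentiable (at t)} \<union> {T, 0}"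
      show "?f t = ?g t"
      proof (cases "t \<in> {T..0}")
        case True
        with t have "Y differentiable (at t)" by auto
        then obtain d where d: "(Y has_vector_derivative d) (at t)"
          using vector_derivative_works by blast
        then have "((\<lambda>t. c (Y t)) has_vector_derivative d *\<^sub>R c' (Y t)) (at t)"
          using vector_diff_chain_at[of Y d t c "c' (Y t)"] der[of "Y t"] by (simp add: o_def)
        then have "vector_derivative (\<lambda>t. c (Y t)) (at t) - F (c (Y t)) = (d - b (Y t)) *\<^sub>R c' (Y t)"
          by (simp add: vector_derivative_at F_c scaleR_diff_left)
        moreover have "vector_derivative Y (at t) = d" using d by (rule vector_derivative_at)
        ultimately show ?thesis using unit[of "Y t"] by simp
      qed simp
    qed
    then show ?thesis unfolding action_def nn_integral_completion by simp
  qed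
  moreover have "quasipotential F (c s1) (c s2) \<le> action F T (\<lambda>t. c (Y t))"
    unfolding quasipotential_def
    by (rule INF_lower2[of "(T, \<lambda>t. c (Y t))"]) (use T ac cc Y in auto)
  ultimately show "quasipotential F (c s1) (c s2) \<le> action b T Y" by simp
qed

section \<open>The ends of the tube and the minimizing boundary point\<close>

lemma circle_quasipotential_cong:
  assumes "[s2 = s2'] (rmod L)"
  shows "circle_quasipotential L b s1 s2 = circle_quasipotential L b s1 s2'"
  unfolding circle_quasipotential_def using assms by (metis (no_types, opaque_lifting) rcong_sym rcong_trans)

lemma circle_quasipotential_le:
  assumes "e = lo \<or> e = hi"
  shows "circle_quasipotential L b a e \<le> ennreal (\<Phi> e)"
  using assms
proof
  assume e: "e = lo"
  have "circle_quasipotential L b a (a + (-1) * (a - lo)) \<le> ennreal (\<Phi> (a + (-1) * (a - lo)) - \<Phi> a)"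
    by (rule circle_quasipotential_le_potential[OF b_cont b_le pot(1)]) (use order b_lo in auto)
  then show ?thesis using e pot(2) by simp
next
  assume e: "e = hi"
  have "circle_quasipotential L b a (a + 1 * (hi - a)) \<le> ennreal (\<Phi> (a + 1 * (hi - a)) - \<Phi> a)"
    by (rule circle_quasipotential_le_potential[OF b_cont b_le pot(1)]) (use order b_hi in auto)
  then show ?thesis using e pot(2) by simp
qed

text \<open>Needed to test the infimum over the frontier. The curve itself leaves the tube at
  \<open>c lo\<close> and \<open>c hi\<close>: points slightly beyond have their foot in the window
  but outside \<open>[lo, hi]\<close>.\<close>

lemma tube_frontier_end:
  assumes e: "e = lo \<or> e = hi"
  shows "c e \<in> frontier (tube L c \<rho> lo hi)"
proof -
  have inf0: "infdist (c x) (range c) = 0" for x by simp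
  have "c e \<in> tube L c \<rho> lo hi"
    unfolding tube_eq[OF rho(2)] using e order rho by (auto intro: bexI[of _ e])
  moreover have "\<exists>Z. Z \<notin> tube L c \<rho> lo hi \<and> dist (c e) Z < \<epsilon>" if \<epsilon>: "\<epsilon> > 0" for \<epsilon>
  proof -
    define h where "h = min (\<epsilon> / 2) (min (hi' - hi) (lo - lo'))"
    have h: "h > 0" "h < \<epsilon>" "hi + h \<le> hi'" "lo' \<le> lo - h" using \<epsilon> order by (auto simp: h_def)
    define x where "x = (if e = lo then lo - h else hi + h)"
    have x: "x \<in> {lo'..hi'}" "x \<notin> {lo..hi}" "\<bar>e - x\<bar> < \<epsilon>" using h e order by (auto simp: x_def)
    have "dist (c e) (c x) < \<epsilon>" using norm_c_diff_le[of e x] x by (simp add: dist_norm)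
    moreover have "c x \<notin> tube L c \<rho> lo hi"
    proof
      assume "c x \<in> tube L c \<rho> lo hi"
      then obtain s where s: "s \<in> {lo..hi}" "norm (c x - c s) = 0"
        unfolding tube_eq[OF rho(2)] by auto
      then have "foot (c x) s" using r0(1) by (simp add: foot_def)
      then have "s = x" using foot_in_window_unique[OF _ foot_c] s x order by auto
      then show False using s x by simp
    qed
    ultimately show ?thesis by blast
  qed
  ultimately show ?thesis
    unfolding frontier_straddle by (intro allI impI conjI) (auto intro: bexI[of _ "c e"])
qed

text \<open>With normal distance below \<open>\<rho>\<close> and foot strictly between
  \<open>lo\<close> and \<open>hi\<close>, the point would have an open neighbourhood in the tube,
  namely the construction of \<open>open_tube\<close> for the narrower window.\<close>

lemma frontier_tube_cases:
  assumes B: "B \<in> frontier (tube L c \<rho> lo hi)" and s: "in_tube B s" "norm (B - c s) < \<rho>"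
  shows "s = lo \<or> s = hi"
proof (rule ccontr)
  assume neg: "\<not> ?thesis"
  let ?U = "tube L c \<rho> lo hi"
  have "closed ?U"
  proof -
    have "?U = {Z. infdist Z (range c) \<le> \<rho>} \<inter> {Z. \<exists>s\<in>{lo..hi}. norm (Z - c s) = infdist Z (range c)}"
      unfolding tube_eq[OF rho(2)] by auto
    then show ?thesis by (simp only:) (intro closed_Int closed_nearest closed_Collect_le continuous_intros)
  qed
  then have "B \<in> ?U" using B frontier_subset_closed by blast
  then obtain s2 where s2: "s2 \<in> {lo..hi}" "norm (B - c s2) = infdist B (range c)"
    unfolding tube_eq[OF rho(2)] by auto
  have sf: "foot B s" "s \<in> {lo'..hi'}" using s by (auto simp: in_tube_def)
  have inf: "infdist B (range c) = norm (B - c s)" by (rule foot_infdist[OF sf(1)])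
  have lt0: "infdist B (range c) < r0" using inf s rho by simp
  have "foot B s2" using s2 nearest_iff_foot[OF lt0] by simp
  then have "s2 = s" using foot_in_window_unique[OF _ sf(1)] s2 sf order by auto
  then have sin: "lo < s" "s < hi" using s2 neg by auto
  let ?O = "{Z. infdist Z (range c) < \<rho>} - {Z. \<exists>s\<in>{hi..lo + L}. norm (Z - c s) = infdist Z (range c)}"
  have "open ?O" by (intro open_Diff closed_nearest open_Collect_less continuous_intros)
  moreover have "?O \<subseteq> ?U"
  proof
    fix Z assume Z: "Z \<in> ?O"
    then have lt: "infdist Z (range c) < r0" using rho by auto
    obtain s0 where "foot Z s0" by (rule foot_exists[OF lt])
    then obtain t where t: "foot Z t" "t \<in> {lo..hi} \<or> t \<in> {hi..lo + L}"
      using foot_shift_into[of Z s0 lo hi] order by auto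
    then show "Z \<in> ?U"
      unfolding tube_eq[OF rho(2)] using Z nearest_iff_foot[OF lt] by auto
  qed
  moreover have "B \<in> ?O"
  proof -
    have "\<not> foot B t" if t: "t \<in> {hi..lo + L}" for t
    proof
      assume "foot B t"
      then obtain k :: int where k: "t = s + of_int k * L" using foot_unique[OF sf(1)] by blast
      moreover have "hi \<le> t" "t \<le> lo + L" using t by auto
      ultimately have "0 < of_int k * L" "of_int k * L < L" using sin by linarith+
      then show False by (rule not_between_periods)
    qed
    then show ?thesis using nearest_iff_foot[OF lt0] inf s by auto
  qed
  ultimately have "B \<in> interior ?U" using interior_maximal by blast
  then show False using B by (simp add: frontier_def)
qed

text \<open>Testing the infimum at both ends of the curve gives \<open>?W B \<le> ennreal S\<close>.
  So some path to \<open>B\<close> costs less than \<open>S + g\<close>, the dichotomy supplies a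
  foot of \<open>B\<close> in the window at distance below \<open>\<rho>\<close>, and
  \<open>frontier_tube_cases\<close> places it at an end.\<close>

theorem quasipotential_minimizer:
  assumes B: "B \<in> frontier (tube L c \<rho> lo hi)"
    and min: "quasipotential F (c a) B = (INF E\<in>frontier (tube L c \<rho> lo hi). quasipotential F (c a) E)"
  obtains e where "e = lo \<or> e = hi" "[proj_param L c B = e] (rmod L)"
    "quasipotential F (c a) B \<le> circle_quasipotential L b a (proj_param L c B)"
    "circle_quasipotential L b a (proj_param L c B) \<le> ennreal (\<Phi> e)"
    "ennreal ((1 - \<eta>) * \<Phi> e) \<le> quasipotential F (c a) B"
proof -
  let ?W = "quasipotential F (c a)"
  have W_le: "?W B \<le> circle_quasipotential L b a e" if "e = lo \<or> e = hi" for e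
  proof -
    have "?W B \<le> ?W (c e)" unfolding min by (rule INF_lower) (rule tube_frontier_end[OF that])
    also have "\<dots> \<le> circle_quasipotential L b a e" by (rule quasipotential_le_circle_quasipotential)
    finally show ?thesis .
  qed
  have W_S: "?W B \<le> ennreal S"
  proof -
    have "\<exists>e. (e = lo \<or> e = hi) \<and> S = \<Phi> e" unfolding S by (auto simp: min_def)
    then show ?thesis using W_le circle_quasipotential_le order_trans by metis
  qed
  have S0: "S \<ge> 0" unfolding S using pot_nonneg[of lo] pot_nonneg[of hi] order by simp
  have low: "ennreal (S + g) \<le> action F T Y \<or> (\<exists>s. in_tube B s \<and> norm (B - c s) < \<rho> \<and> ennreal (barrier B s) \<le> action F T Y)"
    if "T < 0" "abs_continuous_on T 0 Y" "Y T = c a" "Y 0 = B" for T Y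
    using action_dichotomy[OF that(1-3)] that(4) by simp
  have "?W B < ennreal (S + g)" using W_S g S0 by (metis ennreal_lessI le_less_trans less_add_same_cancel1 add_nonneg_pos)
  then obtain T Y where TY: "T < 0" "abs_continuous_on T 0 Y" "Y T = c a" "Y 0 = B" "action F T Y < ennreal (S + g)"
    unfolding quasipotential_def by (auto simp: INF_less_iff)
  then obtain s where s: "in_tube B s" "norm (B - c s) < \<rho>" using low[OF TY(1-4)] by (auto simp: not_le[symmetric])
  have e: "s = lo \<or> s = hi" by (rule frontier_tube_cases[OF B s])
  have \<Phi>s: "(1 - \<eta>) * \<Phi> s \<le> barrier B s" using pos by (simp add: barrier_def)
  \<comment> \<open>A path to \<open>B\<close> may make an excursion beyond the window and then only
    satisfies the bound \<open>S + g\<close>. The minimum covers both alternatives;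
    \<open>?W B < ennreal (S + g)\<close> decides between them afterwards.\<close>
  have W_ge: "ennreal (min (S + g) ((1 - \<eta>) * \<Phi> s)) \<le> ?W B"
    unfolding quasipotential_def
  proof (rule INF_greatest, clarify)
    fix T Y assume TY: "T < 0" "abs_continuous_on T 0 Y" "Y T = c a" "B = Y 0"
    from low[OF TY(1-3) TY(4)[symmetric]]
    show "ennreal (min (S + g) ((1 - \<eta>) * \<Phi> s)) \<le> action F T Y"
    proof
      assume "ennreal (S + g) \<le> action F T Y"
      moreover have "ennreal (min (S + g) ((1 - \<eta>) * \<Phi> s)) \<le> ennreal (S + g)" by (rule ennreal_leI) simp
      ultimately show ?thesis by (rule order_trans[rotated])
    next
      assume "\<exists>s. in_tube B s \<and> norm (B - c s) < \<rho> \<and> ennreal (barrier B s) \<le> action F T Y"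
      then obtain s' where s': "in_tube B s'" "ennreal (barrier B s') \<le> action F T Y" by blast
      have "s' = s" using foot_in_window_unique s s' unfolding in_tube_def by blast
      moreover have "ennreal (min (S + g) ((1 - \<eta>) * \<Phi> s)) \<le> ennreal (barrier B s)"
        using \<Phi>s by (intro ennreal_leI) simp
      ultimately show ?thesis using s' order_trans by blast
    qed
  qed
  have "ennreal ((1 - \<eta>) * \<Phi> s) \<le> ?W B"
  proof (cases "S + g \<le> (1 - \<eta>) * \<Phi> s")
    case True
    then have "ennreal (S + g) \<le> ?W B" using W_ge by (simp add: min_def)
    then show ?thesis using \<open>?W B < ennreal (S + g)\<close> by simp
  next
    case False
    then show ?thesis using W_ge by (simp add: min_def split: if_splits)
  qed
  moreover have foot: "foot B s" using s by (simp add: in_tube_def)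
  moreover have cong: "[proj_param L c B = s] (rmod L)" by (rule proj_param_foot(1)[OF foot])
  moreover have "circle_quasipotential L b a (proj_param L c B) = circle_quasipotential L b a s"
    by (rule circle_quasipotential_cong[OF cong])
  ultimately show thesis
    using that[OF e cong] W_le[OF e] circle_quasipotential_le[OF e] by simp
qed

end

subsection \<open>Closed curves and one-dimensional flows\<close>

text \<open>The squared norm times \<open>exp (- (2 * B) * t)\<close> is nonincreasing, nonnegative
  and starts at 0.\<close>

lemma Gronwall_zero_forward:
  fixes f :: "real \<Rightarrow> 'a::real_inner"
  assumes cont: "continuous_on {a..b} f" and zero: "f a = 0" and ab: "a \<le> b"
    and der: "\<And>t. a < t \<Longrightarrow> t < b \<Longrightarrow> \<exists>d. (f has_vector_derivative d) (at t) \<and> norm d \<le> B * norm (f t)"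
  shows "f b = 0"
proof (cases "a = b")
  case True
  then show ?thesis using zero by simp
next
  case False
  with ab have "a < b" by simp
  let ?g = "\<lambda>t. (f t \<bullet> f t) * exp (- (2 * B) * t)"
  have "?g b \<le> ?g a"
  proof (rule DERIV_nonpos_imp_decreasing_open[OF \<open>a < b\<close>[THEN less_imp_le]])
    show "continuous_on {a..b} ?g" using cont by (intro continuous_intros)
    fix t assume t: "a < t" "t < b"
    obtain d where d: "(f has_vector_derivative d) (at t)" "norm d \<le> B * norm (f t)" using der[OF t] by blast
    have "((\<lambda>t. f t \<bullet> f t) has_derivative (\<lambda>h. f t \<bullet> (h *\<^sub>R d) + (h *\<^sub>R d) \<bullet> f t)) (at t)"
      using d(1) unfolding has_vector_derivative_def by (intro has_derivative_inner)
    moreover have "(\<lambda>h. f t \<bullet> (h *\<^sub>R d) + (h *\<^sub>R d) \<bullet> f t) = (*) (2 * (f t \<bullet> d))"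
      by (rule ext) (simp add: inner_commute)
    ultimately have D1: "((\<lambda>t. f t \<bullet> f t) has_real_derivative 2 * (f t \<bullet> d)) (at t)"
      by (simp add: has_field_derivative_def)
    have D2: "((\<lambda>t. exp (- (2 * B) * t)) has_real_derivative exp (- (2 * B) * t) * (- (2 * B))) (at t)"
      by (auto intro!: derivative_eq_intros)
    have D: "(?g has_real_derivative 2 * (f t \<bullet> d) * exp (- (2 * B) * t) + exp (- (2 * B) * t) * (- (2 * B)) * (f t \<bullet> f t)) (at t)"
      by (rule DERIV_mult'[OF D1 D2, THEN DERIV_cong]) (simp add: mult.commute)
    have "f t \<bullet> d \<le> norm (f t) * norm d" by (rule norm_cauchy_schwarz)
    also have "\<dots> \<le> norm (f t) * (B * norm (f t))" using d(2) by (intro mult_left_mono) auto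
    also have "\<dots> = B * (f t \<bullet> f t)" by (simp add: power2_norm_eq_inner[symmetric] power2_eq_square)
    finally have "(2 * (f t \<bullet> d) - 2 * B * (f t \<bullet> f t)) * exp (- (2 * B) * t) \<le> 0"
      by (intro mult_nonpos_nonneg) auto
    then show "\<exists>y. (?g has_real_derivative y) (at t) \<and> y \<le> 0"
      using D by (intro exI conjI) (auto simp: algebra_simps)
  qed
  then have "f b \<bullet> f b \<le> 0" using zero by (simp add: mult_le_0_iff)
  then have "f b \<bullet> f b = 0" using inner_ge_zero by (rule antisym)
  then show ?thesis by simp
qed

lemma Gronwall_zero:
  fixes f :: "real \<Rightarrow> 'a::real_inner"
  assumes zero: "f a = 0"
    and der: "\<And>t. \<exists>d. (f has_vector_derivative d) (at t) \<and> norm d \<le> B * norm (f t)"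
  shows "f t = 0"
proof -
  have cont: "continuous_on S f" for S
    using der by (meson continuous_at_imp_continuous_on has_vector_derivative_continuous)
  show ?thesis
  proof (cases "a \<le> t")
    case True
    show "f t = 0" by (rule Gronwall_zero_forward[OF cont zero True]) (use der in blast)
  next
    case False
    \<comment> \<open>Times before \<open>a\<close> are reached by reversing time.\<close>
    let ?g = "\<lambda>t. f (- t)"
    have "?g (- t) = 0"
    proof (rule Gronwall_zero_forward[where a="- a" and b="- t" and f="?g" and B=B])
      show "continuous_on {- a..- t} ?g"
        by (intro continuous_on_compose2[OF cont[of UNIV]] continuous_intros) auto
      fix x :: real
      obtain d where d: "(f has_vector_derivative d) (at (- x))" "norm d \<le> B * norm (f (- x))" using der by blast
      have "((\<lambda>x::real. - x) has_vector_derivative - 1) (at x)" by (auto intro!: derivative_eq_intros)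
      from vector_diff_chain_at[OF this d(1)]
      have "(?g has_vector_derivative (- 1) *\<^sub>R d) (at x)" by (simp add: o_def)
      then show "\<exists>d. (?g has_vector_derivative d) (at x) \<and> norm d \<le> B * norm (?g x)"
        using d(2) by (intro exI[of _ "(- 1) *\<^sub>R d"]) simp
    qed (use zero False in auto)
    then show ?thesis by simp
  qed
qed

text \<open>By uniqueness the orbit starting at a zero stays there, so its limit is the zero
  itself.\<close>

lemma zero_in_circle_basin:
  assumes lip: "\<And>x y. \<bar>b x - b y\<bar> \<le> B * \<bar>x - y\<bar>" and z: "b z = 0" "z \<in> circle_basin L b a"
  shows "[z = a] (rmod L)"
proof -
  obtain u a' where u: "solves u b {0..}" "u 0 = z" "[a' = a] (rmod L)" "(u \<longlongrightarrow> a') at_top"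
    using z(2) by (auto simp: circle_basin_def)
  have d: "(u has_vector_derivative b (u t)) (at t within {0..})" if "t \<ge> 0" for t
    using u(1) that by (auto simp: solves_def)
  have "u t = z" if t: "t \<ge> 0" for t
  proof -
    have "u t - z = 0"
    proof (rule Gronwall_zero_forward[where a=0 and b=t and B=B and f="\<lambda>t. u t - z"])
      have "continuous_on {0..} u"
        using has_vector_derivative_continuous[OF d] by (auto simp: continuous_on_eq_continuous_within)
      then show "continuous_on {0..t} (\<lambda>t. u t - z)"
        by (intro continuous_intros) (auto elim: continuous_on_subset)
      fix x :: real assume x: "0 < x" "x < t"
      have "at x within {0..} = at x" using x by (intro at_within_interior) (auto simp: interior_real_atLeast)
      then have "(u has_vector_derivative b (u x)) (at x)" using d[of x] x by simp
      then have "((\<lambda>t. u t - z) has_vector_derivative b (u x)) (at x)"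
        using has_vector_derivative_diff[OF _ has_vector_derivative_const] by fastforce
      moreover have "norm (b (u x)) \<le> B * norm (u x - z)" using lip[of "u x" z] z(1) by simp
      ultimately show "\<exists>d. ((\<lambda>t. u t - z) has_vector_derivative d) (at x) \<and> norm d \<le> B * norm (u x - z)" by blast
    qed (use u t in auto)
    then show ?thesis by simp
  qed
  then have "\<forall>\<^sub>F t in at_top. u t = z" by (auto simp: eventually_at_top_linorder)
  then have "(u \<longlongrightarrow> z) at_top" by (rule tendsto_eventually)
  then have "a' = z" using u(4) tendsto_unique trivial_limit_at_top_linorder by blast
  then show ?thesis using u(3) by simp
qed

text \<open>Only zeros congruent to \<open>a\<close> can lie in the basin. The drift is negative
  just after \<open>a\<close> and positive just before \<open>a + L\<close>, so the circle carries
  another zero \<open>\<zeta>\<close>, which the window must avoid on either side; this bounds its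
  length. A wrong sign inside the window would create a further zero.\<close>

lemma circle_basin_window:
  assumes lip: "\<And>x y. \<bar>b x - b y\<bar> \<le> B * \<bar>x - y\<bar>" and per: "\<And>x. b (x + L) = b x" and L: "L > 0"
    and stable: "stable_hyperbolic_zero b a" and pos: "\<Delta>1 > 0" "\<Delta>2 > 0"
    and basin: "{a - \<Delta>1..a + \<Delta>2} \<subseteq> circle_basin L b a"
  shows "\<And>x. a < x \<Longrightarrow> x \<le> a + \<Delta>2 \<Longrightarrow> b x < 0" "\<And>x. a - \<Delta>1 \<le> x \<Longrightarrow> x < a \<Longrightarrow> b x > 0" "\<Delta>1 + \<Delta>2 < L"
proof -
  have cont: "continuous_on UNIV b"
  proof (rule continuous_onI)
    fix x e :: real assume e: "e > 0"
    have "dist (b y) (b x) < e" if "dist y x < e / (\<bar>B\<bar> + 1)" for y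
    proof -
      have "\<bar>b y - b x\<bar> \<le> (\<bar>B\<bar> + 1) * \<bar>y - x\<bar>"
        by (rule order_trans[OF lip]) (intro mult_right_mono, auto)
      also have "\<dots> < e" using that by (simp add: dist_real_def field_simps)
      finally show ?thesis by (simp add: dist_real_def)
    qed
    then show "\<exists>d>0. \<forall>y\<in>UNIV. dist y x < d \<longrightarrow> dist (b y) (b x) \<le> e"
      using e by (intro exI[of _ "e / (\<bar>B\<bar> + 1)"]) (auto intro: less_imp_le)
  qed
  then have isc: "isCont b x" for x by (simp add: continuous_on_eq_continuous_at)
  obtain D where D: "D < 0" "(b has_real_derivative D) (at a)" and ba: "b a = 0"
    using stable by (auto simp: stable_hyperbolic_zero_def)
  obtain d1 where d1: "d1 > 0" "\<And>h. 0 < h \<Longrightarrow> h < d1 \<Longrightarrow> b (a + h) < 0"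
    using DERIV_neg_dec_right[OF D(2,1)] ba by auto
  obtain d2 where d2: "d2 > 0" "\<And>h. 0 < h \<Longrightarrow> h < d2 \<Longrightarrow> b (a - h) > 0"
    using DERIV_neg_dec_left[OF D(2,1)] ba by auto
  have not_cong: "\<not> [z = a] (rmod L)" if "a < z" "z < a + L" for z
    using rcong_imp_eq[of z a L] that L by auto
  have not_cong': "\<not> [z = a] (rmod L)" if "a - L < z" "z < a" for z
    using rcong_imp_eq[of z a L] that L by auto
  have no_zero: "b z \<noteq> 0" if "z \<in> {a - \<Delta>1..a + \<Delta>2}" "\<not> [z = a] (rmod L)" for z
    using zero_in_circle_basin[OF lip] basin that by blast
  \<comment> \<open>A third, so that \<open>2 * h < L\<close> and the interval from
    \<open>a + h\<close> to \<open>a + L - h\<close> is nonempty.\<close>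
  define h where "h = min (min d1 d2) L / 3"
  have h: "0 < h" "h < d1" "h < d2" "2 * h < L" using d1 d2 L by (auto simp: h_def min_def)
  have "b (a + h) < 0" using d1 h by simp
  moreover have "b (a + L - h) > 0" using per[of "a - h"] d2(2)[of h] h by (simp add: algebra_simps)
  ultimately obtain \<zeta> where \<zeta>: "a + h \<le> \<zeta>" "\<zeta> \<le> a + L - h" "b \<zeta> = 0"
    using IVT[of b "a + h" 0 "a + L - h"] isc h by auto
  have \<zeta>': "b (\<zeta> - L) = 0" using per[of "\<zeta> - L"] \<zeta> by simp
  have right: "a + \<Delta>2 < \<zeta>"
  proof (rule ccontr)
    assume "\<not> ?thesis"
    then have "\<zeta> \<in> {a - \<Delta>1..a + \<Delta>2}" using \<zeta> h pos by auto
    then show False using no_zero[of \<zeta>] not_cong[of \<zeta>] \<zeta> h by auto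
  qed
  have left: "\<zeta> - L < a - \<Delta>1"
  proof (rule ccontr)
    assume "\<not> ?thesis"
    then have "\<zeta> - L \<in> {a - \<Delta>1..a + \<Delta>2}" using \<zeta> h pos by auto
    then show False using no_zero[of "\<zeta> - L"] not_cong'[of "\<zeta> - L"] \<zeta> \<zeta>' h by auto
  qed
  show "\<Delta>1 + \<Delta>2 < L" using left right by simp
  show "b x < 0" if x: "a < x" "x \<le> a + \<Delta>2" for x
  proof (rule ccontr)
    assume "\<not> ?thesis"
    define w where "w = min h (x - a) / 2"
    define y where "y = a + w"
    have "0 < min h (x - a)" "min h (x - a) \<le> x - a" "min h (x - a) \<le> h" "2 * w = min h (x - a)" using h x by (auto simp: w_def)
    then have y: "a < y" "y < x" "y - a < d1" using h x unfolding y_def by linarith+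
    then have "b y < 0" using d1(2)[of "y - a"] by simp
    then obtain z where z: "y \<le> z" "z \<le> x" "b z = 0"
      using IVT[of b y 0 x] isc y \<open>\<not> b x < 0\<close> by auto
    then show False using no_zero[of z] not_cong[of z] x y right \<zeta> h pos by auto
  qed
  show "b x > 0" if x: "a - \<Delta>1 \<le> x" "x < a" for x
  proof (rule ccontr)
    assume "\<not> ?thesis"
    define w where "w = min h (a - x) / 2"
    define y where "y = a - w"
    have "0 < min h (a - x)" "min h (a - x) \<le> a - x" "min h (a - x) \<le> h" "2 * w = min h (a - x)" using h x by (auto simp: w_def)
    then have y: "y < a" "x < y" "a - y < d2" using h x unfolding y_def by linarith+
    then have "b y > 0" using d2(2)[of "a - y"] by simp
    then obtain z where z: "x \<le> z" "z \<le> y" "b z = 0"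
      using IVT[of b x 0 y] isc y \<open>\<not> b x > 0\<close> by auto
    then show False using no_zero[of z] not_cong'[of z] x y left \<zeta> h pos by auto
  qed
qed

lemma Lipschitz_derivative_Taylor:
  fixes c :: "real \<Rightarrow> 'a::real_normed_vector"
  assumes der: "\<And>s. (c has_vector_derivative c' s) (at s)"
    and lip: "\<And>s t. norm (c' s - c' t) \<le> K * \<bar>s - t\<bar>"
  shows "norm (c t - c s - (t - s) *\<^sub>R c' s) \<le> K * \<bar>t - s\<bar>\<^sup>2"
proof -
  let ?h = "\<lambda>x. c x - x *\<^sub>R c' s"
  have K: "K * \<bar>t - s\<bar> \<ge> 0" using lip[of t s] norm_ge_zero order_trans by blast
  have "norm (?h t - ?h s) \<le> (K * \<bar>t - s\<bar>) * norm (t - s)"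
  proof (rule differentiable_bound[of "closed_segment s t" ?h "\<lambda>x h. h *\<^sub>R c' x - h *\<^sub>R c' s"])
    fix x assume x: "x \<in> closed_segment s t"
    show "(?h has_derivative (\<lambda>h. h *\<^sub>R c' x - h *\<^sub>R c' s)) (at x within closed_segment s t)"
      using der[of x] unfolding has_vector_derivative_def
      by (intro derivative_intros) (auto intro: has_derivative_at_withinI)
    have "\<bar>x - s\<bar> \<le> \<bar>t - s\<bar>" using segment_bound(1)[OF x] by simp
    show "onorm (\<lambda>h. h *\<^sub>R c' x - h *\<^sub>R c' s) \<le> K * \<bar>t - s\<bar>"
    proof (rule onorm_le)
      fix h :: real
      have "norm (h *\<^sub>R c' x - h *\<^sub>R c' s) = norm (c' x - c' s) * \<bar>h\<bar>"
        by (simp flip: scaleR_diff_right)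
      also have "norm (c' x - c' s) \<le> K * \<bar>t - s\<bar>"
      proof (cases "x = s")
        case True then show ?thesis using K by simp
      next
        case False
        have "0 \<le> K * \<bar>x - s\<bar>" using lip[of x s] norm_ge_zero order_trans by blast
        then have "K \<ge> 0" using False by (simp add: zero_le_mult_iff)
        then have "K * \<bar>x - s\<bar> \<le> K * \<bar>t - s\<bar>" using \<open>\<bar>x - s\<bar> \<le> \<bar>t - s\<bar>\<close> by (intro mult_left_mono)
        then show ?thesis using lip[of x s] by simp
      qed
      finally show "norm (h *\<^sub>R c' x - h *\<^sub>R c' s) \<le> K * \<bar>t - s\<bar> * norm h"
        by (simp add: mult_right_mono)
    qed
  qed auto
  then show ?thesis by (simp add: power2_eq_square algebra_simps)
qed

text \<open>\<open>P\<close> projects off the line of \<open>e\<close>. By the chord-arc bound and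
  the quadratic contact of \<open>c\<close> with its tangent, increments of \<open>P\<close> along
  \<open>\<gamma>\<close> from time \<open>t\<close> are quadratic in increments of
  \<open>\<gamma>\<close>, so the projected curve has derivative 0 at \<open>t\<close>. In this way
  no continuous lift of \<open>\<gamma>\<close> to parameters has to be chosen.\<close>

lemma velocity_in_tangent_line:
  fixes c :: "real \<Rightarrow> 'a::real_inner"
  assumes der: "\<And>s. (c has_vector_derivative c' s) (at s)"
    and lip: "\<And>s t. norm (c' s - c' t) \<le> K * \<bar>s - t\<bar>"
    and per: "\<And>s. c (s + L) = c s"
    and c0: "c0 > 0" and sep: "\<And>s s'. \<exists>k::int. c0 * \<bar>s - s' - of_int k * L\<bar> \<le> norm (c s - c s')"
    and e: "norm e = 1" "c' s = \<nu> *\<^sub>R e"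
    and \<gamma>: "(\<gamma> has_vector_derivative v) (at t)" "range \<gamma> \<subseteq> range c" "\<gamma> t = c s"
  shows "v = (v \<bullet> e) *\<^sub>R e"
proof -
  define P where "P x = x - (x \<bullet> e) *\<^sub>R e" for x
  have ee: "e \<bullet> e = 1" using e(1) by (simp add: norm_eq_1)
  have blP: "bounded_linear P"
    unfolding P_def by (intro bounded_linear_sub bounded_linear_ident bounded_linear_compose[OF bounded_linear_scaleR_left] bounded_linear_inner_left)
  have K: "K \<ge> 0" using order_trans[OF norm_ge_zero lip[of 0 1]] by simp
  have Pbound: "norm (P x) \<le> 2 * norm x" for x
  proof -
    have "norm (P x) \<le> norm x + norm ((x \<bullet> e) *\<^sub>R e)" unfolding P_def by (rule norm_triangle_ineq4)
    also have "norm ((x \<bullet> e) *\<^sub>R e) \<le> norm x" using Cauchy_Schwarz_ineq2[of x e] e(1) by simp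
    finally show ?thesis by simp
  qed
  have bound: "norm (P (\<gamma> \<tau>) - P (\<gamma> t)) \<le> 2 * K / c0\<^sup>2 * (norm (\<gamma> \<tau> - \<gamma> t))\<^sup>2" for \<tau>
  proof -
    obtain s1 where s1: "\<gamma> \<tau> = c s1" using \<gamma>(2) by blast
    obtain k :: int where k: "c0 * \<bar>s1 - s - of_int k * L\<bar> \<le> norm (c s1 - c s)" using sep by blast
    define s2 where "s2 = s1 - of_int k * L"
    have cs2: "c s2 = c s1" using periodic_of_int[of c L s2 k, OF per] by (simp add: s2_def)
    have "\<bar>s2 - s\<bar> \<le> norm (\<gamma> \<tau> - \<gamma> t) / c0"
      using k c0 by (simp add: s2_def s1 \<gamma>(3) field_simps)
    then have sq: "\<bar>s2 - s\<bar>\<^sup>2 \<le> (norm (\<gamma> \<tau> - \<gamma> t) / c0)\<^sup>2" by (intro power_mono) auto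
    have Pe: "P (x *\<^sub>R e) = 0" for x by (simp add: P_def ee)
    have lin: "linear P" using blP by (rule bounded_linear.linear)
    have "P (\<gamma> \<tau>) - P (\<gamma> t) = P (c s2 - c s - (s2 - s) *\<^sub>R c' s)"
      using Pe lin by (simp add: cs2 s1 \<gamma>(3) e(2) linear_diff)
    also have "norm \<dots> \<le> 2 * norm (c s2 - c s - (s2 - s) *\<^sub>R c' s)" by (rule Pbound)
    also have "\<dots> \<le> 2 * (K * \<bar>s2 - s\<bar>\<^sup>2)"
      using Lipschitz_derivative_Taylor[of c c' K s2 s, OF der lip] by simp
    also have "\<dots> \<le> 2 * (K * (norm (\<gamma> \<tau> - \<gamma> t) / c0)\<^sup>2)"
      using sq K by (intro mult_left_mono) auto
    finally show ?thesis by (simp add: power_divide)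
  qed
  have "((\<lambda>\<tau>. P (\<gamma> \<tau>)) has_vector_derivative P v) (at t)"
    using bounded_linear.has_vector_derivative[OF blP \<gamma>(1)] .
  moreover have "((\<lambda>\<tau>. P (\<gamma> \<tau>)) has_vector_derivative 0) (at t)"
    unfolding has_vector_derivative_def has_derivative_iff_norm
  proof
    show "bounded_linear (\<lambda>x. x *\<^sub>R (0::'a))" by simp
    let ?q = "\<lambda>\<tau>. norm (\<gamma> \<tau> - \<gamma> t) / norm (\<tau> - t)"
    define C where "C = 2 * K / c0\<^sup>2"
    have "((\<lambda>\<tau>. norm (\<gamma> \<tau> - \<gamma> t - (\<tau> - t) *\<^sub>R v) / norm (\<tau> - t)) \<longlongrightarrow> 0) (at t)"
      using \<gamma>(1) unfolding has_vector_derivative_def has_derivative_iff_norm by blast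
    moreover have "((\<lambda>\<tau>. norm (\<gamma> \<tau> - \<gamma> t)) \<longlongrightarrow> 0) (at t)"
    proof -
      have "isCont \<gamma> t" using \<gamma>(1) has_vector_derivative_continuous by blast
      then show ?thesis by (simp add: isCont_def LIM_zero tendsto_norm_zero)
    qed
    ultimately have "((\<lambda>\<tau>. C * norm (\<gamma> \<tau> - \<gamma> t) * (norm (\<gamma> \<tau> - \<gamma> t - (\<tau> - t) *\<^sub>R v) / norm (\<tau> - t) + norm v)) \<longlongrightarrow>
        C * 0 * (0 + norm v)) (at t)"
      by (intro tendsto_intros)
    then have lim0: "((\<lambda>\<tau>. C * norm (\<gamma> \<tau> - \<gamma> t) * (norm (\<gamma> \<tau> - \<gamma> t - (\<tau> - t) *\<^sub>R v) / norm (\<tau> - t) + norm v)) \<longlongrightarrow> 0) (at t)"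
      by simp
    have "norm (P (\<gamma> \<tau>) - P (\<gamma> t) - (\<tau> - t) *\<^sub>R 0) / norm (\<tau> - t) \<le>
        C * norm (\<gamma> \<tau> - \<gamma> t) * (norm (\<gamma> \<tau> - \<gamma> t - (\<tau> - t) *\<^sub>R v) / norm (\<tau> - t) + norm v)" if "\<tau> \<noteq> t" for \<tau>
    proof -
      let ?n = "norm (\<gamma> \<tau> - \<gamma> t)"
      have "?n \<le> norm (\<gamma> \<tau> - \<gamma> t - (\<tau> - t) *\<^sub>R v) + norm ((\<tau> - t) *\<^sub>R v)"
        using norm_triangle_ineq[of "\<gamma> \<tau> - \<gamma> t - (\<tau> - t) *\<^sub>R v" "(\<tau> - t) *\<^sub>R v"]
        by (simp only: diff_add_cancel)
      then have "?n / norm (\<tau> - t) \<le> (norm (\<gamma> \<tau> - \<gamma> t - (\<tau> - t) *\<^sub>R v) + norm ((\<tau> - t) *\<^sub>R v)) / norm (\<tau> - t)"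
        by (rule divide_right_mono) simp
      then have le: "?n / norm (\<tau> - t) \<le> norm (\<gamma> \<tau> - \<gamma> t - (\<tau> - t) *\<^sub>R v) / norm (\<tau> - t) + norm v"
        using that by (simp add: add_divide_distrib)
      have "norm (P (\<gamma> \<tau>) - P (\<gamma> t)) / norm (\<tau> - t) \<le> C * ?n\<^sup>2 / norm (\<tau> - t)"
        using bound[of \<tau>] by (intro divide_right_mono) (auto simp: C_def)
      also have "\<dots> = C * ?n * (?n / norm (\<tau> - t))" by (simp add: power2_eq_square)
      also have "\<dots> \<le> C * ?n * (norm (\<gamma> \<tau> - \<gamma> t - (\<tau> - t) *\<^sub>R v) / norm (\<tau> - t) + norm v)"
        using le K by (intro mult_left_mono) (auto simp: C_def)
      finally show ?thesis by simp
    qed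
    then show "((\<lambda>\<tau>. norm (P (\<gamma> \<tau>) - P (\<gamma> t) - (\<tau> - t) *\<^sub>R 0) / norm (\<tau> - t)) \<longlongrightarrow> 0) (at t)"
      by (intro tendsto_sandwich[OF _ _ tendsto_const lim0]) (auto simp: eventually_at_filter)
  qed
  ultimately have "P v = 0" by (rule vector_derivative_unique_at)
  then show ?thesis by (simp add: P_def)
qed

section \<open>Uniform bounds for periodic curves\<close>

lemma periodic_bounded:
  fixes f :: "real \<Rightarrow> 'a::real_normed_vector"
  assumes per: "\<And>s. f (s + L) = f s" and L: "L > 0" and cont: "continuous_on UNIV f"
  obtains B where "B > 0" "\<And>s. norm (f s) \<le> B"
proof -
  have "compact (f ` {0..L})"
    by (intro compact_continuous_image continuous_on_subset[OF cont]) auto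
  then obtain B where B: "B > 0" "\<And>y. y \<in> f ` {0..L} \<Longrightarrow> norm y \<le> B"
    using compact_imp_bounded bounded_pos by metis
  have "norm (f s) \<le> B" for s
  proof -
    have "s rmod L \<in> {0..L}" using L rmod_nonneg[of L s] rmod_less[of L s] by simp
    moreover have "f (s rmod L) = f s"
      using periodic_of_int[of f L s "- \<lfloor>s / L\<rfloor>", OF per] L by (simp add: rmod_def mult.commute)
    ultimately show ?thesis using B(2)[of "f s"] by (metis imageI)
  qed
  then show thesis using that B(1) by blast
qed

lemma velocity_periodic:
  fixes c :: "real \<Rightarrow> 'a::real_normed_vector"
  assumes per: "\<And>s. c (s + L) = c s" and der: "\<And>s. (c has_vector_derivative velocity c s) (at s)"
  shows "velocity c (s + L) = velocity c s"
proof -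
  have "((\<lambda>x. x + L) has_vector_derivative 1) (at s)" by (auto intro!: derivative_eq_intros)
  from vector_diff_chain_at[OF this der]
  have "((\<lambda>x. c (x + L)) has_vector_derivative velocity c (s + L)) (at s)" by (simp add: o_def)
  then have "(c has_vector_derivative velocity c (s + L)) (at s)" using per by simp
  then show ?thesis by (simp add: vector_derivative_at)
qed

lemma bounded_derivative_Lipschitz:
  fixes f :: "real \<Rightarrow> 'a::real_normed_vector"
  assumes "\<And>s. (f has_vector_derivative f' s) (at s)" "\<And>s. norm (f' s) \<le> B"
  shows "norm (f s - f t) \<le> B * \<bar>s - t\<bar>"
proof -
  have "norm (f s - f t) \<le> B * norm (s - t)"
  proof (rule differentiable_bound[of UNIV f "\<lambda>x h. h *\<^sub>R f' x"])
    show "(f has_derivative (\<lambda>h. h *\<^sub>R f' x)) (at x within UNIV)" for x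
      using assms(1) by (simp add: has_vector_derivative_def)
    show "onorm (\<lambda>h. h *\<^sub>R f' x) \<le> B" for x
      by (rule onorm_le) (simp add: assms(2) mult_left_mono mult.commute[of B])
  qed auto
  then show ?thesis by simp
qed

lemma Lipschitz_derivative_le:
  fixes f :: "real \<Rightarrow> 'a::real_normed_vector"
  assumes der: "(f has_vector_derivative d) (at s)" and lip: "\<And>t. norm (f t - f s) \<le> B * \<bar>t - s\<bar>"
  shows "norm d \<le> B"
proof -
  have "((\<lambda>\<tau>. norm (f \<tau> - f s - (\<tau> - s) *\<^sub>R d) / norm (\<tau> - s)) \<longlongrightarrow> 0) (at s)"
    using der unfolding has_vector_derivative_def has_derivative_iff_norm by blast
  then have "((\<lambda>\<tau>. B + norm (f \<tau> - f s - (\<tau> - s) *\<^sub>R d) / norm (\<tau> - s)) \<longlongrightarrow> B + 0) (at s)"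
    by (intro tendsto_intros)
  moreover have "\<forall>\<^sub>F \<tau> in at s. norm d \<le> B + norm (f \<tau> - f s - (\<tau> - s) *\<^sub>R d) / norm (\<tau> - s)"
  proof -
    have "norm d \<le> B + norm (f \<tau> - f s - (\<tau> - s) *\<^sub>R d) / norm (\<tau> - s)" if "\<tau> \<noteq> s" for \<tau>
    proof -
      have "norm ((\<tau> - s) *\<^sub>R d) \<le> norm (f \<tau> - f s) + norm (f \<tau> - f s - (\<tau> - s) *\<^sub>R d)"
        using norm_triangle_ineq4[of "f \<tau> - f s" "f \<tau> - f s - (\<tau> - s) *\<^sub>R d"] by simp
      then have "norm d * \<bar>\<tau> - s\<bar> \<le> B * \<bar>\<tau> - s\<bar> + norm (f \<tau> - f s - (\<tau> - s) *\<^sub>R d)"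
        using lip[of \<tau>] by (simp add: mult.commute)
      then show ?thesis using that by (simp add: field_simps)
    qed
    then show ?thesis by (auto simp: eventually_at_filter)
  qed
  ultimately show ?thesis using tendsto_lowerbound[of _ "B + 0" "at s" "norm d"] by simp
qed

text \<open>For close parameters the chord is at least half the arc by Taylor expansion. For the
  others, reduced modulo the period, injectivity and compactness give a positive minimal
  chord.\<close>

lemma unit_speed_curve_separated:
  fixes c :: "real \<Rightarrow> 'a::real_normed_vector"
  assumes c: "unit_speed_closed_curve k L c" "k \<ge> 2"
  obtains c0 where "c0 > 0" "\<And>s s'. \<exists>k::int. c0 * \<bar>s - s' - of_int k * L\<bar> \<le> norm (c s - c s')"
proof -
  have L: "L > 0" and C: "C_k (Suc (Suc 0)) c" and per: "\<And>s. c (s + L) = c s" and inj: "inj_on c {0..<L}"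
    and unit: "\<And>s. norm (velocity c s) = 1"
    using c C_k_le[of k c 2] unfolding unit_speed_closed_curve_def
    by (auto simp: numeral_2_eq_2 simp del: C_k.simps)
  have der: "(c has_vector_derivative velocity c s) (at s)" for s using C_k_curve(1)[OF C] .
  have C1: "C_k (Suc 0) (velocity c)" using C_k_curve(2)[OF C] .
  have der': "(velocity c has_vector_derivative velocity (velocity c) s) (at s)" for s using C_k_curve(1)[OF C1] .
  have per': "velocity c (s + L) = velocity c s" for s using velocity_periodic[OF per der] .
  obtain K where K: "K > 0" "\<And>s. norm (velocity (velocity c) s) \<le> K"
    by (rule periodic_bounded[of "velocity (velocity c)" L])
       (use velocity_periodic[OF per' der'] L C_k_imp_continuous_on[OF C_k_curve(2)[OF C1]] in auto)
  have lip: "norm (velocity c s - velocity c t) \<le> K * \<bar>s - t\<bar>" for s t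
    by (rule bounded_derivative_Lipschitz[OF der' K(2)])
  have near: "1 / 2 * \<bar>s - t\<bar> \<le> norm (c s - c t)" if st: "\<bar>s - t\<bar> \<le> 1 / (2 * K)" for s t
  proof -
    have "norm ((s - t) *\<^sub>R velocity c t) \<le> norm (c s - c t) + norm (c s - c t - (s - t) *\<^sub>R velocity c t)"
      using norm_triangle_ineq4[of "c s - c t" "c s - c t - (s - t) *\<^sub>R velocity c t"] by simp
    moreover have "norm (c s - c t - (s - t) *\<^sub>R velocity c t) \<le> K * \<bar>s - t\<bar>\<^sup>2"
      by (rule Lipschitz_derivative_Taylor[OF der lip])
    moreover have "K * \<bar>s - t\<bar>\<^sup>2 \<le> 1 / 2 * \<bar>s - t\<bar>"
    proof -
      have "K * \<bar>s - t\<bar> \<le> 1 / 2" using st K by (simp add: field_simps)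
      then have "K * \<bar>s - t\<bar> * \<bar>s - t\<bar> \<le> 1 / 2 * \<bar>s - t\<bar>" by (rule mult_right_mono) simp
      then show ?thesis by (simp only: power2_eq_square mult.assoc)
    qed
    ultimately show ?thesis using unit[of t] by simp
  qed
  \<comment> \<open>Pairs representing all parameter differences between \<open>1 / (2 * K)\<close>
    and half a period. The second coordinate ranges over more than one period, since only the first
    one is reduced to \<open>[0, L]\<close>.\<close>
  define X where "X = {p \<in> {0..L} \<times> {- L..2 * L}. 1 / (2 * K) \<le> \<bar>fst p - snd p\<bar> \<and> \<bar>fst p - snd p\<bar> \<le> L / 2}"
  have contc: "continuous_on S c" for S using der by (meson continuous_at_imp_continuous_on has_vector_derivative_continuous)
  have "compact X"
  proof -
    have "X = ({0..L} \<times> {- L..2 * L}) \<inter> {p. 1 / (2 * K) \<le> \<bar>fst p - snd p\<bar>} \<inter> {p. \<bar>fst p - snd p\<bar> \<le> L / 2}"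
      by (auto simp: X_def)
    then show ?thesis
      by (simp only:) (intro compact_Int_closed compact_Times compact_Icc closed_Collect_le continuous_intros)
  qed
  have inj': "\<exists>k::int. s = t + of_int k * L" if "c s = c t" for s t
  proof -
    have *: "x rmod L \<in> {0..<L}" "c (x rmod L) = c x" for x
      using L rmod_nonneg[of L x] rmod_less[of L x] periodic_of_int[of c L x "- \<lfloor>x / L\<rfloor>", OF per]
      by (auto simp: rmod_def mult.commute)
    have "s rmod L = t rmod L" using inj *(1)[of s] *(1)[of t] *(2)[of s] *(2)[of t] that by (metis inj_onD)
    then have "[t = s] (rmod L)" by (simp add: rcong_def)
    then show ?thesis by (auto simp: rcong_altdef)
  qed
  have posX: "norm (c (fst p) - c (snd p)) > 0" if p: "p \<in> X" for p
  proof (rule ccontr)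
    assume "\<not> ?thesis"
    then obtain k :: int where k: "fst p = snd p + of_int k * L" using inj' by force
    then have "\<bar>of_int k :: real\<bar> * L \<le> L / 2" using p L by (auto simp: X_def abs_mult)
    then have "\<bar>of_int k :: real\<bar> \<le> 1 / 2" using L by (simp add: field_simps)
    then have "k = 0" by linarith
    then have "1 / (2 * K) \<le> 0" using p k by (simp add: X_def)
    then show False using K by (simp add: field_simps)
  qed
  obtain m where m: "m > 0" "\<And>p. p \<in> X \<Longrightarrow> m \<le> norm (c (fst p) - c (snd p))"
  proof (cases "X = {}")
    case True then show thesis using that[of 1] by auto
  next
    case False
    have "continuous_on X (\<lambda>p. norm (c (fst p) - c (snd p)))"
      by (intro continuous_intros continuous_on_compose2[OF contc[of UNIV]]) auto
    then obtain p0 where "p0 \<in> X" "\<And>p. p \<in> X \<Longrightarrow> norm (c (fst p0) - c (snd p0)) \<le> norm (c (fst p) - c (snd p))"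
      using continuous_attains_inf[OF \<open>compact X\<close> False] by blast
    then show thesis using that[of "norm (c (fst p0) - c (snd p0))"] posX by auto
  qed
  define c0 where "c0 = min (1 / 2) (m / L)"
  have c0: "c0 > 0" using m L by (simp add: c0_def)
  have "\<exists>k::int. c0 * \<bar>s - s' - of_int k * L\<bar> \<le> norm (c s - c s')" for s s'
  proof -
    define j where "j = \<lfloor>s / L\<rfloor>"
    \<comment> \<open>Rounding to the nearest integer, so that the shifted difference is at most
      half a period.\<close>
    define k where "k = \<lfloor>(s - s') / L + 1 / 2\<rfloor>"
    define x where "x = s - of_int j * L"
    define y where "y = s' + of_int (k - j) * L"
    have cxy: "c x = c s" "c y = c s'"
      using periodic_of_int[of c L s "- j", OF per] periodic_of_int[of c L s' "k - j", OF per] by (simp_all add: x_def y_def)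
    have xy: "x - y = s - s' - of_int k * L" by (simp add: x_def y_def algebra_simps)
    have x: "0 \<le> x" "x \<le> L"
    proof -
      have "of_int j \<le> s / L" "s / L < of_int j + 1" by (auto simp: j_def)
      then show "0 \<le> x" "x \<le> L" using L by (auto simp: x_def field_simps)
    qed
    have half: "\<bar>x - y\<bar> \<le> L / 2"
    proof -
      have "of_int k \<le> (s - s') / L + 1 / 2" "(s - s') / L + 1 / 2 < of_int k + 1" by (auto simp: k_def)
      then have "of_int k * L \<le> s - s' + L / 2" "s - s' + L / 2 < of_int k * L + L" using L by (auto simp: field_simps)
      then show ?thesis unfolding xy by linarith
    qed
    have "c0 * \<bar>x - y\<bar> \<le> norm (c x - c y)"
    proof (cases "\<bar>x - y\<bar> \<le> 1 / (2 * K)")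
      case True
      have "c0 * \<bar>x - y\<bar> \<le> 1 / 2 * \<bar>x - y\<bar>" by (intro mult_right_mono) (simp_all only: c0_def min.cobounded1 abs_ge_zero)
      then show ?thesis using near[OF True] by simp
    next
      case False
      have "\<bar>x - y\<bar> \<le> L" using half L by simp
      then have "- L \<le> y" "y \<le> 2 * L" using x L by linarith+
      with False have "(x, y) \<in> X" using x half by (simp add: X_def)
      then have "m \<le> norm (c x - c y)" using m(2) by fastforce
      moreover have "c0 * \<bar>x - y\<bar> \<le> (m / L) * L"
        using half L m by (intro mult_mono) (auto simp: c0_def)
      ultimately show ?thesis using L by simp
    qed
    then show ?thesis using cxy xy by auto
  qed
  then show thesis using that c0 by blast
qed

subsection \<open>The perturbed curve\<close>

lemma sgn_Lipschitz:
  fixes u v :: "'a::real_normed_vector"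
  assumes "norm u \<ge> 1 / 2" "v \<noteq> 0"
  shows "norm (sgn u - sgn v) \<le> 4 * norm (u - v)"
proof -
  have u0: "norm u > 0" using assms(1) by (rule less_le_trans[rotated]) simp
  have "sgn u - sgn v = (u - v) /\<^sub>R norm u + (1 / norm u - 1 / norm v) *\<^sub>R v"
    by (simp add: sgn_div_norm scaleR_diff_right scaleR_diff_left inverse_eq_divide)
  also have "norm \<dots> \<le> norm ((u - v) /\<^sub>R norm u) + norm ((1 / norm u - 1 / norm v) *\<^sub>R v)" by (rule norm_triangle_ineq)
  also have "norm ((1 / norm u - 1 / norm v) *\<^sub>R v) = \<bar>norm v - norm u\<bar> / norm u"
  proof -
    have "1 / norm u - 1 / norm v = (norm v - norm u) / (norm u * norm v)" using u0 assms(2) by (simp add: field_simps)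
    then show ?thesis using u0 assms(2) by (simp add: abs_mult)
  qed
  also have "\<dots> \<le> norm (u - v) / norm u"
    using u0 norm_triangle_ineq3[of u v] by (intro divide_right_mono) (auto simp: abs_minus_commute)
  also have "norm ((u - v) /\<^sub>R norm u) = norm (u - v) / norm u" by (simp add: divide_inverse mult.commute)
  also have "norm (u - v) / norm u + norm (u - v) / norm u \<le> norm (u - v) / (1 / 2) + norm (u - v) / (1 / 2)"
    using assms(1) by (intro add_mono divide_left_mono) (auto intro: mult_pos_pos u0)
  finally show ?thesis by simp
qed

text \<open>One constant \<open>K\<close> serves all bounds on the ball of radius \<open>R\<close>.
  The margin 2 in \<open>q_ball\<close> leaves room for a displacement of the curve by at most
  \<open>1 / 2\<close> and a normal vector of length at most 1. \<open>H\<close> stands for the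
  second derivative of the potential.\<close>

locale curve_data =
  fixes gV G :: "'a::euclidean_space \<Rightarrow> 'a" and H :: "'a \<Rightarrow> 'a \<Rightarrow> 'a"
    and q q' :: "real \<Rightarrow> 'a" and L lam K R c0 :: real
  assumes L: "L > 0" and q_per: "q (s + L) = q s" and q'_per: "q' (s + L) = q' s"
    and q_der: "(q has_vector_derivative q' s) (at s)"
    and q'_lip: "norm (q' s - q' t) \<le> K * \<bar>s - t\<bar>" and q_unit: "norm (q' s) = 1"
    and c0: "0 < c0" "c0 \<le> 1" and q_sep: "\<exists>k::int. c0 * \<bar>s - t - of_int k * L\<bar> \<le> norm (q s - q t)"
    and K: "K \<ge> 1" and q_ball: "norm (q s) \<le> R - 2"
    and gT: "x \<in> cball 0 R \<Longrightarrow> y \<in> cball 0 R \<Longrightarrow> norm (gV x - gV y - H y (x - y)) \<le> K * (norm (x - y))\<^sup>2"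
    and H_lin: "linear (H x)" and H_sym: "H x v \<bullet> w = H x w \<bullet> v"
    and H_bd: "x \<in> cball 0 R \<Longrightarrow> norm (H x v) \<le> K * norm v"
    and H_lip: "x \<in> cball 0 R \<Longrightarrow> y \<in> cball 0 R \<Longrightarrow> norm (H x v - H y v) \<le> K * norm (x - y) * norm v"
    and G_bd: "x \<in> cball 0 R \<Longrightarrow> norm (G x) \<le> K"
    and G_lip: "x \<in> cball 0 R \<Longrightarrow> y \<in> cball 0 R \<Longrightarrow> norm (G x - G y) \<le> K * norm (x - y)"
    and gV_q: "gV (q s) = 0" and H_q: "H (q s) (q' s) = 0"
    and lam: "lam > 0" and H_pos: "w \<bullet> q' s = 0 \<Longrightarrow> lam * (norm w)\<^sup>2 \<le> H (q s) w \<bullet> w"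

text \<open>\<open>C * \<delta> \<le> c0 / 2\<close> preserves half of the chord-arc constant, and
  \<open>base\<close> ties the two parametrizations together at one point. Invariance enters through
  one curve per point, inside the range and with velocity \<open>F x\<close> there, which is what
  tangency of the field needs.\<close>

locale perturbed_curve = curve_data gV G H q q' L lam K R c0
  for gV G :: "'a::euclidean_space \<Rightarrow> 'a" and H q q' L lam K R c0 +
  fixes \<delta> C \<theta>A a :: real and \<phi> \<phi>' c c' c'' :: "real \<Rightarrow> 'a" and Ld :: real and F :: "'a \<Rightarrow> 'a"
  assumes C: "C \<ge> 1" and \<delta>: "0 < \<delta>" "C * \<delta> \<le> c0 / 2"
    and \<phi>_per: "\<phi> (s + L) = \<phi> s" and \<phi>'_per: "\<phi>' (s + L) = \<phi>' s"
    and \<phi>_der: "(\<phi> has_vector_derivative \<phi>' s) (at s)"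
    and \<phi>_bd: "norm (\<phi> s) \<le> C * \<delta>" and \<phi>'_bd: "norm (\<phi>' s) \<le> C * \<delta>"
    and \<phi>'_lip: "norm (\<phi>' s - \<phi>' t) \<le> C * \<delta> * \<bar>s - t\<bar>"
    and c_der: "(c has_vector_derivative c' s) (at s)" and c'_der: "(c' has_vector_derivative c'' s) (at s)"
    and c_unit: "norm (c' s) = 1" and c_per: "c (s + Ld) = c s" and Ld: "Ld > 0"
    and Ld_eq: "Ld = integral {0..L} (\<lambda>\<theta>. norm (q' \<theta> + \<phi>' \<theta>))"
    and range_eq: "range c = range (\<lambda>\<theta>. q \<theta> + \<phi> \<theta>)"
    and orient: "q \<theta> + \<phi> \<theta> = c s \<Longrightarrow> (q' \<theta> + \<phi>' \<theta>) \<bullet> c' s > 0"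
    and base: "c a = q \<theta>A + \<phi> \<theta>A"
    and F: "F x = - gV x + \<delta> *\<^sub>R G x"
    and invariant: "x \<in> range c \<Longrightarrow> \<exists>u. (u has_vector_derivative F x) (at 0) \<and> u 0 = x \<and> range u \<subseteq> range c"
begin

abbreviation Q :: "real \<Rightarrow> 'a" where "Q \<theta> \<equiv> q \<theta> + \<phi> \<theta>"
abbreviation Q' :: "real \<Rightarrow> 'a" where "Q' \<theta> \<equiv> q' \<theta> + \<phi>' \<theta>"

section \<open>Tangent and arclength of the perturbed curve\<close>

lemma C\<delta>: "C * \<delta> > 0" "C * \<delta> \<le> 1 / 2" using C \<delta> c0 by auto

lemma \<delta>_le: "\<delta> \<le> C * \<delta>" "\<delta> \<le> 1"
proof -
  show "\<delta> \<le> C * \<delta>" using C \<delta> by simp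
  then show "\<delta> \<le> 1" using C\<delta> by simp
qed

lemma Q_der: "(Q has_vector_derivative Q' \<theta>) (at \<theta>)"
  by (intro has_vector_derivative_add q_der \<phi>_der)

lemma Q'_lip: "norm (Q' s - Q' t) \<le> 2 * K * \<bar>s - t\<bar>"
proof -
  have "norm (Q' s - Q' t) \<le> norm (q' s - q' t) + norm (\<phi>' s - \<phi>' t)"
    using norm_triangle_ineq[of "q' s - q' t" "\<phi>' s - \<phi>' t"] by (simp add: algebra_simps)
  also have "\<dots> \<le> K * \<bar>s - t\<bar> + C * \<delta> * \<bar>s - t\<bar>" by (intro add_mono q'_lip \<phi>'_lip)
  also have "\<dots> \<le> K * \<bar>s - t\<bar> + K * \<bar>s - t\<bar>"
    using C\<delta> K by (intro add_left_mono mult_right_mono) auto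
  finally show ?thesis by simp
qed

lemma norm_Q': "\<bar>norm (Q' \<theta>) - 1\<bar> \<le> C * \<delta>" "norm (Q' \<theta>) \<ge> 1 / 2" "Q' \<theta> \<noteq> 0"
proof -
  have "\<bar>norm (Q' \<theta>) - norm (q' \<theta>)\<bar> \<le> norm (Q' \<theta> - q' \<theta>)" by (rule norm_triangle_ineq3)
  then show 1: "\<bar>norm (Q' \<theta>) - 1\<bar> \<le> C * \<delta>" using \<phi>'_bd[of \<theta>] by (simp add: q_unit)
  then show "norm (Q' \<theta>) \<ge> 1 / 2" using C\<delta>(2) by linarith
  then show "Q' \<theta> \<noteq> 0" by auto
qed

lemma Q_per: "Q (s + L) = Q s" by (simp add: q_per \<phi>_per)

lemma Q_sep: "\<exists>k::int. c0 / 2 * \<bar>s - t - of_int k * L\<bar> \<le> norm (Q s - Q t)"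
proof -
  obtain k :: int where k: "c0 * \<bar>s - t - of_int k * L\<bar> \<le> norm (q s - q t)" using q_sep by blast
  let ?t = "t + of_int k * L"
  have per: "q ?t = q t" "\<phi> ?t = \<phi> t"
    using periodic_of_int[of q L t k, OF q_per] periodic_of_int[of \<phi> L t k, OF \<phi>_per] by auto
  have "norm (\<phi> s - \<phi> ?t) \<le> C * \<delta> * \<bar>s - ?t\<bar>"
    by (rule bounded_derivative_Lipschitz[OF \<phi>_der \<phi>'_bd])
  also have "\<dots> \<le> c0 / 2 * \<bar>s - ?t\<bar>" using \<delta>(2) by (intro mult_right_mono) auto
  finally have "norm (\<phi> s - \<phi> t) \<le> c0 / 2 * \<bar>s - t - of_int k * L\<bar>" using per by (simp add: algebra_simps)
  moreover have "norm (q s - q t) \<le> norm (Q s - Q t) + norm (\<phi> s - \<phi> t)"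
    using norm_triangle_ineq4[of "Q s - Q t" "\<phi> s - \<phi> t"] by (simp add: algebra_simps)
  ultimately show ?thesis using k by (intro exI[of _ k]) (simp add: field_simps)
qed

definition X :: "real \<Rightarrow> 'a" where "X \<theta> = sgn (Q' \<theta>)"

lemma X_unit: "norm (X \<theta>) = 1" and Q'_eq: "Q' \<theta> = norm (Q' \<theta>) *\<^sub>R X \<theta>"
  unfolding X_def sgn_div_norm using norm_Q'(3)[of \<theta>] by simp_all

lemma X_lip: "norm (X s - X t) \<le> 8 * K * \<bar>s - t\<bar>"
proof -
  have "norm (X s - X t) \<le> 4 * norm (Q' s - Q' t)"
    unfolding X_def by (rule sgn_Lipschitz) (use norm_Q' in auto)
  also have "\<dots> \<le> 4 * (2 * K * \<bar>s - t\<bar>)" using Q'_lip by (intro mult_left_mono) auto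
  finally show ?thesis by simp
qed

lemma X_close: "norm (X \<theta> - q' \<theta>) \<le> 2 * (C * \<delta>)"
proof -
  have "X \<theta> - q' \<theta> = (1 - norm (Q' \<theta>)) *\<^sub>R X \<theta> + \<phi>' \<theta>"
  proof -
    have "X \<theta> = (1 - norm (Q' \<theta>)) *\<^sub>R X \<theta> + norm (Q' \<theta>) *\<^sub>R X \<theta>" by (simp add: scaleR_diff_left)
    also have "norm (Q' \<theta>) *\<^sub>R X \<theta> = q' \<theta> + \<phi>' \<theta>" by (rule Q'_eq[symmetric])
    finally show ?thesis by (simp add: algebra_simps)
  qed
  also have "norm \<dots> \<le> norm ((1 - norm (Q' \<theta>)) *\<^sub>R X \<theta>) + norm (\<phi>' \<theta>)" by (rule norm_triangle_ineq)
  also have "\<dots> \<le> C * \<delta> + C * \<delta>"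
    using norm_Q'(1)[of \<theta>] \<phi>'_bd[of \<theta>] by (intro add_mono) (auto simp: X_unit abs_minus_commute)
  finally show ?thesis by simp
qed

lemma tangent:
  assumes "(\<gamma> has_vector_derivative v) (at t)" "range \<gamma> \<subseteq> range c" "\<gamma> t = Q \<theta>"
  shows "v = (v \<bullet> X \<theta>) *\<^sub>R X \<theta>"
proof (rule velocity_in_tangent_line[where c=Q and c'=Q' and K="2 * K" and L=L and ?c0.0="c0 / 2" and s=\<theta>])
  show "c0 / 2 > 0" "range \<gamma> \<subseteq> range Q" using c0 assms(2) range_eq by auto
qed (rule Q_der Q'_lip Q_per Q_sep X_unit Q'_eq assms(1,3))+

text \<open>Both are unit vectors on the same tangent line; \<open>orient\<close> fixes the
  sign.\<close>

lemma c'_eq: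
  assumes "c s = Q \<theta>" shows "c' s = X \<theta>"
proof -
  have *: "c' s = (c' s \<bullet> X \<theta>) *\<^sub>R X \<theta>" by (rule tangent[OF c_der _ assms]) simp
  then have "norm (c' s) = \<bar>c' s \<bullet> X \<theta>\<bar> * norm (X \<theta>)" by (metis norm_scaleR)
  then have abs1: "\<bar>c' s \<bullet> X \<theta>\<bar> = 1" by (simp add: c_unit X_unit)
  have "0 < Q' \<theta> \<bullet> c' s" using orient assms by simp
  also have "Q' \<theta> \<bullet> c' s = norm (Q' \<theta>) * (c' s \<bullet> X \<theta>)"
    by (subst Q'_eq) (simp add: inner_commute)
  finally have "c' s \<bullet> X \<theta> > 0" using norm_Q'(3)[of \<theta>] by (simp add: zero_less_mult_iff)
  then have "c' s \<bullet> X \<theta> = 1" using abs1 by simp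
  then show ?thesis using * by simp
qed

lemma exists_arclength: "\<exists>\<sigma>. (\<forall>\<theta>. (\<sigma> has_real_derivative norm (Q' \<theta>)) (at \<theta>)) \<and> \<sigma> \<theta>A = a"
proof -
  have "continuous_on UNIV (\<lambda>\<theta>. norm (Q' \<theta>))"
  proof (rule continuous_on_norm, rule continuous_onI)
    fix x e :: real assume "e > 0"
    have "dist (Q' y) (Q' x) \<le> e" if "dist y x < e / (2 * K)" for y
    proof -
      have "2 * K * \<bar>y - x\<bar> \<le> e" using that K by (simp add: dist_real_def field_simps)
      then show ?thesis using Q'_lip[of y x] by (simp add: dist_norm)
    qed
    then show "\<exists>d>0. \<forall>y\<in>UNIV. dist y x < d \<longrightarrow> dist (Q' y) (Q' x) \<le> e"
      using \<open>e > 0\<close> K by (intro exI[of _ "e / (2 * K)"]) auto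
  qed
  then obtain \<sigma>0 where "\<And>\<theta>. (\<sigma>0 has_real_derivative norm (Q' \<theta>)) (at \<theta>)"
    by (rule continuous_antiderivative) blast
  then have "((\<lambda>\<theta>. \<sigma>0 \<theta> - \<sigma>0 \<theta>A + a) has_real_derivative norm (Q' \<theta>)) (at \<theta>)" for \<theta>
    by (auto intro!: derivative_eq_intros)
  then show ?thesis by (intro exI[of _ "\<lambda>\<theta>. \<sigma>0 \<theta> - \<sigma>0 \<theta>A + a"]) auto
qed

text \<open>Arclength along \<open>Q\<close>, normalised at the base point.\<close>

definition \<sigma> :: "real \<Rightarrow> real" where
  "\<sigma> = (SOME \<sigma>. (\<forall>\<theta>. (\<sigma> has_real_derivative norm (Q' \<theta>)) (at \<theta>)) \<and> \<sigma> \<theta>A = a)"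

lemma \<sigma>: "(\<sigma> has_real_derivative norm (Q' \<theta>)) (at \<theta>)" "\<sigma> \<theta>A = a"
  using someI_ex[OF exists_arclength] unfolding \<sigma>_def by auto

lemma \<sigma>_close: "\<bar>\<sigma> s - \<sigma> t - (s - t)\<bar> \<le> C * \<delta> * \<bar>s - t\<bar>"
proof -
  have "norm ((\<sigma> s - s) - (\<sigma> t - t)) \<le> (C * \<delta>) * \<bar>s - t\<bar>"
  proof (rule bounded_derivative_Lipschitz)
    show "((\<lambda>s. \<sigma> s - s) has_vector_derivative norm (Q' s) - 1) (at s)" for s
      unfolding has_real_derivative_iff_has_vector_derivative[symmetric]
      by (intro DERIV_diff \<sigma> DERIV_ident)
    show "norm (norm (Q' s) - 1) \<le> C * \<delta>" for s using norm_Q'(1) by simp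
  qed
  then show ?thesis by (simp add: algebra_simps)
qed

lemma \<sigma>_half: "2 * \<bar>\<sigma> s - \<sigma> t - (s - t)\<bar> \<le> \<bar>s - t\<bar>"
proof -
  have "C * \<delta> * \<bar>s - t\<bar> \<le> 1 / 2 * \<bar>s - t\<bar>" using C\<delta> by (intro mult_right_mono) auto
  then have "\<bar>\<sigma> s - \<sigma> t - (s - t)\<bar> \<le> 1 / 2 * \<bar>s - t\<bar>" by (rule order_trans[OF \<sigma>_close])
  then show ?thesis by simp
qed

lemma \<sigma>_bounds: "\<bar>\<sigma> s - \<sigma> t\<bar> \<le> 2 * \<bar>s - t\<bar>" "\<bar>s - t\<bar> \<le> 2 * \<bar>\<sigma> s - \<sigma> t\<bar>"
  using \<sigma>_half[of s t] by (smt (verit))+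

lemma \<sigma>_surj: obtains \<theta> where "s = \<sigma> \<theta>"
proof -
  define d where "d = 2 * \<bar>s - a\<bar>"
  have d: "d \<ge> 0" by (simp add: d_def)
  have "2 * \<bar>\<sigma> (\<theta>A - d) - a + d\<bar> \<le> d" "2 * \<bar>\<sigma> (\<theta>A + d) - a - d\<bar> \<le> d"
    using \<sigma>_half[of "\<theta>A - d" \<theta>A] \<sigma>_half[of "\<theta>A + d" \<theta>A] \<sigma>(2) d by auto
  then have lo: "\<sigma> (\<theta>A - d) \<le> s" and hi: "s \<le> \<sigma> (\<theta>A + d)"
    using d_def by (smt (verit))+
  have "isCont \<sigma> x" for x using \<sigma>(1) DERIV_isCont by blast
  then obtain \<theta> where "\<sigma> \<theta> = s" using IVT[of \<sigma> "\<theta>A - d" s "\<theta>A + d"] lo hi d by auto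
  then show thesis using that by blast
qed

text \<open>The point \<open>c (\<sigma> t)\<close> equals some \<open>Q t3\<close>, so its velocity
  involves the tangent at \<open>t3\<close> rather than at \<open>t\<close>. Chord-arc bounds
  \<open>\<bar>t3 - t\<bar>\<close> by a multiple of the distance of the two curves at time
  \<open>t\<close>; hence their difference satisfies a Gronwall inequality, and it vanishes at
  \<open>\<theta>A\<close>.\<close>

lemma c_\<sigma>: "c (\<sigma> \<theta>) = Q \<theta>"
proof -
  have "c (\<sigma> \<theta>) - Q \<theta> = 0"
  proof (rule Gronwall_zero[where f="\<lambda>\<theta>. c (\<sigma> \<theta>) - Q \<theta>" and a=\<theta>A and B="32 * K / c0"])
    show "c (\<sigma> \<theta>A) - Q \<theta>A = 0" using base \<sigma>(2) by simp
    fix t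
    obtain t2 where t2: "c (\<sigma> t) = Q t2" using range_eq by blast
    obtain k :: int where k: "c0 / 2 * \<bar>t2 - t - of_int k * L\<bar> \<le> norm (Q t2 - Q t)" using Q_sep by blast
    define t3 where "t3 = t2 - of_int k * L"
    have Qt3: "Q t3 = c (\<sigma> t)" using periodic_of_int[of Q L t3 k, OF Q_per] t2 by (simp add: t3_def)
    have "((\<lambda>\<theta>. c (\<sigma> \<theta>)) has_vector_derivative norm (Q' t) *\<^sub>R c' (\<sigma> t)) (at t)"
      using vector_diff_chain_at[of \<sigma> "norm (Q' t)" t c "c' (\<sigma> t)"] \<sigma>(1) c_der
      by (simp add: o_def has_real_derivative_iff_has_vector_derivative)
    then have D: "((\<lambda>\<theta>. c (\<sigma> \<theta>) - Q \<theta>) has_vector_derivative norm (Q' t) *\<^sub>R c' (\<sigma> t) - Q' t) (at t)"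
      by (intro has_vector_derivative_diff Q_der)
    have "norm (Q' t) *\<^sub>R c' (\<sigma> t) - Q' t = norm (Q' t) *\<^sub>R (X t3 - X t)"
      using c'_eq[of "\<sigma> t" t3] Qt3 Q'_eq[of t] by (simp add: scaleR_diff_right)
    also have "norm \<dots> = norm (Q' t) * norm (X t3 - X t)" by simp
    also have "\<dots> \<le> 2 * (8 * K * \<bar>t3 - t\<bar>)"
    proof (rule mult_mono)
      show "norm (Q' t) \<le> 2" using norm_Q'(1)[of t] C\<delta>(2) by linarith
    qed (use X_lip in auto)
    also have "\<bar>t3 - t\<bar> \<le> 2 / c0 * norm (c (\<sigma> t) - Q t)"
      using k c0 by (simp add: t3_def t2 field_simps)
    finally have "norm (norm (Q' t) *\<^sub>R c' (\<sigma> t) - Q' t) \<le> 2 * (8 * K * (2 / c0 * norm (c (\<sigma> t) - Q t)))"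
      using K by simp
    then show "\<exists>d. ((\<lambda>\<theta>. c (\<sigma> \<theta>) - Q \<theta>) has_vector_derivative d) (at t) \<and> norm d \<le> 32 * K / c0 * norm (c (\<sigma> t) - Q t)"
      using D by (intro exI conjI) auto
  qed
  then show ?thesis by simp
qed

lemma c'_\<sigma>: "c' (\<sigma> \<theta>) = X \<theta>" by (rule c'_eq[OF c_\<sigma>])

text \<open>The increment of \<open>\<sigma>\<close> over one period is the length
  \<open>Ld\<close>, so \<open>\<sigma> \<theta> - Ld / L * \<theta>\<close> is periodic.\<close>

lemma \<sigma>_per: "\<sigma> (\<theta> + of_int k * L) = \<sigma> \<theta> + of_int k * Ld"
proof -
  have "Q' (s + L) = Q' s" for s by (simp add: q'_per \<phi>'_per)
  then have D: "((\<lambda>\<theta>. \<sigma> (\<theta> + L) - \<sigma> \<theta>) has_real_derivative 0) (at \<theta>)" for \<theta>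
    using DERIV_diff[OF \<sigma>(1)[of "\<theta> + L", unfolded DERIV_shift] \<sigma>(1)[of \<theta>]] by simp
  then have const: "\<sigma> (\<theta> + L) - \<sigma> \<theta> = \<sigma> (0 + L) - \<sigma> 0" for \<theta>
    using DERIV_isconst_all[of "\<lambda>\<theta>. \<sigma> (\<theta> + L) - \<sigma> \<theta>" \<theta> 0] D by blast
  have "((\<lambda>\<theta>. norm (Q' \<theta>)) has_integral (\<sigma> L - \<sigma> 0)) {0..L}"
    by (rule fundamental_theorem_of_calculus)
       (use L \<sigma>(1) in \<open>auto simp: has_real_derivative_iff_has_vector_derivative[symmetric] intro: has_field_derivative_at_within\<close>)
  then have "Ld = \<sigma> L - \<sigma> 0" unfolding Ld_eq by (rule integral_unique)
  then have step: "\<sigma> (\<theta> + L) - Ld / L * (\<theta> + L) = \<sigma> \<theta> - Ld / L * \<theta>" for \<theta>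
  proof -
    have "Ld / L * (\<theta> + L) = Ld / L * \<theta> + Ld" using L by (simp add: distrib_left)
    then show ?thesis using const[of \<theta>] \<open>Ld = \<sigma> L - \<sigma> 0\<close> by simp
  qed
  have "\<sigma> (\<theta> + of_int k * L) - Ld / L * (\<theta> + of_int k * L) = \<sigma> \<theta> - Ld / L * \<theta>"
    by (rule periodic_of_int[of "\<lambda>\<theta>. \<sigma> \<theta> - Ld / L * \<theta>"]) (rule step)
  moreover have "Ld / L * (\<theta> + of_int k * L) = Ld / L * \<theta> + of_int k * Ld" using L by (simp add: distrib_left)
  ultimately show ?thesis by simp
qed

lemma Ld_close: "\<bar>Ld - L\<bar> \<le> C * \<delta> * L"
  using \<sigma>_close[of "0 + of_int 1 * L" 0] \<sigma>_per[of 0 1] L by simp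

lemma c'_lip: "norm (c' s - c' t) \<le> 16 * K * \<bar>s - t\<bar>"
proof -
  obtain x y where xy: "s = \<sigma> x" "t = \<sigma> y" using \<sigma>_surj by metis
  have "norm (c' s - c' t) \<le> 8 * K * \<bar>x - y\<bar>" unfolding xy c'_\<sigma> by (rule X_lip)
  also have "\<dots> \<le> 8 * K * (2 * \<bar>s - t\<bar>)" using \<sigma>_bounds(2) K unfolding xy by (intro mult_left_mono) auto
  finally show ?thesis by simp
qed

text \<open>Neither the curvature bound nor the chord-arc constant depends on
  \<open>\<delta>\<close>, so the tube radius is uniform. \<open>K1\<close> stays free so that
  \<open>r1\<close> can later be made small against the part of the circle left over by the
  window.\<close>

lemma tubular:
  assumes "K1 \<ge> 16 * K"
  shows "tubular_curve c c' c'' Ld K1 (c0 / 4)"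
proof
  show "Ld > 0" by (rule Ld)
  show "c (s + Ld) = c s" for s by (rule c_per)
  show "c' (s + Ld) = c' s" for s
  proof -
    obtain x where x: "s = \<sigma> x" by (rule \<sigma>_surj)
    have "Q' (x + L) = Q' x" by (simp add: q'_per \<phi>'_per)
    then show ?thesis using c'_\<sigma>[of "x + L"] c'_\<sigma>[of x] \<sigma>_per[of x 1] by (simp add: x X_def)
  qed
  show "(c has_vector_derivative c' s) (at s)" "(c' has_vector_derivative c'' s) (at s)" "norm (c' s) = 1" for s
    by (rule c_der c'_der c_unit)+
  show "norm (c'' s) \<le> K1" for s
    using Lipschitz_derivative_le[OF c'_der c'_lip] assms by (rule order_trans)
  show "K1 \<ge> 1" using assms K by simp
  show "0 < c0 / 4" "c0 / 4 \<le> 1" using c0 by auto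
  show "\<exists>k::int. c0 / 4 * \<bar>s - s' - of_int k * Ld\<bar> \<le> norm (c s - c s')" for s s'
  proof -
    obtain x y where xy: "s = \<sigma> x" "s' = \<sigma> y" using \<sigma>_surj by metis
    obtain k :: int where k: "c0 / 2 * \<bar>x - y - of_int k * L\<bar> \<le> norm (Q x - Q y)" using Q_sep by blast
    have "\<bar>s - s' - of_int k * Ld\<bar> = \<bar>\<sigma> x - \<sigma> (y + of_int k * L)\<bar>" unfolding xy \<sigma>_per by (simp add: algebra_simps)
    also have "\<dots> \<le> 2 * \<bar>x - (y + of_int k * L)\<bar>" by (rule \<sigma>_bounds)
    finally have "c0 / 4 * \<bar>s - s' - of_int k * Ld\<bar> \<le> c0 / 4 * (2 * \<bar>x - y - of_int k * L\<bar>)"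
      using c0 by (intro mult_left_mono) (auto simp: algebra_simps)
    then show ?thesis using k by (intro exI[of _ k]) (simp add: xy c_\<sigma>)
  qed
qed

section \<open>The drift on and near the perturbed curve\<close>

definition b :: "real \<Rightarrow> real" where "b s = F (c s) \<bullet> c' s"

lemma F_c: "F (c s) = b s *\<^sub>R c' s"
proof -
  obtain x where x: "s = \<sigma> x" by (rule \<sigma>_surj)
  obtain u where u: "(u has_vector_derivative F (c s)) (at 0)" "u 0 = c s" "range u \<subseteq> range c"
    using invariant[of "c s"] by blast
  have "F (c s) = (F (c s) \<bullet> X x) *\<^sub>R X x"
    by (rule tangent[OF u(1,3)]) (use u(2) x c_\<sigma> in simp)
  then show ?thesis by (simp add: b_def x c'_\<sigma>)
qed

lemma in_ball: "q \<theta> \<in> cball 0 R" "Q \<theta> \<in> cball 0 R" "norm n \<le> 1 \<Longrightarrow> Q \<theta> + n \<in> cball 0 R"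
proof -
  have *: "norm (q \<theta>) \<le> R - 2" "norm (\<phi> \<theta>) \<le> 1 / 2" using q_ball \<phi>_bd C\<delta> order_trans by blast+
  then show "q \<theta> \<in> cball 0 R" by simp
  show "Q \<theta> \<in> cball 0 R" using * norm_triangle_ineq[of "q \<theta>" "\<phi> \<theta>"] by simp
  show "Q \<theta> + n \<in> cball 0 R" if "norm n \<le> 1"
    using * that norm_triangle_ineq[of "q \<theta>" "\<phi> \<theta>"] norm_triangle_ineq[of "Q \<theta>" n] by simp
qed

lemma inner_le: "\<bar>x \<bullet> y\<bar> \<le> norm x * norm y" for x y :: 'a by (rule Cauchy_Schwarz_ineq2)

text \<open>The gradient at \<open>Q \<theta>\<close> has first-order part
  \<open>H (q \<theta>) (\<phi> \<theta>)\<close>, which is orthogonal to \<open>q' \<theta>\<close>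
  by symmetry and \<open>H_q\<close>. Only its product with \<open>X \<theta> - q' \<theta>\<close>,
  itself of order \<open>\<delta>\<close>, survives, so the error is quadratic.\<close>

lemma b_close: "\<bar>b (\<sigma> \<theta>) - \<delta> * (G (q \<theta>) \<bullet> q' \<theta>)\<bar> \<le> 6 * K * C\<^sup>2 * \<delta>\<^sup>2"
proof -
  let ?e = "X \<theta>" and ?d = "C * \<delta>"
  have K0: "K \<ge> 0" using K by simp
  have d0: "?d \<ge> 0" using C\<delta> by simp
  have ee: "norm (?e - q' \<theta>) \<le> 2 * ?d" by (rule X_close)
  let ?T = "gV (Q \<theta>) - gV (q \<theta>) - H (q \<theta>) (Q \<theta> - q \<theta>)"
  have T: "norm ?T \<le> K * ?d\<^sup>2"
  proof -
    have "norm ?T \<le> K * (norm (Q \<theta> - q \<theta>))\<^sup>2" by (rule gT) (rule in_ball)+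
    also have "\<dots> \<le> K * ?d\<^sup>2" using \<phi>_bd[of \<theta>] K0 by (intro mult_left_mono power_mono) auto
    finally show ?thesis .
  qed
  have "gV (Q \<theta>) = ?T + H (q \<theta>) (\<phi> \<theta>)" by (simp add: gV_q)
  then have "gV (Q \<theta>) \<bullet> ?e = ?T \<bullet> ?e + (H (q \<theta>) (\<phi> \<theta>) \<bullet> q' \<theta> + H (q \<theta>) (\<phi> \<theta>) \<bullet> (?e - q' \<theta>))"
    by (metis inner_add_left inner_add_right add.commute diff_add_cancel)
  moreover have "H (q \<theta>) (\<phi> \<theta>) \<bullet> q' \<theta> = 0" using H_sym[of "q \<theta>" "\<phi> \<theta>" "q' \<theta>"] H_q by simp
  moreover have "\<bar>?T \<bullet> ?e\<bar> \<le> K * ?d\<^sup>2" using inner_le[of ?T ?e] T by (simp add: X_unit)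
  moreover have "\<bar>H (q \<theta>) (\<phi> \<theta>) \<bullet> (?e - q' \<theta>)\<bar> \<le> (K * ?d) * (2 * ?d)"
  proof -
    have "norm (H (q \<theta>) (\<phi> \<theta>)) \<le> K * norm (\<phi> \<theta>)" by (rule H_bd) (rule in_ball)
    also have "\<dots> \<le> K * ?d" using \<phi>_bd K0 by (intro mult_left_mono)
    finally have "norm (H (q \<theta>) (\<phi> \<theta>)) * norm (?e - q' \<theta>) \<le> (K * ?d) * (2 * ?d)"
      using ee K0 d0 by (intro mult_mono) auto
    then show ?thesis using inner_le order_trans by blast
  qed
  ultimately have gV: "\<bar>gV (Q \<theta>) \<bullet> ?e\<bar> \<le> 3 * K * ?d\<^sup>2" by (simp add: power2_eq_square algebra_simps)
  have G: "\<bar>G (Q \<theta>) \<bullet> ?e - G (q \<theta>) \<bullet> q' \<theta>\<bar> \<le> 3 * K * ?d"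
  proof -
    have "G (Q \<theta>) \<bullet> ?e - G (q \<theta>) \<bullet> q' \<theta> = (G (Q \<theta>) - G (q \<theta>)) \<bullet> ?e + G (q \<theta>) \<bullet> (?e - q' \<theta>)"
      by (simp add: inner_diff_left inner_diff_right)
    moreover have "\<bar>(G (Q \<theta>) - G (q \<theta>)) \<bullet> ?e\<bar> \<le> K * ?d"
    proof -
      have "norm (G (Q \<theta>) - G (q \<theta>)) \<le> K * norm (Q \<theta> - q \<theta>)" by (rule G_lip) (rule in_ball)+
      also have "\<dots> \<le> K * ?d" using \<phi>_bd[of \<theta>] K0 by (intro mult_left_mono) auto
      finally show ?thesis using inner_le[of "G (Q \<theta>) - G (q \<theta>)" ?e] by (simp add: X_unit)
    qed
    moreover have "\<bar>G (q \<theta>) \<bullet> (?e - q' \<theta>)\<bar> \<le> K * (2 * ?d)"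
    proof -
      have "norm (G (q \<theta>)) * norm (?e - q' \<theta>) \<le> K * (2 * ?d)"
        using ee K0 G_bd[OF in_ball(1)] by (intro mult_mono) auto
      then show ?thesis using inner_le order_trans by blast
    qed
    ultimately show ?thesis by linarith
  qed
  have "b (\<sigma> \<theta>) - \<delta> * (G (q \<theta>) \<bullet> q' \<theta>) = - (gV (Q \<theta>) \<bullet> ?e) + \<delta> * (G (Q \<theta>) \<bullet> ?e - G (q \<theta>) \<bullet> q' \<theta>)"
    by (simp add: b_def c_\<sigma> c'_\<sigma> F inner_add_left inner_diff_left right_diff_distrib)
  also have "\<bar>\<dots>\<bar> \<le> \<bar>gV (Q \<theta>) \<bullet> ?e\<bar> + \<delta> * \<bar>G (Q \<theta>) \<bullet> ?e - G (q \<theta>) \<bullet> q' \<theta>\<bar>"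
    using abs_triangle_ineq[of "- (gV (Q \<theta>) \<bullet> ?e)" "\<delta> * (G (Q \<theta>) \<bullet> ?e - G (q \<theta>) \<bullet> q' \<theta>)"] \<delta>
    by (simp add: abs_mult)
  also have "\<dots> \<le> 3 * K * ?d\<^sup>2 + ?d * (3 * K * ?d)"
    using gV G \<delta>_le \<delta> d0 by (intro add_mono mult_mono) auto
  finally show ?thesis by (simp add: power2_eq_square algebra_simps)
qed

lemma b_le: "\<bar>b s\<bar> \<le> 7 * K * C\<^sup>2 * \<delta>"
proof -
  obtain x where x: "s = \<sigma> x" by (rule \<sigma>_surj)
  have "\<bar>G (q x) \<bullet> q' x\<bar> \<le> K"
    using inner_le[of "G (q x)" "q' x"] G_bd[OF in_ball(1)[of x]] by (simp add: q_unit)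
  then have "\<bar>\<delta> * (G (q x) \<bullet> q' x)\<bar> \<le> \<delta> * K" using \<delta> by (simp add: abs_mult)
  also have "\<dots> \<le> K * C\<^sup>2 * \<delta>"
    using \<delta> K C by (simp add: one_le_power)
  finally have "\<bar>\<delta> * (G (q x) \<bullet> q' x)\<bar> \<le> K * C\<^sup>2 * \<delta>" .
  moreover have "6 * K * C\<^sup>2 * \<delta>\<^sup>2 \<le> 6 * K * C\<^sup>2 * \<delta>"
    using \<delta>_le \<delta> K by (intro mult_left_mono) (auto simp: power2_eq_square)
  ultimately show ?thesis using b_close[of x] unfolding x by linarith
qed

text \<open>The linear term \<open>H (q \<theta>) n\<close> is orthogonal to
  \<open>q' \<theta>\<close>. What remains either pairs \<open>n\<close> with a quantity of order
  \<open>\<delta>\<close> or is the quadratic Taylor remainder.\<close>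

lemma tangential:
  assumes n: "n \<bullet> c' s = 0" "norm n \<le> 1"
  shows "\<bar>F (c s + n) \<bullet> c' s - b s\<bar> \<le> 7 * K * C\<^sup>2 * (\<delta> * norm n + (norm n)\<^sup>2)"
proof -
  obtain \<theta> where s: "s = \<sigma> \<theta>" by (rule \<sigma>_surj)
  let ?e = "X \<theta>" and ?d = "C * \<delta>" and ?r = "norm n"
  have K0: "K \<ge> 0" using K by simp
  let ?T = "gV (Q \<theta> + n) - gV (Q \<theta>) - H (Q \<theta>) n"
  have T: "norm ?T \<le> K * ?r\<^sup>2" using gT[OF in_ball(3)[OF n(2)] in_ball(2), of \<theta> \<theta>] by simp
  have eq: "(gV (Q \<theta> + n) - gV (Q \<theta>)) \<bullet> ?e = ?T \<bullet> ?e + (H (Q \<theta>) n - H (q \<theta>) n) \<bullet> ?e + H (q \<theta>) n \<bullet> (?e - q' \<theta>) + H (q \<theta>) n \<bullet> q' \<theta>"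
    by (simp add: inner_diff_left inner_diff_right)
  have z: "H (q \<theta>) n \<bullet> q' \<theta> = 0" using H_sym[of "q \<theta>" n "q' \<theta>"] H_q by simp
  have t1: "\<bar>?T \<bullet> ?e\<bar> \<le> K * ?r\<^sup>2" using inner_le[of ?T ?e] T by (simp add: X_unit)
  have t2: "\<bar>(H (Q \<theta>) n - H (q \<theta>) n) \<bullet> ?e\<bar> \<le> K * ?d * ?r"
  proof -
    have "norm (H (Q \<theta>) n - H (q \<theta>) n) \<le> K * norm (Q \<theta> - q \<theta>) * ?r" by (rule H_lip) (rule in_ball)+
    also have "\<dots> \<le> K * ?d * ?r" using \<phi>_bd[of \<theta>] K0 by (intro mult_right_mono mult_left_mono) auto
    finally show ?thesis using inner_le[of "H (Q \<theta>) n - H (q \<theta>) n" ?e] by (simp add: X_unit)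
  qed
  have t3: "\<bar>H (q \<theta>) n \<bullet> (?e - q' \<theta>)\<bar> \<le> (K * ?r) * (2 * ?d)"
  proof -
    have "norm (H (q \<theta>) n) * norm (?e - q' \<theta>) \<le> (K * ?r) * (2 * ?d)"
      using X_close[of \<theta>] H_bd[OF in_ball(1)] K0 by (intro mult_mono) auto
    then show ?thesis using inner_le order_trans by blast
  qed
  have t4: "\<bar>(G (Q \<theta> + n) - G (Q \<theta>)) \<bullet> ?e\<bar> \<le> K * ?r"
    using G_lip[OF in_ball(3)[OF n(2)] in_ball(2), of \<theta> \<theta>] inner_le[of "G (Q \<theta> + n) - G (Q \<theta>)" ?e]
    by (simp add: X_unit)
  have "F (c s + n) \<bullet> c' s - b s = - ((gV (Q \<theta> + n) - gV (Q \<theta>)) \<bullet> ?e) + \<delta> * ((G (Q \<theta> + n) - G (Q \<theta>)) \<bullet> ?e)"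
    by (simp add: b_def s c_\<sigma> c'_\<sigma> F inner_add_left inner_diff_left right_diff_distrib)
  also have "\<bar>\<dots>\<bar> \<le> \<bar>(gV (Q \<theta> + n) - gV (Q \<theta>)) \<bullet> ?e\<bar> + \<delta> * \<bar>(G (Q \<theta> + n) - G (Q \<theta>)) \<bullet> ?e\<bar>"
    using abs_triangle_ineq[of "- ((gV (Q \<theta> + n) - gV (Q \<theta>)) \<bullet> ?e)" "\<delta> * ((G (Q \<theta> + n) - G (Q \<theta>)) \<bullet> ?e)"] \<delta>
    by (simp add: abs_mult)
  also have "\<dots> \<le> (K * ?r\<^sup>2 + K * ?d * ?r + (K * ?r) * (2 * ?d)) + \<delta> * (K * ?r)"
  proof (rule add_mono)
    show "\<bar>(gV (Q \<theta> + n) - gV (Q \<theta>)) \<bullet> ?e\<bar> \<le> K * ?r\<^sup>2 + K * ?d * ?r + (K * ?r) * (2 * ?d)"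
      unfolding eq z using t1 t2 t3 by linarith
    show "\<delta> * \<bar>(G (Q \<theta> + n) - G (Q \<theta>)) \<bullet> ?e\<bar> \<le> \<delta> * (K * ?r)" using t4 \<delta> by (intro mult_left_mono) auto
  qed
  also have "\<dots> = K * ?r\<^sup>2 + (3 * C + 1) * (K * (\<delta> * ?r))" by (simp add: algebra_simps)
  also have "\<dots> \<le> (7 * C\<^sup>2) * (K * ?r\<^sup>2) + (7 * C\<^sup>2) * (K * (\<delta> * ?r))"
  proof (rule add_mono)
    have C2: "1 \<le> C\<^sup>2" by (rule one_le_power[OF C])
    moreover have "C \<le> C\<^sup>2" using C by (simp add: power2_eq_square)
    ultimately have C3: "3 * C + 1 \<le> 7 * C\<^sup>2" by linarith
    have "1 * (K * ?r\<^sup>2) \<le> (7 * C\<^sup>2) * (K * ?r\<^sup>2)" using C2 K0 by (intro mult_right_mono) auto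
    then show "K * ?r\<^sup>2 \<le> (7 * C\<^sup>2) * (K * ?r\<^sup>2)" by simp
    show "(3 * C + 1) * (K * (\<delta> * ?r)) \<le> (7 * C\<^sup>2) * (K * (\<delta> * ?r))"
      using C3 K0 \<delta> by (intro mult_right_mono) auto
  qed
  finally show ?thesis by (simp add: algebra_simps)
qed

text \<open>\<open>n\<close> is normal to the perturbed curve, not to \<open>q'\<close>. Its
  component along \<open>q'\<close> has size of order \<open>\<delta> * norm n\<close> and is
  annihilated by \<open>H (q \<theta>)\<close>, so the coercivity of \<open>H\<close> on normal
  vectors loses only order \<open>\<delta>\<^sup>2\<close>. Since \<open>F\<close> is tangent at the
  foot, only the increment of \<open>F\<close> counts.\<close>

lemma normal:
  assumes n: "n \<bullet> c' s = 0" "norm n \<le> r" "r \<le> 1"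
    and small: "4 * lam * C\<^sup>2 * \<delta>\<^sup>2 + K * C * \<delta> + K * \<delta> + K * r \<le> lam / 2"
  shows "n \<bullet> F (c s + n) \<le> - (lam / 2) * (norm n)\<^sup>2"
proof -
  obtain \<theta> where s: "s = \<sigma> \<theta>" by (rule \<sigma>_surj)
  let ?e = "X \<theta>" and ?d = "C * \<delta>" and ?r = "norm n"
  have n1: "norm n \<le> 1" using n by simp
  have K0: "K \<ge> 0" using K by simp
  have ne: "n \<bullet> ?e = 0" using n by (simp add: s c'_\<sigma>)
  let ?T = "gV (Q \<theta> + n) - gV (Q \<theta>) - H (Q \<theta>) n"
  have T: "norm ?T \<le> K * ?r\<^sup>2" using gT[OF in_ball(3)[OF n1] in_ball(2), of \<theta> \<theta>] by simp
  have t1: "- (n \<bullet> ?T) \<le> ?r * (K * ?r\<^sup>2)"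
  proof -
    have "\<bar>n \<bullet> ?T\<bar> \<le> ?r * (K * ?r\<^sup>2)" by (rule order_trans[OF inner_le mult_left_mono[OF T]]) simp
    then show ?thesis by linarith
  qed
  have t2: "- (n \<bullet> (H (Q \<theta>) n - H (q \<theta>) n)) \<le> ?r * (K * ?d * ?r)"
  proof -
    have "norm (H (Q \<theta>) n - H (q \<theta>) n) \<le> K * norm (Q \<theta> - q \<theta>) * ?r" by (rule H_lip) (rule in_ball)+
    also have "\<dots> \<le> K * ?d * ?r" using \<phi>_bd[of \<theta>] K0 by (intro mult_right_mono mult_left_mono) auto
    finally have "\<bar>n \<bullet> (H (Q \<theta>) n - H (q \<theta>) n)\<bar> \<le> ?r * (K * ?d * ?r)"
      by (intro order_trans[OF inner_le mult_left_mono]) auto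
    then show ?thesis by linarith
  qed
  have t3: "n \<bullet> (G (Q \<theta> + n) - G (Q \<theta>)) \<le> ?r * (K * ?r)"
  proof -
    have "norm (G (Q \<theta> + n) - G (Q \<theta>)) \<le> K * ?r" using G_lip[OF in_ball(3)[OF n1] in_ball(2), of \<theta> \<theta>] by simp
    then have "\<bar>n \<bullet> (G (Q \<theta> + n) - G (Q \<theta>))\<bar> \<le> ?r * (K * ?r)"
      by (intro order_trans[OF inner_le mult_left_mono]) auto
    then show ?thesis by linarith
  qed
  define \<alpha> where "\<alpha> = n \<bullet> q' \<theta>"
  define w where "w = n - \<alpha> *\<^sub>R q' \<theta>"
  have q'1: "q' \<theta> \<bullet> q' \<theta> = 1" using q_unit[of \<theta>] by (simp add: norm_eq_1)
  have wq: "w \<bullet> q' \<theta> = 0" by (simp add: w_def \<alpha>_def inner_diff_left q'1)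
  have \<alpha>2: "\<alpha>\<^sup>2 \<le> 4 * C\<^sup>2 * \<delta>\<^sup>2 * ?r\<^sup>2"
  proof -
    have "\<alpha> = - (n \<bullet> (?e - q' \<theta>))" by (simp add: \<alpha>_def inner_diff_right ne)
    then have "\<bar>\<alpha>\<bar> \<le> ?r * norm (?e - q' \<theta>)" using inner_le[of n "?e - q' \<theta>"] by simp
    also have "\<dots> \<le> ?r * (2 * ?d)" using X_close by (intro mult_left_mono) auto
    finally have "\<bar>\<alpha>\<bar>\<^sup>2 \<le> (?r * (2 * ?d))\<^sup>2" by (intro power_mono) auto
    then show ?thesis by (simp add: power_mult_distrib mult_ac)
  qed
  have nw: "n = \<alpha> *\<^sub>R q' \<theta> + w" by (simp add: w_def)
  have wn: "(norm w)\<^sup>2 = ?r\<^sup>2 - \<alpha>\<^sup>2"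
  proof -
    have "n \<bullet> n = \<alpha>\<^sup>2 + w \<bullet> w"
      using wq by (subst (1 2) nw) (simp add: inner_add_left inner_add_right inner_commute q'1 power2_eq_square)
    then show ?thesis by (simp add: power2_norm_eq_inner)
  qed
  have Hn: "H (q \<theta>) n = H (q \<theta>) w"
    using H_lin[of "q \<theta>"] H_q[of \<theta>] by (subst nw) (simp add: linear_add linear_cmul)
  have "n \<bullet> H (q \<theta>) n = H (q \<theta>) w \<bullet> w"
  proof -
    have "n \<bullet> H (q \<theta>) w = \<alpha> * (q' \<theta> \<bullet> H (q \<theta>) w) + w \<bullet> H (q \<theta>) w"
      by (subst nw) (simp add: inner_add_left)
    moreover have "q' \<theta> \<bullet> H (q \<theta>) w = 0" using H_sym[of "q \<theta>" w "q' \<theta>"] H_q by (simp add: inner_commute)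
    ultimately show ?thesis using Hn by (simp add: inner_commute)
  qed
  also have "\<dots> \<ge> lam * (?r\<^sup>2 - \<alpha>\<^sup>2)" using H_pos[OF wq] wn by simp
  finally have t4: "n \<bullet> H (q \<theta>) n \<ge> lam * (?r\<^sup>2 - \<alpha>\<^sup>2)" .
  have t5: "lam * \<alpha>\<^sup>2 \<le> lam * (4 * C\<^sup>2 * \<delta>\<^sup>2 * ?r\<^sup>2)" using \<alpha>2 lam by (intro mult_left_mono) auto
  have nF: "n \<bullet> F (Q \<theta>) = 0" using F_c[of s] n(1) by (simp add: s c_\<sigma>)
  have "n \<bullet> F (c s + n) = n \<bullet> F (c s + n) - n \<bullet> F (Q \<theta>)" using nF by simp
  also have "\<dots> = - (n \<bullet> ?T) - n \<bullet> (H (Q \<theta>) n - H (q \<theta>) n) - n \<bullet> H (q \<theta>) n + \<delta> * (n \<bullet> (G (Q \<theta> + n) - G (Q \<theta>)))"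
    by (simp add: s c_\<sigma> F inner_add_right inner_diff_right right_diff_distrib)
  also have "\<dots> \<le> ?r * (K * ?r\<^sup>2) + ?r * (K * ?d * ?r) - lam * (?r\<^sup>2 - \<alpha>\<^sup>2) + \<delta> * (?r * (K * ?r))"
    using t1 t2 t4 mult_left_mono[OF t3, of \<delta>] \<delta>(1) by linarith
  also have "\<dots> \<le> (r * K + K * C * \<delta> - lam + 4 * lam * C\<^sup>2 * \<delta>\<^sup>2 + K * \<delta>) * ?r\<^sup>2"
  proof -
    have "?r * (K * ?r\<^sup>2) \<le> r * (K * ?r\<^sup>2)" using n(2) K0 by (intro mult_right_mono) auto
    then show ?thesis using t5 by (simp add: power2_eq_square algebra_simps)
  qed
  also have "\<dots> \<le> (- (lam / 2)) * ?r\<^sup>2"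
    by (intro mult_right_mono) (use small in \<open>auto simp: algebra_simps\<close>)
  finally show ?thesis .
qed

lemma b_cont: "continuous_on UNIV b"
proof (rule continuous_on_eq)
  have cont: "continuous_on UNIV c" "continuous_on UNIV c'"
    using c_der c'_der by (meson continuous_at_imp_continuous_on has_vector_derivative_continuous)+
  have c_ball: "c s \<in> cball 0 R" for s using \<sigma>_surj c_\<sigma> in_ball(2) by metis
  have "continuous_on (cball 0 R) gV"
  proof (rule continuous_onI)
    fix x :: 'a and e :: real assume x: "x \<in> cball 0 R" and e: "e > 0"
    define d where "d = min 1 (e / (2 * K))"
    have d: "d > 0" "2 * K * d \<le> e" using e K by (auto simp: d_def min_def field_simps)
    have "dist (gV y) (gV x) \<le> e" if y: "y \<in> cball 0 R" "dist y x < d" for y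
    proof -
      have yx: "norm (y - x) \<le> d" "norm (y - x) \<le> 1" using y(2) by (auto simp: dist_norm d_def)
      have "norm (gV y - gV x) \<le> norm (gV y - gV x - H x (y - x)) + norm (H x (y - x))"
        using norm_triangle_ineq[of "gV y - gV x - H x (y - x)" "H x (y - x)"] by simp
      also have "\<dots> \<le> K * (norm (y - x))\<^sup>2 + K * norm (y - x)" using gT[OF y(1) x] H_bd[OF x] by (intro add_mono)
      also have "\<dots> \<le> K * norm (y - x) + K * norm (y - x)"
        using yx K by (intro add_right_mono mult_left_mono) (auto simp: power2_eq_square mult_left_le)
      also have "\<dots> = 2 * K * norm (y - x)" by simp
      also have "\<dots> \<le> 2 * K * d" using yx K by (intro mult_left_mono) auto
      finally show ?thesis using d by (simp add: dist_norm)
    qed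
    then show "\<exists>d>0. \<forall>y\<in>cball 0 R. dist y x < d \<longrightarrow> dist (gV y) (gV x) \<le> e" using d(1) by blast
  qed
  moreover have "continuous_on (cball 0 R) G"
  proof (rule continuous_onI)
    fix x :: 'a and e :: real assume x: "x \<in> cball 0 R" and e: "e > 0"
    have "dist (G y) (G x) \<le> e" if y: "y \<in> cball 0 R" "dist y x < e / K" for y
    proof -
      have "K * norm (y - x) \<le> e" using y(2) K by (simp add: dist_norm field_simps)
      then show ?thesis using G_lip[OF y(1) x] by (simp add: dist_norm)
    qed
    then show "\<exists>d>0. \<forall>y\<in>cball 0 R. dist y x < d \<longrightarrow> dist (G y) (G x) \<le> e"
      using e K by (intro exI[of _ "e / K"]) auto
  qed
  ultimately show "continuous_on UNIV (\<lambda>s. (- gV (c s) + \<delta> *\<^sub>R G (c s)) \<bullet> c' s)"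
    using c_ball by (intro continuous_intros cont continuous_on_compose2[OF _ cont(1)]) auto
qed (simp add: b_def F)

lemma b_per: "b (s + Ld) = b s"
proof -
  interpret T: tubular_curve c c' c'' Ld "16 * K" "c0 / 4" by (rule tubular) simp
  show ?thesis by (simp add: b_def T.periodic T.periodic')
qed

end

section \<open>The perturbed curve as an instance of the reduced flow\<close>

lemma inner_Lipschitz:
  fixes f g :: "real \<Rightarrow> 'a::real_inner"
  assumes f: "\<And>s. norm (f s) \<le> Bf" "\<And>s t. norm (f s - f t) \<le> Lf * \<bar>s - t\<bar>"
    and g: "\<And>s. norm (g s) \<le> Bg" "\<And>s t. norm (g s - g t) \<le> Lg * \<bar>s - t\<bar>"
  shows "\<bar>f s \<bullet> g s - f t \<bullet> g t\<bar> \<le> (Lf * Bg + Bf * Lg) * \<bar>s - t\<bar>"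
proof -
  have nonneg: "0 \<le> Bf" "0 \<le> Bg" using f(1)[of 0] g(1)[of 0] norm_ge_zero order_trans by blast+
  have "f s \<bullet> g s - f t \<bullet> g t = (f s - f t) \<bullet> g s + f t \<bullet> (g s - g t)"
    by (simp add: inner_diff_left inner_diff_right)
  also have "\<bar>\<dots>\<bar> \<le> \<bar>(f s - f t) \<bullet> g s\<bar> + \<bar>f t \<bullet> (g s - g t)\<bar>" by (rule abs_triangle_ineq)
  also have "\<dots> \<le> norm (f s - f t) * norm (g s) + norm (f t) * norm (g s - g t)"
    by (intro add_mono Cauchy_Schwarz_ineq2)
  also have "\<dots> \<le> (Lf * \<bar>s - t\<bar>) * Bg + Bf * (Lg * \<bar>s - t\<bar>)"
    by (intro add_mono mult_mono f g norm_ge_zero nonneg order_trans[OF norm_ge_zero f(2)])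
  finally show ?thesis by (simp add: algebra_simps)
qed

context curve_data
begin

lemma gV_lip:
  assumes "x \<in> cball 0 R" "y \<in> cball 0 R"
  shows "norm (gV x - gV y) \<le> K * (2 * R + 1) * norm (x - y)"
proof -
  have "norm (x - y) \<le> 2 * R" using assms norm_triangle_ineq4[of x y] by simp
  have "norm (gV x - gV y) \<le> norm (gV x - gV y - H y (x - y)) + norm (H y (x - y))"
    using norm_triangle_ineq[of "gV x - gV y - H y (x - y)" "H y (x - y)"] by simp
  also have "\<dots> \<le> K * (norm (x - y))\<^sup>2 + K * norm (x - y)" using gT[OF assms] H_bd[OF assms(2)] by (intro add_mono)
  also have "\<dots> = K * (norm (x - y) + 1) * norm (x - y)" by (simp add: power2_eq_square algebra_simps)
  also have "\<dots> \<le> K * (2 * R + 1) * norm (x - y)"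
    using K \<open>norm (x - y) \<le> 2 * R\<close> by (intro mult_right_mono mult_left_mono) auto
  finally show ?thesis .
qed

lemma drift_Lipschitz: "\<bar>G (q s) \<bullet> q' s - G (q t) \<bullet> q' t\<bar> \<le> (K * 1 + K * K) * \<bar>s - t\<bar>"
proof (rule inner_Lipschitz)
  have ball: "q s \<in> cball 0 R" for s using q_ball[of s] by simp
  show "norm (G (q s)) \<le> K" for s by (rule G_bd[OF ball])
  show "norm (G (q s) - G (q t)) \<le> K * \<bar>s - t\<bar>" for s t
  proof -
    have "norm (q s - q t) \<le> 1 * \<bar>s - t\<bar>" by (rule bounded_derivative_Lipschitz[OF q_der]) (simp add: q_unit)
    then have "K * norm (q s - q t) \<le> K * \<bar>s - t\<bar>" using K by (intro mult_left_mono) auto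
    then show ?thesis using G_lip[OF ball ball] order_trans by blast
  qed
qed (use q_unit q'_lip in auto)

end

context perturbed_curve
begin

text \<open>The constant may depend on \<open>\<delta>\<close>; it serves the uniqueness of orbits
  in the basin argument.\<close>

lemma b_Lipschitz: "\<exists>B. \<forall>s t. \<bar>b s - b t\<bar> \<le> B * \<bar>s - t\<bar>"
proof -
  have ball: "c s \<in> cball 0 R" for s using \<sigma>_surj c_\<sigma> in_ball(2) by metis
  define LF where "LF = K * (2 * R + 1) + \<delta> * K"
  have R: "R \<ge> 0" using q_ball[of 0] norm_ge_zero[of "q 0"] by linarith
  have lip: "norm (F (c s) - F (c t)) \<le> LF * \<bar>s - t\<bar>" for s t
  proof -
    have "norm (F (c s) - F (c t)) = norm (\<delta> *\<^sub>R (G (c s) - G (c t)) - (gV (c s) - gV (c t)))"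
      by (simp add: F scaleR_diff_right algebra_simps)
    also have "\<dots> \<le> norm (\<delta> *\<^sub>R (G (c s) - G (c t))) + norm (gV (c s) - gV (c t))" by (rule norm_triangle_ineq4)
    also have "\<dots> \<le> \<delta> * (K * norm (c s - c t)) + K * (2 * R + 1) * norm (c s - c t)"
      using G_lip[OF ball ball, of s t] gV_lip[OF ball ball, of s t] \<delta> by (intro add_mono) auto
    also have "\<dots> = LF * norm (c s - c t)" by (simp add: LF_def algebra_simps)
    also have "\<dots> \<le> LF * \<bar>s - t\<bar>"
    proof (rule mult_left_mono)
      have "norm (c s - c t) \<le> 1 * \<bar>s - t\<bar>" by (rule bounded_derivative_Lipschitz[OF c_der]) (simp add: c_unit)
      then show "norm (c s - c t) \<le> \<bar>s - t\<bar>" by simp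
      show "0 \<le> LF" using K \<delta> R by (simp add: LF_def)
    qed
    finally show ?thesis .
  qed
  have bd: "norm (F (c s)) \<le> 7 * K * C\<^sup>2 * \<delta>" for s using b_le[of s] by (simp add: F_c c_unit)
  have "\<bar>F (c s) \<bullet> c' s - F (c t) \<bullet> c' t\<bar> \<le> (LF * 1 + 7 * K * C\<^sup>2 * \<delta> * (16 * K)) * \<bar>s - t\<bar>" for s t
    by (rule inner_Lipschitz) (use bd lip c_unit c'_lip in auto)
  then show ?thesis unfolding b_def by blast
qed

text \<open>Near both ends the unperturbed drift has size at least \<open>m\<close>, so
  \<open>\<Phi>\<close> gains at least \<open>m * h * \<delta>\<close> over each prolongation of
  length \<open>h\<close>. The factor \<open>1 - N * \<delta>\<^sup>2\<close> takes back at most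
  half of this, which leaves the gap \<open>m * h * \<delta> / 2\<close>. \<open>C0\<close> makes
  the lateral barrier exceed an upper bound for \<open>S\<close> plus the gap.\<close>

lemma reduced_flow_instance:
  fixes \<Delta>1 \<Delta>2 h m K1 M \<mu> N C0 CA \<theta>0 :: real
  assumes pos: "\<Delta>1 > 0" "\<Delta>2 > 0" "h > 0" "m > 0" "C0 > 0" and K1: "K1 \<ge> 16 * K"
    and \<beta>_hi: "\<And>\<theta>. \<bar>\<theta> - (\<theta>0 + \<Delta>2)\<bar> \<le> 2 * h \<Longrightarrow> G (q \<theta>) \<bullet> q' \<theta> \<le> - m"
    and \<beta>_lo: "\<And>\<theta>. \<bar>\<theta> - (\<theta>0 - \<Delta>1)\<bar> \<le> 2 * h \<Longrightarrow> G (q \<theta>) \<bullet> q' \<theta> \<ge> m"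
    and \<theta>A: "\<bar>\<theta>A - \<theta>0\<bar> \<le> CA * \<delta>"
    and b_hi: "\<And>s. a < s \<Longrightarrow> s \<le> a + \<Delta>2 \<Longrightarrow> b s < 0" and b_lo: "\<And>s. a - \<Delta>1 \<le> s \<Longrightarrow> s < a \<Longrightarrow> b s > 0"
    and M: "M = 7 * K * C\<^sup>2" and \<mu>: "\<mu> = lam / 2" and N: "N = 9 / 4 * (8 * K1 * M + 4 * M)\<^sup>2 / \<mu>\<^sup>2"
    and C0: "\<mu> / 2 * C0\<^sup>2 = 2 * M * (\<Delta>1 + \<Delta>2) + m * h"
    and s1: "C0 * sqrt \<delta> < c0 / (64 * K1)"
    and s2: "4 * lam * C\<^sup>2 * \<delta>\<^sup>2 + K * C * \<delta> + K * \<delta> + K * (C0 * sqrt \<delta>) \<le> lam / 2"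
    and s3: "16 * M\<^sup>2 * \<delta> \<le> \<mu>\<^sup>2" and s4: "N * \<delta>\<^sup>2 \<le> 1 / 2"
    and s5: "\<Delta>1 + \<Delta>2 + 2 * h + 1 / (4 * K1) < L - C * \<delta> * L"
    and s6: "C * \<delta> * (2 * (\<Delta>1 + \<Delta>2 + h)) + CA * \<delta> \<le> h"
    and s7: "6 * K * C\<^sup>2 * \<delta> \<le> m / 2"
    and s8: "4 * N * M * (\<Delta>1 + \<Delta>2 + h) * \<delta>\<^sup>2 \<le> m * h"
  obtains \<Phi> S where "reduced_flow c c' c'' Ld K1 (c0 / 4) F b \<Phi> M \<delta> \<mu> (C0 * sqrt \<delta>) (N * \<delta>\<^sup>2) a
      (a - \<Delta>1) (a + \<Delta>2) (a - \<Delta>1 - h) (a + \<Delta>2 + h) S (m * h * \<delta> / 2)"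
proof -
  have tub: "tubular_curve c c' c'' Ld K1 (c0 / 4)" by (rule tubular[OF K1])
  interpret T: tubular_curve c c' c'' Ld K1 "c0 / 4" by (rule tub)
  define \<rho> where "\<rho> = C0 * sqrt \<delta>"
  have M0: "M > 0" using K C by (simp add: M)
  have \<mu>0: "\<mu> > 0" using lam by (simp add: \<mu>)
  \<comment> \<open>The radius for chord-arc constant \<open>c0 / 4\<close> and curvature bound
    \<open>K1\<close>, that is \<open>c0 / 4 * (1 / (4 * K1)) / 4\<close>.\<close>
  have r0: "T.r0 = c0 / (64 * K1)" by (simp add: T.r0_def T.r1_def)
  have \<rho>: "0 < \<rho>" "\<rho> < T.r0" using pos \<delta> s1 r0 by (auto simp: \<rho>_def)
  have "\<rho> \<le> 1"
  proof -
    have "T.r0 \<le> K1 * T.r0" using T.K T.r0(1) by simp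
    then show ?thesis using \<rho> T.r0(3) by linarith
  qed
  obtain \<Phi>0 where "\<And>s. (\<Phi>0 has_real_derivative - 2 * b s) (at s)"
  proof -
    have "continuous_on UNIV (\<lambda>s. - 2 * b s)" by (intro continuous_intros b_cont)
    then show thesis by (rule continuous_antiderivative) (rule that)
  qed
  define \<Phi> where "\<Phi> s = \<Phi>0 s - \<Phi>0 a" for s
  have \<Phi>: "(\<Phi> has_real_derivative - 2 * b s) (at s)" "\<Phi> a = 0" for s
    unfolding \<Phi>_def using \<open>\<And>s. (\<Phi>0 has_real_derivative - 2 * b s) (at s)\<close>
    by (auto intro!: derivative_eq_intros)
  \<comment> \<open>Continuity forces a zero between the opposite signs on the two sides.\<close>
  have ba: "b a = 0"
  proof -
    have "isCont b a" using b_cont by (simp add: continuous_on_eq_continuous_at)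
    then have lim: "(b \<longlongrightarrow> b a) (at_right a)" "(b \<longlongrightarrow> b a) (at_left a)"
      by (auto simp: isCont_def filterlim_at_split)
    have "\<forall>\<^sub>F s in at_right a. b s \<le> 0"
      using b_hi pos by (auto simp: eventually_at_right_field less_imp_le intro!: exI[of _ "a + \<Delta>2"])
    then have "b a \<le> 0" using lim(1) tendsto_upperbound by fastforce
    moreover have "\<forall>\<^sub>F s in at_left a. b s \<ge> 0"
      using b_lo pos by (auto simp: eventually_at_left_field less_imp_le intro!: exI[of _ "a - \<Delta>1"])
    then have "b a \<ge> 0" using lim(2) tendsto_lowerbound by fastforce
    ultimately show ?thesis by simp
  qed
  \<comment> \<open>Arclength differs from \<open>\<theta>\<close>, and \<open>\<theta>A\<close>
    from \<open>\<theta>0\<close>, by order \<open>\<delta>\<close>; \<open>s6\<close> bounds the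
    total discrepancy by \<open>h\<close>. Together with the prolongation \<open>h\<close> this
    explains the tolerance \<open>2 * h\<close> in \<open>\<beta>_hi\<close> and
    \<open>\<beta>_lo\<close>.\<close>
  have near: "\<bar>(\<theta> - \<theta>0) - (\<sigma> \<theta> - a)\<bar> \<le> h" if "\<bar>\<sigma> \<theta> - a\<bar> \<le> \<Delta>1 + \<Delta>2 + h" for \<theta>
  proof -
    have "\<bar>\<theta> - \<theta>A\<bar> \<le> 2 * (\<Delta>1 + \<Delta>2 + h)" 
      by (rule order_trans[OF \<sigma>_bounds(2)[of \<theta> \<theta>A, unfolded \<sigma>(2)] mult_left_mono[OF that]]) simp
    then have "C * \<delta> * \<bar>\<theta> - \<theta>A\<bar> \<le> C * \<delta> * (2 * (\<Delta>1 + \<Delta>2 + h))" using C\<delta> by (intro mult_left_mono) auto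
    then have "\<bar>\<sigma> \<theta> - a - (\<theta> - \<theta>A)\<bar> \<le> C * \<delta> * (2 * (\<Delta>1 + \<Delta>2 + h))"
      using \<sigma>_close[of \<theta> \<theta>A] \<sigma>(2) by simp
    then show ?thesis using \<theta>A s6 by (smt (verit))
  qed
  have err: "6 * K * C\<^sup>2 * \<delta>\<^sup>2 \<le> m * \<delta> / 2"
    using mult_right_mono[OF s7, of \<delta>] \<delta>(1) by (simp add: power2_eq_square)
  have b_far_hi: "b s \<le> - (m * \<delta> / 2)" if s: "a + \<Delta>2 \<le> s" "s \<le> a + \<Delta>2 + h" for s
  proof -
    obtain \<theta> where \<theta>: "s = \<sigma> \<theta>" by (rule \<sigma>_surj)
    have "\<bar>\<sigma> \<theta> - a\<bar> \<le> \<Delta>1 + \<Delta>2 + h" using s pos \<theta> by auto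
    from near[OF this] have "\<bar>\<theta> - (\<theta>0 + \<Delta>2)\<bar> \<le> 2 * h" using s \<theta> by (smt (verit))
    then have "\<delta> * (G (q \<theta>) \<bullet> q' \<theta>) \<le> \<delta> * (- m)" using \<beta>_hi \<delta> by (intro mult_left_mono) auto
    then have "b s \<le> - (m * \<delta>) + 6 * K * C\<^sup>2 * \<delta>\<^sup>2" using b_close[of \<theta>] unfolding \<theta>
      by (simp add: abs_le_iff algebra_simps)
    then show ?thesis using err by simp
  qed
  have b_far_lo: "b s \<ge> m * \<delta> / 2" if s: "a - \<Delta>1 - h \<le> s" "s \<le> a - \<Delta>1" for s
  proof -
    obtain \<theta> where \<theta>: "s = \<sigma> \<theta>" by (rule \<sigma>_surj)
    have "\<bar>\<sigma> \<theta> - a\<bar> \<le> \<Delta>1 + \<Delta>2 + h" using s pos \<theta> by auto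
    from near[OF this] have "\<bar>\<theta> - (\<theta>0 - \<Delta>1)\<bar> \<le> 2 * h" using s \<theta> by (smt (verit))
    then have "\<delta> * (G (q \<theta>) \<bullet> q' \<theta>) \<ge> \<delta> * m" using \<beta>_lo \<delta> by (intro mult_left_mono) auto
    then have "b s \<ge> m * \<delta> - 6 * K * C\<^sup>2 * \<delta>\<^sup>2" using b_close[of \<theta>] unfolding \<theta>
      by (simp add: abs_le_iff algebra_simps)
    then show ?thesis using err by simp
  qed
  have m\<delta>: "m * \<delta> > 0" using pos \<delta> by simp
  have b_right: "b s \<le> 0" if "a \<le> s" "s \<le> a + \<Delta>2 + h" for s
  proof -
    consider "s = a" | "a < s" "s \<le> a + \<Delta>2" | "a + \<Delta>2 \<le> s" using \<open>a \<le> s\<close> by linarith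
    then show ?thesis using ba b_hi[of s] b_far_hi[of s] that m\<delta> by cases auto
  qed
  have b_left: "b s \<ge> 0" if "a - \<Delta>1 - h \<le> s" "s \<le> a" for s
  proof -
    consider "s = a" | "a - \<Delta>1 \<le> s" "s < a" | "s \<le> a - \<Delta>1" using \<open>s \<le> a\<close> by linarith
    then show ?thesis using ba b_lo[of s] b_far_lo[of s] that m\<delta> by cases auto
  qed
  have \<Phi>_nonneg: "\<Phi> s \<ge> 0" if s: "a - \<Delta>1 - h \<le> s" "s \<le> a + \<Delta>2 + h" for s
  proof (cases "a \<le> s")
    case True
    have "\<Phi> a \<le> \<Phi> s"
    proof (rule DERIV_nonneg_imp_nondecreasing[OF True, where f=\<Phi>])
      fix x assume "a \<le> x" "x \<le> s"
      then show "\<exists>y. (\<Phi> has_real_derivative y) (at x) \<and> 0 \<le> y"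
        using \<Phi>(1) b_right[of x] s by (intro exI[of _ "- 2 * b x"]) auto
    qed
    then show ?thesis using \<Phi>(2) by simp
  next
    case False
    have "\<Phi> a \<le> \<Phi> s"
    proof (rule DERIV_nonpos_imp_nonincreasing[where a=s and b=a and f=\<Phi>])
      show "s \<le> a" using False by simp
      fix x assume "s \<le> x" "x \<le> a"
      then show "\<exists>y. (\<Phi> has_real_derivative y) (at x) \<and> y \<le> 0"
        using \<Phi>(1) b_left[of x] s by (intro exI[of _ "- 2 * b x"]) auto
    qed
    then show ?thesis using \<Phi>(2) by simp
  qed
  define S where "S = min (\<Phi> (a - \<Delta>1)) (\<Phi> (a + \<Delta>2))"
  have \<Phi>_le: "\<Phi> s \<le> 2 * M * \<delta> * \<bar>s - a\<bar>" for s
  proof -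
    have "norm (\<Phi> s - \<Phi> a) \<le> (2 * (M * \<delta>)) * \<bar>s - a\<bar>"
    proof (rule bounded_derivative_Lipschitz)
      show "(\<Phi> has_vector_derivative - 2 * b s) (at s)" for s
        using \<Phi>(1) by (simp add: has_real_derivative_iff_has_vector_derivative)
      show "norm (- 2 * b s) \<le> 2 * (M * \<delta>)" for s using b_le[of s] by (simp add: M abs_mult mult_ac)
    qed
    then show ?thesis using \<Phi>(2) by (simp add: mult.assoc)
  qed
  have N0: "N \<ge> 0" using \<mu>0 by (simp add: N)
  have loss: "N * \<delta>\<^sup>2 * \<Phi> s \<le> m * h * \<delta> / 2" if s: "a - \<Delta>1 - h \<le> s" "s \<le> a + \<Delta>2 + h" for s
  proof -
    have "\<Phi> s \<le> 2 * M * \<delta> * (\<Delta>1 + \<Delta>2 + h)"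
      by (rule order_trans[OF \<Phi>_le mult_left_mono]) (use s pos M0 \<delta> in auto)
    then have "N * \<delta>\<^sup>2 * \<Phi> s \<le> N * \<delta>\<^sup>2 * (2 * M * \<delta> * (\<Delta>1 + \<Delta>2 + h))" using N0 by (intro mult_left_mono) auto
    also have "\<dots> = (4 * N * M * (\<Delta>1 + \<Delta>2 + h) * \<delta>\<^sup>2) * (\<delta> / 2)" by simp
    also have "\<dots> \<le> m * h * (\<delta> / 2)" using s8 \<delta> by (intro mult_right_mono) auto
    finally show ?thesis by simp
  qed
  have "reduced_flow c c' c'' Ld K1 (c0 / 4) F b \<Phi> M \<delta> \<mu> \<rho> (N * \<delta>\<^sup>2) a
      (a - \<Delta>1) (a + \<Delta>2) (a - \<Delta>1 - h) (a + \<Delta>2 + h) S (m * h * \<delta> / 2)"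
  proof (intro reduced_flow.intro[OF tub] reduced_flow_axioms.intro)
    show "F (c s) = b s *\<^sub>R c' s" for s by (rule F_c)
    show "continuous_on UNIV b" by (rule b_cont)
    show "\<bar>b s\<bar> \<le> M * \<delta>" for s using b_le by (simp add: M)
    show "\<bar>F Z \<bullet> c' s - b s\<bar> \<le> M * (\<delta> * norm (Z - c s) + (norm (Z - c s))\<^sup>2)"
      if "T.foot Z s" "norm (Z - c s) \<le> \<rho>" for Z s
      using tangential[of "Z - c s" s] that \<open>\<rho> \<le> 1\<close> by (simp add: M T.foot_def)
    show "(Z - c s) \<bullet> F Z \<le> - \<mu> * (norm (Z - c s))\<^sup>2"
      if "T.foot Z s" "norm (Z - c s) \<le> \<rho>" for Z s
      using normal[of "Z - c s" s \<rho>] that \<open>\<rho> \<le> 1\<close> s2 by (simp add: \<mu> \<rho>_def T.foot_def)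
    show "N * \<delta>\<^sup>2 = 9 / 4 * (8 * K1 * M + 4 * M)\<^sup>2 * \<delta>\<^sup>2 / \<mu>\<^sup>2" by (simp add: N)
    show "(a + \<Delta>2 + h) - (a - \<Delta>1 - h) + T.r1 < Ld"
      using s5 Ld_close by (simp add: T.r1_def)
    show "S + m * h * \<delta> / 2 \<le> (1 - N * \<delta>\<^sup>2) * \<Phi> (a - \<Delta>1 - h)"
    proof -
      have "\<exists>z>a - \<Delta>1 - h. z < a - \<Delta>1 \<and> \<Phi> (a - \<Delta>1) - \<Phi> (a - \<Delta>1 - h) = (a - \<Delta>1 - (a - \<Delta>1 - h)) * (- 2 * b z)"
        by (rule MVT2) (use pos \<Phi>(1) in auto)
      then obtain z where z: "a - \<Delta>1 - h < z" "z < a - \<Delta>1" "\<Phi> (a - \<Delta>1 - h) = \<Phi> (a - \<Delta>1) + h * (2 * b z)" by auto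
      have "h * (m * \<delta>) \<le> h * (2 * b z)" using b_far_lo[of z] z pos by (intro mult_left_mono) auto
      moreover have "h * (m * \<delta>) = m * h * \<delta>" by simp
      moreover have "S \<le> \<Phi> (a - \<Delta>1)" by (simp add: S_def)
      moreover have "(1 - N * \<delta>\<^sup>2) * \<Phi> (a - \<Delta>1 - h) = \<Phi> (a - \<Delta>1 - h) - N * \<delta>\<^sup>2 * \<Phi> (a - \<Delta>1 - h)"
        by (simp add: left_diff_distrib)
      moreover have "N * \<delta>\<^sup>2 * \<Phi> (a - \<Delta>1 - h) \<le> m * h * \<delta> / 2" using pos by (intro loss) auto
      ultimately show ?thesis using z(3) by linarith
    qed
    show "S + m * h * \<delta> / 2 \<le> (1 - N * \<delta>\<^sup>2) * \<Phi> (a + \<Delta>2 + h)"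
    proof -
      have "\<exists>z>a + \<Delta>2. z < a + \<Delta>2 + h \<and> \<Phi> (a + \<Delta>2 + h) - \<Phi> (a + \<Delta>2) = (a + \<Delta>2 + h - (a + \<Delta>2)) * (- 2 * b z)"
        by (rule MVT2) (use pos \<Phi>(1) in auto)
      then obtain z where z: "a + \<Delta>2 < z" "z < a + \<Delta>2 + h" "\<Phi> (a + \<Delta>2 + h) = \<Phi> (a + \<Delta>2) + h * (- 2 * b z)" by auto
      have "h * (m * \<delta>) \<le> h * (- 2 * b z)" using b_far_hi[of z] z pos by (intro mult_left_mono) auto
      moreover have "h * (m * \<delta>) = m * h * \<delta>" by simp
      moreover have "S \<le> \<Phi> (a + \<Delta>2)" by (simp add: S_def)
      moreover have "(1 - N * \<delta>\<^sup>2) * \<Phi> (a + \<Delta>2 + h) = \<Phi> (a + \<Delta>2 + h) - N * \<delta>\<^sup>2 * \<Phi> (a + \<Delta>2 + h)"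
        by (simp add: left_diff_distrib)
      moreover have "N * \<delta>\<^sup>2 * \<Phi> (a + \<Delta>2 + h) \<le> m * h * \<delta> / 2" using pos by (intro loss) auto
      ultimately show ?thesis using z(3) by linarith
    qed
    show "S + m * h * \<delta> / 2 \<le> \<mu> / 2 * \<rho>\<^sup>2"
    proof -
      \<comment> \<open>The potential at either end bounds the minimum \<open>S\<close>; the right
        end is used.\<close>
      have "S \<le> 2 * M * \<delta> * \<Delta>2" using \<Phi>_le[of "a + \<Delta>2"] pos by (simp add: S_def min_le_iff_disj)
      also have "\<dots> \<le> 2 * M * \<delta> * (\<Delta>1 + \<Delta>2)" using M0 \<delta> pos by (intro mult_left_mono) auto
      finally have "S + m * h * \<delta> / 2 \<le> (2 * M * (\<Delta>1 + \<Delta>2) + m * h) * \<delta>"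
        using m\<delta> pos mult_pos_pos[OF \<open>h > 0\<close> m\<delta>] by (simp add: algebra_simps)
      also have "\<dots> = \<mu> / 2 * \<rho>\<^sup>2" unfolding C0[symmetric] using \<delta> by (simp add: \<rho>_def power_mult_distrib)
      finally show ?thesis .
    qed
  qed (use \<rho> M0 \<mu>0 \<delta> s3 s4 \<Phi> pos b_left b_right \<Phi>_nonneg S_def in auto)
  then show thesis unfolding \<rho>_def by (rule that)
qed

end

section \<open>Constants extracted from the hypotheses\<close>

lemma curve_data_exists:
  fixes V :: "real^'n \<Rightarrow> real" and G :: "real^'n \<Rightarrow> real^'n" and q :: "real \<Rightarrow> real^'n"
  assumes V: "C_k 4 V" and G: "C_k 2 G"
    and q: "unit_speed_closed_curve 3 L q"
    and V_on_M: "\<forall>x\<in>range q. V x = 0 \<and> grad V x = 0"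
    and lam: "lam > 0"
    and hess: "\<forall>\<theta>. (\<forall>v\<in>span {velocity q \<theta>}. hessian V (q \<theta>) *v v = 0) \<and>
        (\<forall>w. w \<bullet> velocity q \<theta> = 0 \<longrightarrow> (hessian V (q \<theta>) *v w) \<bullet> w \<ge> lam * (norm w)\<^sup>2)"
  obtains K R c0 where
    "curve_data (grad V) G (\<lambda>x. frechet_derivative (grad V) (at x)) q (velocity q) L lam K R c0"
proof -
  let ?H = "\<lambda>x. frechet_derivative (grad V) (at x)"
  have V4: "C_k (Suc (Suc (Suc (Suc 0)))) V" using V by (simp add: eval_nat_numeral del: C_k.simps)
  have gV: "C_k (Suc (Suc 0)) (grad V)" using C_k_le[OF C_k_grad(2)[OF V4], of "Suc (Suc 0)"] by (simp del: C_k.simps)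
  have G2: "C_k (Suc (Suc 0)) G" using G by (simp add: eval_nat_numeral del: C_k.simps)
  have G1: "C_k (Suc 0) G" using C_k_Suc_imp[OF G2] .
  have L: "L > 0" and q3: "C_k (Suc (Suc (Suc 0))) q" and per: "\<And>s. q (s + L) = q s" and unit: "\<And>s. norm (velocity q s) = 1"
    using q unfolding unit_speed_closed_curve_def by (auto simp: eval_nat_numeral simp del: C_k.simps)
  have der: "(q has_vector_derivative velocity q s) (at s)" for s using C_k_curve(1)[OF q3] .
  have q2: "C_k (Suc (Suc 0)) (velocity q)" using C_k_curve(2)[OF q3] .
  have der': "(velocity q has_vector_derivative velocity (velocity q) s) (at s)" for s using C_k_curve(1)[OF q2] .
  have per': "velocity q (s + L) = velocity q s" for s using velocity_periodic[OF per der] .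
  obtain Kq where Kq: "Kq > 0" "\<And>s. norm (velocity (velocity q) s) \<le> Kq"
    by (rule periodic_bounded[of "velocity (velocity q)" L])
       (use velocity_periodic[OF per' der'] L C_k_imp_continuous_on[OF C_k_curve(2)[OF q2]] in auto)
  obtain B where B: "B > 0" "\<And>s. norm (q s) \<le> B"
    by (rule periodic_bounded[of q L]) (use per L C_k_imp_continuous_on[OF q3] in auto)
  obtain c1 where c1: "c1 > 0" "\<And>s s'. \<exists>k::int. c1 * \<bar>s - s' - of_int k * L\<bar> \<le> norm (q s - q s')"
    by (rule unit_speed_curve_separated[OF q]) auto
  define c0 where "c0 = min c1 1"
  define R where "R = B + 2"
  have R: "R \<ge> 0" using B by (simp add: R_def)
  obtain K1 where K1: "K1 \<ge> 0" "\<And>x y. x \<in> cball 0 R \<Longrightarrow> y \<in> cball 0 R \<Longrightarrow>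
      norm (grad V x - grad V y - ?H y (x - y)) \<le> K1 * (norm (x - y))\<^sup>2"
    by (rule C_2_Taylor_on_cball[OF gV, of R]) blast
  obtain K2 where K2: "K2 \<ge> 0" "\<And>x y v. x \<in> cball 0 R \<Longrightarrow> y \<in> cball 0 R \<Longrightarrow>
      norm (?H x v - ?H y v) \<le> K2 * norm (x - y) * norm v"
    by (rule C_2_derivative_Lipschitz_on_cball[OF gV, of R]) blast
  obtain K3 where K3: "K3 \<ge> 0" "\<And>x y. x \<in> cball 0 R \<Longrightarrow> y \<in> cball 0 R \<Longrightarrow> norm (G x - G y) \<le> K3 * norm (x - y)"
    by (rule C_1_Lipschitz_on_cball[OF G1, of R]) blast
  obtain K4 where K4: "K4 \<ge> 0" "\<And>x. x \<in> cball 0 R \<Longrightarrow> norm (G x) \<le> K4"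
    by (rule continuous_bounded_on_cball[OF C_k_imp_continuous_on[OF G1], of R]) blast
  have lin: "linear (?H x)" for x using C_k_Suc_has_derivative[OF gV] has_derivative_linear by blast
  \<comment> \<open>An operator bound at the origin plus the Lipschitz growth over the ball.\<close>
  define K5 where "K5 = (\<Sum>i\<in>Basis. norm (?H 0 i)) + K2 * R"
  have K5: "K5 \<ge> 0" unfolding K5_def using K2 R by (simp add: sum_nonneg)
  have H5: "norm (?H x v) \<le> K5 * norm v" if x: "x \<in> cball 0 R" for x v
  proof -
    have "norm (?H x v) \<le> norm (?H 0 v) + norm (?H x v - ?H 0 v)"
      using norm_triangle_ineq[of "?H 0 v" "?H x v - ?H 0 v"] by simp
    also have "\<dots> \<le> (\<Sum>i\<in>Basis. norm (?H 0 i)) * norm v + K2 * norm (x - 0) * norm v"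
      using norm_linear_le_sum_Basis[OF lin[of 0], of v] K2(2)[of x 0 v] x R by (intro add_mono) auto
    also have "\<dots> \<le> (\<Sum>i\<in>Basis. norm (?H 0 i)) * norm v + K2 * R * norm v"
      using x K2(1) by (intro add_left_mono mult_right_mono mult_left_mono) auto
    finally show ?thesis by (simp add: K5_def distrib_right)
  qed
  define K where "K = 1 + Kq + K1 + K2 + K3 + K4 + K5"
  have KK: "1 \<le> K" "Kq \<le> K" "K1 \<le> K" "K2 \<le> K" "K3 \<le> K" "K4 \<le> K" "K5 \<le> K"
    unfolding K_def using Kq(1) K1(1) K2(1) K3(1) K4(1) K5 by linarith+
  have hm: "hessian V x *v v = ?H x v" for x v by (rule hessian_mult[OF V4])
  have "curve_data (grad V) G ?H q (velocity q) L lam K R c0"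
  proof (intro curve_data.intro)
    show "norm (velocity q s - velocity q t) \<le> K * \<bar>s - t\<bar>" for s t
    proof -
      have "Kq * \<bar>s - t\<bar> \<le> K * \<bar>s - t\<bar>" using KK by (intro mult_right_mono) auto
      then show ?thesis using bounded_derivative_Lipschitz[OF der' Kq(2), of s t] by simp
    qed
    show "\<exists>k::int. c0 * \<bar>s - t - of_int k * L\<bar> \<le> norm (q s - q t)" for s t
    proof -
      obtain k :: int where k: "c1 * \<bar>s - t - of_int k * L\<bar> \<le> norm (q s - q t)" using c1(2) by blast
      have "c0 * \<bar>s - t - of_int k * L\<bar> \<le> c1 * \<bar>s - t - of_int k * L\<bar>" by (intro mult_right_mono) (auto simp: c0_def)
      then show ?thesis using k order_trans by blast
    qed
    show "norm (grad V x - grad V y - ?H y (x - y)) \<le> K * (norm (x - y))\<^sup>2" if "x \<in> cball 0 R" "y \<in> cball 0 R" for x y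
      by (rule order_trans[OF K1(2)[OF that] mult_right_mono]) (use KK in auto)
    show "norm (?H x v) \<le> K * norm v" if "x \<in> cball 0 R" for x v
      by (rule order_trans[OF H5[OF that] mult_right_mono]) (use KK in auto)
    show "norm (?H x v - ?H y v) \<le> K * norm (x - y) * norm v" if "x \<in> cball 0 R" "y \<in> cball 0 R" for x y v
      by (rule order_trans[OF K2(2)[OF that] mult_right_mono[OF mult_right_mono]]) (use KK in auto)
    show "norm (G x) \<le> K" if "x \<in> cball 0 R" for x using K4(2)[OF that] KK by simp
    show "norm (G x - G y) \<le> K * norm (x - y)" if "x \<in> cball 0 R" "y \<in> cball 0 R" for x y
      by (rule order_trans[OF K3(2)[OF that] mult_right_mono]) (use KK in auto)
    show "?H x v \<bullet> w = ?H x w \<bullet> v" for x v w by (rule second_derivative_symmetric[OF V4])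
    show "?H (q s) (velocity q s) = 0" for s
      using hess hm[of "q s" "velocity q s"] span_base[of "velocity q s" "{velocity q s}"] by auto
    show "lam * (norm w)\<^sup>2 \<le> ?H (q s) w \<bullet> w" if "w \<bullet> velocity q s = 0" for w s
    proof -
      have "lam * (norm w)\<^sup>2 \<le> (hessian V (q s) *v w) \<bullet> w" using hess that by blast
      then show ?thesis unfolding hm .
    qed
    show "grad V (q s) = 0" for s using V_on_M by blast
  qed (use L per per' der unit c1 KK B lin lam in \<open>auto simp: c0_def R_def\<close>)
  then show thesis by (rule that)
qed

lemma unit_speed_reparametrization_perturbed_curve:
  fixes V :: "real^'n \<Rightarrow> real" and G :: "real^'n \<Rightarrow> real^'n"
    and q \<phi> c :: "real \<Rightarrow> real^'n"
  assumes data: "curve_data (grad V) G (\<lambda>x. frechet_derivative (grad V) (at x)) q (velocity q) L lam K R c0"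
    and C: "C \<ge> 1" and \<delta>: "0 < \<delta>" "C * \<delta> \<le> c0 / 2"
    and \<phi>: "C_k 2 \<phi>" "\<forall>\<theta>. \<phi> (\<theta> + L) = \<phi> \<theta>"
        "stable_normally_hyperbolic (perturbed_field V G \<delta>) (\<lambda>\<theta>. q \<theta> + \<phi> \<theta>)"
    and \<phi>_small: "\<forall>\<theta>. norm (\<phi> \<theta>) \<le> C * \<delta> \<and>
        norm (velocity \<phi> \<theta>) \<le> C * \<delta> \<and> norm (velocity (velocity \<phi>) \<theta>) \<le> C * \<delta>"
    and c: "unit_speed_reparametrization L (\<lambda>\<theta>. q \<theta> + \<phi> \<theta>) Ld c"
    and base: "c a = q \<theta>A + \<phi> \<theta>A"
  shows "perturbed_curve (grad V) G (\<lambda>x. frechet_derivative (grad V) (at x)) q (velocity q) L lam K R c0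
    \<delta> C \<theta>A a \<phi> (velocity \<phi>) c (velocity c) (velocity (velocity c)) Ld (perturbed_field V G \<delta>)"
proof -
  interpret D: curve_data "grad V" G "\<lambda>x. frechet_derivative (grad V) (at x)" q "velocity q" L lam K R c0
    by (rule data)
  have \<phi>2: "C_k (Suc (Suc 0)) \<phi>" using \<phi>(1) by (simp add: eval_nat_numeral del: C_k.simps)
  have \<phi>_der: "(\<phi> has_vector_derivative velocity \<phi> s) (at s)" for s using C_k_curve(1)[OF \<phi>2] .
  have \<phi>'_der: "(velocity \<phi> has_vector_derivative velocity (velocity \<phi>) s) (at s)" for s
    using C_k_curve(1)[OF C_k_curve(2)[OF \<phi>2]] .
  have vQ: "velocity (\<lambda>\<theta>. q \<theta> + \<phi> \<theta>) s = velocity q s + velocity \<phi> s" for s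
    by (rule vector_derivative_at) (intro has_vector_derivative_add D.q_der \<phi>_der)
  have Ld: "Ld = curve_length L (\<lambda>\<theta>. q \<theta> + \<phi> \<theta>)" and usc: "unit_speed_closed_curve 2 Ld c"
    and rng: "range c = range (\<lambda>\<theta>. q \<theta> + \<phi> \<theta>)"
    and orient: "\<And>s s'. q s + \<phi> s = c s' \<Longrightarrow> velocity (\<lambda>\<theta>. q \<theta> + \<phi> \<theta>) s \<bullet> velocity c s' > 0"
    using c unfolding unit_speed_reparametrization_def by auto
  have Ld0: "Ld > 0" and c2: "C_k (Suc (Suc 0)) c" and c_per: "\<And>s. c (s + Ld) = c s" and c_unit: "\<And>s. norm (velocity c s) = 1"
    using usc unfolding unit_speed_closed_curve_def by (auto simp: eval_nat_numeral simp del: C_k.simps)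
  have inv: "flow_invariant (perturbed_field V G \<delta>) (range c)"
    using \<phi>(3) unfolding stable_normally_hyperbolic_def rng by blast
  show ?thesis
  proof (intro perturbed_curve.intro[OF data] perturbed_curve_axioms.intro)
    show "velocity \<phi> (s + L) = velocity \<phi> s" for s by (rule velocity_periodic[OF _ \<phi>_der]) (use \<phi>(2) in blast)
    show "norm (velocity \<phi> s - velocity \<phi> t) \<le> C * \<delta> * \<bar>s - t\<bar>" for s t
      by (rule bounded_derivative_Lipschitz[OF \<phi>'_der]) (use \<phi>_small in blast)
    show "(c has_vector_derivative velocity c s) (at s)" for s using C_k_curve(1)[OF c2] .
    show "(velocity c has_vector_derivative velocity (velocity c) s) (at s)" for s
      using C_k_curve(1)[OF C_k_curve(2)[OF c2]] .
    show "Ld = integral {0..L} (\<lambda>\<theta>. norm (velocity q \<theta> + velocity \<phi> \<theta>))"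
      unfolding Ld curve_length_def vQ ..
    show "0 < (velocity q \<theta> + velocity \<phi> \<theta>) \<bullet> velocity c s" if "q \<theta> + \<phi> \<theta> = c s" for \<theta> s
      using orient[OF that] unfolding vQ .
    show "perturbed_field V G \<delta> x = - grad V x + \<delta> *\<^sub>R G x" for x by (simp add: perturbed_field_def)
    show "\<exists>u. (u has_vector_derivative perturbed_field V G \<delta> x) (at 0) \<and> u 0 = x \<and> range u \<subseteq> range c"
      if "x \<in> range c" for x
      using inv that unfolding flow_invariant_def solves_def by (metis UNIV_I)
  qed (use C \<delta> \<phi>(2) \<phi>_small \<phi>_der Ld0 c_per c_unit rng base in auto)
qed

lemma eventually_at_right_0_less:
  fixes f :: "real \<Rightarrow> real"
  assumes "(f \<longlongrightarrow> l) (at_right 0)" "l < e"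
  shows "\<forall>\<^sub>F \<delta> in at_right 0. f \<delta> < e"
  using order_tendstoD(2)[OF assms] .

text \<open>\<open>enn2real\<close> sends infinity to 0, so finiteness of both quasipotentials is
  asserted along with the estimate.\<close>

theorem theorem1p1:
  fixes V :: "real^'n \<Rightarrow> real" and G :: "real^'n \<Rightarrow> real^'n"
    and q :: "real \<Rightarrow> real^'n" and L lam \<theta>0 \<Delta>1 \<Delta>2 :: real
    and \<phi> q\<^sub>\<delta> :: "real \<Rightarrow> real \<Rightarrow> real^'n"
    and L\<^sub>\<delta> \<theta>A \<phi>A :: "real \<Rightarrow> real" and A :: "real \<Rightarrow> real^'n"
  assumes V: "C_k 4 V" and G: "C_k 2 G"
    and q: "unit_speed_closed_curve 3 L q"
    and V_on_M: "\<forall>x\<in>range q. V x = 0 \<and> grad V x = 0"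
    and lam: "lam > 0"
    and hess: "\<forall>\<theta>. (\<forall>v\<in>span {velocity q \<theta>}. hessian V (q \<theta>) *v v = 0) \<and>
        (\<forall>w. w \<bullet> velocity q \<theta> = 0 \<longrightarrow> (hessian V (q \<theta>) *v w) \<bullet> w \<ge> lam * (norm w)\<^sup>2)"
    and \<phi>: "\<forall>\<^sub>F \<delta> in at_right 0. C_k 2 (\<phi> \<delta>) \<and>
        (\<forall>\<theta>. \<phi> \<delta> (\<theta> + L) = \<phi> \<delta> \<theta>) \<and>
        (\<forall>\<theta>. \<phi> \<delta> \<theta> \<bullet> velocity q \<theta> = 0) \<and>
        stable_normally_hyperbolic (perturbed_field V G \<delta>) (\<lambda>\<theta>. q \<theta> + \<phi> \<delta> \<theta>)"
    and \<phi>_small: "\<exists>C. \<forall>\<^sub>F \<delta> in at_right 0. \<forall>\<theta>. norm (\<phi> \<delta> \<theta>) \<le> C * \<delta> \<and>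
        norm (velocity (\<phi> \<delta>) \<theta>) \<le> C * \<delta> \<and> norm (velocity (velocity (\<phi> \<delta>)) \<theta>) \<le> C * \<delta>"
    and q\<^sub>\<delta>: "\<forall>\<^sub>F \<delta> in at_right 0.
        unit_speed_reparametrization L (\<lambda>\<theta>. q \<theta> + \<phi> \<delta> \<theta>) (L\<^sub>\<delta> \<delta>) (q\<^sub>\<delta> \<delta>)"
    and \<Delta>: "\<Delta>1 > 0" "\<Delta>2 > 0"
    and b: "\<forall>\<delta>>0. stable_hyperbolic_zero (\<lambda>\<theta>. \<delta> * (G (q \<theta>) \<bullet> velocity q \<theta>)) \<theta>0 \<and>
        {\<theta>0 - \<Delta>1 .. \<theta>0 + \<Delta>2} \<subseteq> circle_basin L (\<lambda>\<theta>. \<delta> * (G (q \<theta>) \<bullet> velocity q \<theta>)) \<theta>0"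
    and \<theta>A: "(\<lambda>\<delta>. \<theta>A \<delta> - \<theta>0) \<in> O[at_right 0](\<lambda>\<delta>. \<delta>)"
    and A: "\<forall>\<^sub>F \<delta> in at_right 0. A \<delta> = q (\<theta>A \<delta>) + \<phi> \<delta> (\<theta>A \<delta>) \<and> A \<delta> = q\<^sub>\<delta> \<delta> (\<phi>A \<delta>) \<and>
        stable_fixed_point (perturbed_field V G \<delta>) (A \<delta>) \<and>
        stable_hyperbolic_zero (reduced_drift (perturbed_field V G \<delta>) (q\<^sub>\<delta> \<delta>)) (\<phi>A \<delta>) \<and>
        {\<phi>A \<delta> - \<Delta>1 .. \<phi>A \<delta> + \<Delta>2} \<subseteq>
          circle_basin (L\<^sub>\<delta> \<delta>) (reduced_drift (perturbed_field V G \<delta>) (q\<^sub>\<delta> \<delta>)) (\<phi>A \<delta>)"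
  shows "\<exists>\<delta>0>0. \<exists>C0>0. \<exists>K. \<forall>\<delta>. 0 < \<delta> \<and> \<delta> \<le> \<delta>0 \<longrightarrow>
    (let U = tube (L\<^sub>\<delta> \<delta>) (q\<^sub>\<delta> \<delta>) (C0 * sqrt \<delta>) (\<phi>A \<delta> - \<Delta>1) (\<phi>A \<delta> + \<Delta>2);
         W = quasipotential (perturbed_field V G \<delta>);
         Wred = circle_quasipotential (L\<^sub>\<delta> \<delta>) (reduced_drift (perturbed_field V G \<delta>) (q\<^sub>\<delta> \<delta>))
     in \<forall>B\<in>frontier U. W (A \<delta>) B = (INF E\<in>frontier U. W (A \<delta>) E) \<longrightarrow>
       (let \<phi>B = proj_param (L\<^sub>\<delta> \<delta>) (q\<^sub>\<delta> \<delta>) B in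
         ([\<phi>B = \<phi>A \<delta> - \<Delta>1] (rmod L\<^sub>\<delta> \<delta>) \<or> [\<phi>B = \<phi>A \<delta> + \<Delta>2] (rmod L\<^sub>\<delta> \<delta>)) \<and>
         W (A \<delta>) B < \<infinity> \<and> Wred (\<phi>A \<delta>) \<phi>B < \<infinity> \<and>
         \<bar>enn2real (W (A \<delta>) B) - enn2real (Wred (\<phi>A \<delta>) \<phi>B)\<bar> \<le> K * (\<delta> ^ 3 * \<bar>ln \<delta>\<bar> ^ 3)))"
proof -
  obtain K R c0 where data: "curve_data (grad V) G (\<lambda>x. frechet_derivative (grad V) (at x)) q (velocity q) L lam K R c0"
    by (rule curve_data_exists[OF V G q V_on_M lam hess])
  interpret D: curve_data "grad V" G "\<lambda>x. frechet_derivative (grad V) (at x)" q "velocity q" L lam K R c0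
    by (rule data)
  define \<beta> where "\<beta> \<theta> = G (q \<theta>) \<bullet> velocity q \<theta>" for \<theta>
  define B where "B = K * 1 + K * K"
  have B: "B > 0" using D.K by (simp add: B_def add_pos_pos)
  have \<beta>_lip: "\<bar>\<beta> s - \<beta> t\<bar> \<le> B * \<bar>s - t\<bar>" for s t
    unfolding \<beta>_def B_def by (rule D.drift_Lipschitz)
  \<comment> \<open>The signs of the drift are the same for all positive \<open>\<delta>\<close>, so
    they are read off at \<open>\<delta> = 1\<close>.\<close>
  have b1: "stable_hyperbolic_zero \<beta> \<theta>0" "{\<theta>0 - \<Delta>1..\<theta>0 + \<Delta>2} \<subseteq> circle_basin L \<beta> \<theta>0"
    using b[rule_format, of 1] unfolding \<beta>_def by simp_all
  have \<beta>_per: "\<beta> (x + L) = \<beta> x" for x by (simp add: \<beta>_def D.q_per D.q'_per)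
  note win = circle_basin_window[OF \<beta>_lip \<beta>_per D.L b1(1) \<Delta> b1(2)]
  define gap where "gap = L - (\<Delta>1 + \<Delta>2)"
  have gap: "gap > 0" using win(3) by (simp add: gap_def)
  \<comment> \<open>Half of the smaller end drift: \<open>h\<close> is chosen so that moving by
    \<open>2 * h\<close> changes \<open>\<beta>\<close> by at most \<open>m\<close>, which leaves
    size \<open>m\<close>.\<close>
  define m where "m = min (- \<beta> (\<theta>0 + \<Delta>2)) (\<beta> (\<theta>0 - \<Delta>1)) / 2"
  have m: "m > 0" "\<beta> (\<theta>0 + \<Delta>2) \<le> - (2 * m)" "\<beta> (\<theta>0 - \<Delta>1) \<ge> 2 * m"
    using win(1)[of "\<theta>0 + \<Delta>2"] win(2)[of "\<theta>0 - \<Delta>1"] \<Delta> by (auto simp: m_def)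
  define h where "h = min (gap / 8) (m / (2 * B))"
  have h: "h > 0" "h \<le> gap / 8" "B * (2 * h) \<le> m"
    using gap m B by (auto simp: h_def min_def field_simps)
  have \<beta>_hi: "\<beta> \<theta> \<le> - m" if "\<bar>\<theta> - (\<theta>0 + \<Delta>2)\<bar> \<le> 2 * h" for \<theta>
  proof -
    have "B * \<bar>\<theta> - (\<theta>0 + \<Delta>2)\<bar> \<le> B * (2 * h)" using that B by (intro mult_left_mono) auto
    then have "\<bar>\<beta> \<theta> - \<beta> (\<theta>0 + \<Delta>2)\<bar> \<le> m" using \<beta>_lip[of \<theta> "\<theta>0 + \<Delta>2"] h(3) by simp
    then show ?thesis using m by linarith
  qed
  have \<beta>_lo: "\<beta> \<theta> \<ge> m" if "\<bar>\<theta> - (\<theta>0 - \<Delta>1)\<bar> \<le> 2 * h" for \<theta>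
  proof -
    have "B * \<bar>\<theta> - (\<theta>0 - \<Delta>1)\<bar> \<le> B * (2 * h)" using that B by (intro mult_left_mono) auto
    then have "\<bar>\<beta> \<theta> - \<beta> (\<theta>0 - \<Delta>1)\<bar> \<le> m" using \<beta>_lip[of \<theta> "\<theta>0 - \<Delta>1"] h(3) by simp
    then show ?thesis using m by linarith
  qed
  obtain C' where C': "\<forall>\<^sub>F \<delta> in at_right 0. \<forall>\<theta>. norm (\<phi> \<delta> \<theta>) \<le> C' * \<delta> \<and>
        norm (velocity (\<phi> \<delta>) \<theta>) \<le> C' * \<delta> \<and> norm (velocity (velocity (\<phi> \<delta>)) \<theta>) \<le> C' * \<delta>"
    using \<phi>_small by blast
  define C where "C = max C' 1"
  have C: "C \<ge> 1" by (simp add: C_def)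
  obtain CA where CA: "\<forall>\<^sub>F \<delta> in at_right 0. norm (\<theta>A \<delta> - \<theta>0) \<le> CA * norm \<delta>"
    using landau_o.bigE[OF \<theta>A] by blast
  \<comment> \<open>The first entry is the curvature bound of the perturbed curves; the second makes
    the spare length \<open>1 / (4 * K1)\<close> at most \<open>gap / 16\<close>.\<close>
  define K1 where "K1 = max (16 * K) (4 / gap)"
  have K1: "K1 \<ge> 16 * K" "K1 > 0" "1 / (4 * K1) \<le> gap / 16"
  proof -
    show "K1 \<ge> 16 * K" by (simp add: K1_def)
    then show K1: "K1 > 0" using D.K by simp
    have "4 / gap \<le> K1" by (simp add: K1_def)
    then show "1 / (4 * K1) \<le> gap / 16" using gap K1 by (simp add: field_simps)
  qed
  define M where "M = 7 * K * C\<^sup>2"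
  define \<mu> where "\<mu> = lam / 2"
  define N where "N = 9 / 4 * (8 * K1 * M + 4 * M)\<^sup>2 / \<mu>\<^sup>2"
  have M: "M > 0" using D.K C by (simp add: M_def)
  have \<mu>: "\<mu> > 0" using lam by (simp add: \<mu>_def)
  have N: "N \<ge> 0" by (simp add: N_def)
  have rhs: "2 * M * (\<Delta>1 + \<Delta>2) + m * h > 0" using M \<Delta> m h by (simp add: add_pos_pos)
  \<comment> \<open>The lateral barrier at distance \<open>C0 * sqrt \<delta>\<close> is
    \<open>\<mu> / 2 * C0\<^sup>2 * \<delta>\<close>; the radicand makes it equal to a bound for the
    potential at the ends plus \<open>m * h * \<delta>\<close>.\<close>
  define C0 where "C0 = sqrt (2 / \<mu> * (2 * M * (\<Delta>1 + \<Delta>2) + m * h))"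
  have C0: "C0 > 0" "\<mu> / 2 * C0\<^sup>2 = 2 * M * (\<Delta>1 + \<Delta>2) + m * h"
    using rhs \<mu> by (simp_all add: C0_def)
  have lim: "((\<lambda>\<delta>::real. \<delta>) \<longlongrightarrow> 0) (at_right 0)" by (rule tendsto_ident_at)
  note lims = tendsto_mult[OF tendsto_const] tendsto_add tendsto_power[OF lim] tendsto_real_sqrt[OF lim] lim
  \<comment> \<open>Each left-hand side tends to 0 with \<open>\<delta>\<close>, and each right-hand
    side is a fixed positive number.\<close>
  have ev: "\<forall>\<^sub>F \<delta> in at_right 0. C * \<delta> < c0 / 2"
    "\<forall>\<^sub>F \<delta> in at_right 0. C0 * sqrt \<delta> < c0 / (64 * K1)"
    "\<forall>\<^sub>F \<delta> in at_right 0. 4 * lam * C\<^sup>2 * \<delta>\<^sup>2 + K * C * \<delta> + K * \<delta> + K * (C0 * sqrt \<delta>) < lam / 2"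
    "\<forall>\<^sub>F \<delta> in at_right 0. 16 * M\<^sup>2 * \<delta> < \<mu>\<^sup>2"
    "\<forall>\<^sub>F \<delta> in at_right 0. N * \<delta>\<^sup>2 < 1 / 2"
    "\<forall>\<^sub>F \<delta> in at_right 0. (C * L) * \<delta> < gap / 8"
    "\<forall>\<^sub>F \<delta> in at_right 0. (C * (2 * (\<Delta>1 + \<Delta>2 + h))) * \<delta> + CA * \<delta> < h"
    "\<forall>\<^sub>F \<delta> in at_right 0. 6 * K * C\<^sup>2 * \<delta> < m / 2"
    "\<forall>\<^sub>F \<delta> in at_right 0. 4 * N * M * (\<Delta>1 + \<Delta>2 + h) * \<delta>\<^sup>2 < m * h"
    "\<forall>\<^sub>F \<delta> in at_right 0. \<delta> < exp (- 1 :: real)"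
    by (rule eventually_at_right_0_less, (rule lims)+, use D.c0 K1 lam \<mu> gap h m in simp)+
  have "\<forall>\<^sub>F \<delta> in at_right 0. \<delta> > (0::real)" by (rule eventually_at_right_less)
  note all = eventually_conj[OF ev(1) eventually_conj[OF ev(2) eventually_conj[OF ev(3) eventually_conj[OF ev(4)
    eventually_conj[OF ev(5) eventually_conj[OF ev(6) eventually_conj[OF ev(7) eventually_conj[OF ev(8)
    eventually_conj[OF ev(9) eventually_conj[OF ev(10) eventually_conj[OF \<phi> eventually_conj[OF C'
    eventually_conj[OF q\<^sub>\<delta> eventually_conj[OF CA A]]]]]]]]]]]]]]
  obtain d where d: "d > 0" and good: "\<And>\<delta>. 0 < \<delta> \<Longrightarrow> \<delta> < d \<Longrightarrow> C * \<delta> < c0 / 2 \<and>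
      C0 * sqrt \<delta> < c0 / (64 * K1) \<and>
      4 * lam * C\<^sup>2 * \<delta>\<^sup>2 + K * C * \<delta> + K * \<delta> + K * (C0 * sqrt \<delta>) < lam / 2 \<and>
      16 * M\<^sup>2 * \<delta> < \<mu>\<^sup>2 \<and> N * \<delta>\<^sup>2 < 1 / 2 \<and> (C * L) * \<delta> < gap / 8 \<and>
      (C * (2 * (\<Delta>1 + \<Delta>2 + h))) * \<delta> + CA * \<delta> < h \<and>
      6 * K * C\<^sup>2 * \<delta> < m / 2 \<and> 4 * N * M * (\<Delta>1 + \<Delta>2 + h) * \<delta>\<^sup>2 < m * h \<and> \<delta> < exp (- 1) \<and>
      (C_k 2 (\<phi> \<delta>) \<and> (\<forall>\<theta>. \<phi> \<delta> (\<theta> + L) = \<phi> \<delta> \<theta>) \<and> (\<forall>\<theta>. \<phi> \<delta> \<theta> \<bullet> velocity q \<theta> = 0) \<and>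
        stable_normally_hyperbolic (perturbed_field V G \<delta>) (\<lambda>\<theta>. q \<theta> + \<phi> \<delta> \<theta>)) \<and>
      (\<forall>\<theta>. norm (\<phi> \<delta> \<theta>) \<le> C' * \<delta> \<and> norm (velocity (\<phi> \<delta>) \<theta>) \<le> C' * \<delta> \<and>
        norm (velocity (velocity (\<phi> \<delta>)) \<theta>) \<le> C' * \<delta>) \<and>
      unit_speed_reparametrization L (\<lambda>\<theta>. q \<theta> + \<phi> \<delta> \<theta>) (L\<^sub>\<delta> \<delta>) (q\<^sub>\<delta> \<delta>) \<and>
      norm (\<theta>A \<delta> - \<theta>0) \<le> CA * norm \<delta> \<and>
      A \<delta> = q (\<theta>A \<delta>) + \<phi> \<delta> (\<theta>A \<delta>) \<and> A \<delta> = q\<^sub>\<delta> \<delta> (\<phi>A \<delta>) \<and>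
      stable_fixed_point (perturbed_field V G \<delta>) (A \<delta>) \<and>
      stable_hyperbolic_zero (reduced_drift (perturbed_field V G \<delta>) (q\<^sub>\<delta> \<delta>)) (\<phi>A \<delta>) \<and>
      {\<phi>A \<delta> - \<Delta>1 .. \<phi>A \<delta> + \<Delta>2} \<subseteq>
        circle_basin (L\<^sub>\<delta> \<delta>) (reduced_drift (perturbed_field V G \<delta>) (q\<^sub>\<delta> \<delta>)) (\<phi>A \<delta>)"
    using all unfolding eventually_at_right_field by blast
  \<comment> \<open>The product of \<open>N * \<delta>\<^sup>2\<close> and the bound
    \<open>2 * M * \<delta> * (\<Delta>1 + \<Delta>2)\<close> for the potential, stripped of the
    powers of \<open>\<delta>\<close>.\<close>
  define Kf where "Kf = 2 * N * M * (\<Delta>1 + \<Delta>2)"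
  show ?thesis
  \<comment> \<open>\<open>good\<close> requires \<open>\<delta> < d\<close> strictly, hence the
    half.\<close>
  proof (rule exI[of _ "d / 2"], rule conjI, use d in simp, rule exI[of _ C0], rule conjI[OF C0(1)],
      rule exI[of _ Kf], intro allI impI, goal_cases)
    case (1 \<delta>)
    then have \<delta>: "0 < \<delta>" "\<delta> < d" using d by auto
    note gd = good[OF \<delta>]
    have C'C: "C' * \<delta> \<le> C * \<delta>" using \<delta>(1) by (intro mult_right_mono) (auto simp: C_def)
    interpret P: perturbed_curve "grad V" G "\<lambda>x. frechet_derivative (grad V) (at x)" q "velocity q" L lam K R c0
      \<delta> C "\<theta>A \<delta>" "\<phi>A \<delta>" "\<phi> \<delta>" "velocity (\<phi> \<delta>)" "q\<^sub>\<delta> \<delta>" "velocity (q\<^sub>\<delta> \<delta>)" "velocity (velocity (q\<^sub>\<delta> \<delta>))"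
      "L\<^sub>\<delta> \<delta>" "perturbed_field V G \<delta>"
    proof (rule unit_speed_reparametrization_perturbed_curve[OF data C \<delta>(1)])
      show "\<forall>\<theta>. norm (\<phi> \<delta> \<theta>) \<le> C * \<delta> \<and> norm (velocity (\<phi> \<delta>) \<theta>) \<le> C * \<delta> \<and>
          norm (velocity (velocity (\<phi> \<delta>)) \<theta>) \<le> C * \<delta>"
        using gd C'C by (meson order_trans)
    qed (use gd in auto)
    let ?b = "reduced_drift (perturbed_field V G \<delta>) (q\<^sub>\<delta> \<delta>)"
    have b_eq: "?b = P.b" by (rule ext) (simp add: P.b_def reduced_drift_def)
    obtain B where B: "\<And>s t. \<bar>P.b s - P.b t\<bar> \<le> B * \<bar>s - t\<bar>" using P.b_Lipschitz by blast
    have stable: "stable_hyperbolic_zero P.b (\<phi>A \<delta>)"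
      "{\<phi>A \<delta> - \<Delta>1 .. \<phi>A \<delta> + \<Delta>2} \<subseteq> circle_basin (L\<^sub>\<delta> \<delta>) P.b (\<phi>A \<delta>)"
      using gd unfolding b_eq by auto
    note win_\<delta> = circle_basin_window[OF B P.b_per P.Ld stable(1) \<Delta> stable(2)]
    obtain \<Phi> S where "reduced_flow (q\<^sub>\<delta> \<delta>) (velocity (q\<^sub>\<delta> \<delta>)) (velocity (velocity (q\<^sub>\<delta> \<delta>))) (L\<^sub>\<delta> \<delta>) K1 (c0 / 4)
      (perturbed_field V G \<delta>) P.b \<Phi> M \<delta> \<mu> (C0 * sqrt \<delta>) (N * \<delta>\<^sup>2) (\<phi>A \<delta>)
      (\<phi>A \<delta> - \<Delta>1) (\<phi>A \<delta> + \<Delta>2) (\<phi>A \<delta> - \<Delta>1 - h) (\<phi>A \<delta> + \<Delta>2 + h) S (m * h * \<delta> / 2)"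
    proof (rule P.reduced_flow_instance[OF \<Delta> h(1) m(1) C0(1) K1(1) _ _ _ win_\<delta>(1,2) M_def \<mu>_def N_def C0(2)])
      show "G (q \<theta>) \<bullet> velocity q \<theta> \<le> - m" if "\<bar>\<theta> - (\<theta>0 + \<Delta>2)\<bar> \<le> 2 * h" for \<theta>
        using \<beta>_hi[OF that] by (simp add: \<beta>_def)
      show "m \<le> G (q \<theta>) \<bullet> velocity q \<theta>" if "\<bar>\<theta> - (\<theta>0 - \<Delta>1)\<bar> \<le> 2 * h" for \<theta>
        using \<beta>_lo[OF that] by (simp add: \<beta>_def)
      show "\<bar>\<theta>A \<delta> - \<theta>0\<bar> \<le> CA * \<delta>" using gd \<delta>(1) by simp
      show "\<Delta>1 + \<Delta>2 + 2 * h + 1 / (4 * K1) < L - C * \<delta> * L"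
      proof -
        \<comment> \<open>\<open>\<Delta>1 + \<Delta>2\<close> is \<open>L - gap\<close>, and the
          three corrections are at most \<open>gap / 4\<close>, \<open>gap / 16\<close> and
          \<open>gap / 8\<close>.\<close>
        have "(C * L) * \<delta> < gap / 8" using gd by blast
        moreover have "(C * L) * \<delta> = C * \<delta> * L" by simp
        ultimately show ?thesis using h(2) K1(3) gap unfolding gap_def by argo
      qed
      show "C * \<delta> * (2 * (\<Delta>1 + \<Delta>2 + h)) + CA * \<delta> \<le> h"
      proof -
        have "(C * (2 * (\<Delta>1 + \<Delta>2 + h))) * \<delta> + CA * \<delta> < h" using gd by blast
        moreover have "(C * (2 * (\<Delta>1 + \<Delta>2 + h))) * \<delta> = C * \<delta> * (2 * (\<Delta>1 + \<Delta>2 + h))" by simp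
        ultimately show ?thesis by linarith
      qed
    qed (use gd in \<open>blast intro: less_imp_le\<close>)+
    then interpret RF: reduced_flow "q\<^sub>\<delta> \<delta>" "velocity (q\<^sub>\<delta> \<delta>)" "velocity (velocity (q\<^sub>\<delta> \<delta>))" "L\<^sub>\<delta> \<delta>" K1 "c0 / 4"
      "perturbed_field V G \<delta>" P.b \<Phi> M \<delta> \<mu> "C0 * sqrt \<delta>" "N * \<delta>\<^sup>2" "\<phi>A \<delta>"
      "\<phi>A \<delta> - \<Delta>1" "\<phi>A \<delta> + \<Delta>2" "\<phi>A \<delta> - \<Delta>1 - h" "\<phi>A \<delta> + \<Delta>2 + h" S "m * h * \<delta> / 2" .
    have A\<delta>: "A \<delta> = q\<^sub>\<delta> \<delta> (\<phi>A \<delta>)" using gd by blast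
    show ?case
      unfolding Let_def b_eq A\<delta>
    proof (intro ballI impI)
      fix Z
      let ?W = "quasipotential (perturbed_field V G \<delta>) (q\<^sub>\<delta> \<delta> (\<phi>A \<delta>))"
      let ?fr = "frontier (tube (L\<^sub>\<delta> \<delta>) (q\<^sub>\<delta> \<delta>) (C0 * sqrt \<delta>) (\<phi>A \<delta> - \<Delta>1) (\<phi>A \<delta> + \<Delta>2))"
      let ?p = "proj_param (L\<^sub>\<delta> \<delta>) (q\<^sub>\<delta> \<delta>) Z"
      let ?R = "circle_quasipotential (L\<^sub>\<delta> \<delta>) P.b (\<phi>A \<delta>) ?p"
      assume Z: "Z \<in> ?fr" "?W Z = (INF E\<in>?fr. ?W E)"
      obtain e where e: "e = \<phi>A \<delta> - \<Delta>1 \<or> e = \<phi>A \<delta> + \<Delta>2" "[?p = e] (rmod L\<^sub>\<delta> \<delta>)"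
        "?W Z \<le> ?R" "?R \<le> ennreal (\<Phi> e)" "ennreal ((1 - N * \<delta>\<^sup>2) * \<Phi> e) \<le> ?W Z"
        by (rule RF.quasipotential_minimizer[OF Z])
      have fin: "?R < \<infinity>" "?W Z < \<infinity>"
      proof -
        show 1: "?R < \<infinity>" using e(4) by (rule order_le_less_trans) simp
        show "?W Z < \<infinity>" using e(3) 1 by (rule order_le_less_trans)
      qed
      define w where "w = enn2real (?W Z)"
      define r where "r = enn2real ?R"
      have wr: "?W Z = ennreal w" "?R = ennreal r" "w \<ge> 0" "r \<ge> 0"
        using fin by (simp_all add: w_def r_def less_top)
      have \<Phi>e: "0 \<le> \<Phi> e" using RF.pot_nonneg[of e] e(1) \<Delta> h(1) by auto
      \<comment> \<open>Both numbers lie between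
        \<open>(1 - N * \<delta>\<^sup>2) * \<Phi> e\<close> and \<open>\<Phi> e\<close>, an
        interval of length \<open>N * \<delta>\<^sup>2 * \<Phi> e\<close>.\<close>
      have "w \<le> r" using e(3) unfolding wr using wr(4) by (simp add: ennreal_le_iff)
      moreover have "r \<le> \<Phi> e" using e(4) unfolding wr using \<Phi>e by (simp add: ennreal_le_iff)
      moreover have "(1 - N * \<delta>\<^sup>2) * \<Phi> e \<le> w" using e(5) unfolding wr using wr(3) by (simp add: ennreal_le_iff)
      ultimately have "\<bar>w - r\<bar> \<le> N * \<delta>\<^sup>2 * \<Phi> e" by (simp add: algebra_simps)
      also have "\<dots> \<le> N * \<delta>\<^sup>2 * (2 * M * \<delta> * (\<Delta>1 + \<Delta>2))"
      proof (rule mult_left_mono)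
        have "\<Phi> e \<le> 2 * M * \<delta> * \<bar>e - \<phi>A \<delta>\<bar>" using RF.potential_Lipschitz[of e "\<phi>A \<delta>"] RF.pot(2) by simp
        also have "\<dots> \<le> 2 * M * \<delta> * (\<Delta>1 + \<Delta>2)" using e(1) \<Delta> M \<delta> by (intro mult_left_mono) auto
        finally show "\<Phi> e \<le> 2 * M * \<delta> * (\<Delta>1 + \<Delta>2)" .
      qed (use N in simp)
      also have "\<dots> = Kf * (\<delta> ^ 3 * 1)" by (simp add: Kf_def power2_eq_square power3_eq_cube)
      also have "\<dots> \<le> Kf * (\<delta> ^ 3 * \<bar>ln \<delta>\<bar> ^ 3)"
      proof -
        \<comment> \<open>The bound obtained so far is of order \<open>\<delta> ^ 3\<close>;
          \<open>\<delta> < exp (- 1)\<close> gives \<open>\<bar>ln \<delta>\<bar> \<ge> 1\<close>,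
          which brings it to the stated form.\<close>
        have "ln \<delta> < ln (exp (- 1))" using gd \<delta>(1) by (subst ln_less_cancel_iff) auto
        then have "\<bar>ln \<delta>\<bar> \<ge> 1" by simp
        then have "1 \<le> \<bar>ln \<delta>\<bar> ^ 3" by (rule one_le_power)
        then show ?thesis using \<delta>(1) N M \<Delta> by (intro mult_left_mono) (auto simp: Kf_def)
      qed
      finally have "\<bar>w - r\<bar> \<le> Kf * (\<delta> ^ 3 * \<bar>ln \<delta>\<bar> ^ 3)" .
      then show "([?p = \<phi>A \<delta> - \<Delta>1] (rmod L\<^sub>\<delta> \<delta>) \<or> [?p = \<phi>A \<delta> + \<Delta>2] (rmod L\<^sub>\<delta> \<delta>)) \<and>
         ?W Z < \<infinity> \<and> ?R < \<infinity> \<and> \<bar>enn2real (?W Z) - enn2real ?R\<bar> \<le> Kf * (\<delta> ^ 3 * \<bar>ln \<delta>\<bar> ^ 3)"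
        using e(1,2) fin unfolding w_def r_def by auto
    qed
  qed
qed

end
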